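(* Consider Bernoulli site percolation on the square lattice $(\mathbb{Z}^2,\mathbb{E}^2)$ at the critical parameter $p = p_c = p_c^{\mathrm{site}}(\mathbb{Z}^2)$, and let $\alpha_2$ and $\alpha_4$ be the (polychromatic, alternating) two-arm and four-arm exponents, defined by $$\alpha_k := -\limsup_{n\to\infty} \frac{\log \pi_k(n)}{\log n}, \qquad k \in \{2,4\},$$ where $\pi_k(n)$ is the probability under $\mathbb{P}_{p_c}$ of the $k$-arm event in the annulus $\{v \in \mathbb{Z}^2 : 1 \le \|v\|_\infty \le n\}$. Then $$\alpha_4 \geq 1 + \frac{\alpha_2}{2}.$$
   Context: Lattice: the vertex set is $\mathbb{Z}^2$; two vertices $v,v'$ are adjacent, $v\sim v'$, if $\|v-v'\|_2=1$. The matching lattice ( *-lattice) has the same vertex set, and is obtained by adding the two diagonal edges to each face of the square lattice, so that $v \sim^* v'$ if and only if $\|v-v'\|_\infty = 1$. A path (resp. *-path) is a finite sequence of vertices $v_0,\dots,v_m$ ($m\ge 1$) with $v_i \sim v_{i+1}$ (resp. $v_i \sim^* v_{i+1}$) for all $i = 0, \ldots, m-1$. Percolation: each vertex of $\mathbb{Z}^2$ is declared open with probability $p$ and closed with probability $1-p$, independently of the other vertices; $\mathbb{P}_p$ is the corresponding product measure on $\{0,1\}^{\mathbb{Z}^2}$ ($1$ = open, $0$ = closed). An open path is a path all of whose vertices are open; a closed *-path is a *-path all of whose vertices are closed. Open clusters are the maximal connected components (for $\sim$) of open vertices. The critical parameter $p_c = p_c^{\mathrm{site}}(\mathbb{Z}^2)$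 is the percolation threshold: for $p<p_c$ there is almost surely no infinite open cluster, and for $p>p_c$ there is almost surely a (unique) infinite open cluster. Arm events: for integers $n\ge 0$ let $B_n := [-n,n]^2 \cap \mathbb{Z}^2$, and for $1\le n_1<n_2$ let $A_{n_1,n_2} := B_{n_2}\setminus B_{n_1-1}$. For $k\ge 1$, let $\mathcal{A}_k(A_{n_1,n_2})$ be the event that there exist $k$ pairwise disjoint (sharing no vertex) paths $\gamma_1,\dots,\gamma_k$ contained in $A_{n_1,n_2}$, in counter-clockwise order around the annulus, each connecting a vertex $v$ with $\|v\|_\infty=n_1$ to a vertex $v'$ with $\|v'\|_\infty=n_2$, such that $\gamma_i$ is an open path if $i$ is odd and a closed *-path if $i$ is even. Set $\pi_k(n_1,n_2) := \mathbb{P}_{p_c}(\mathcal{A}_k(A_{n_1,n_2}))$, and for $k\in\{2,4\}$, $\pi_k(n) := \pi_k(1,n)$ for $n\ge 2$. It is a standard fact that $\alpha_k\in(0,\infty)$. *)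

theory Defs
  imports "HOL-Probability.Probability"
begin

type_synonym vertex = "int \<times> int"

definition adj :: "vertex \<Rightarrow> vertex \<Rightarrow> bool" where
  "adj v w \<longleftrightarrow> norm (real_of_int (fst v - fst w), real_of_int (snd v - snd w)) = 1"

definition norm_inf :: "vertex \<Rightarrow> int" where
  "norm_inf v = max \<bar>fst v\<bar> \<bar>snd v\<bar>"

definition star_adj :: "vertex \<Rightarrow> vertex \<Rightarrow> bool" where
  "star_adj v w \<longleftrightarrow> norm_inf (v - w) = 1"

text \<open>A path has at least one step (two vertices) and need not be self-avoiding.\<close>

definition is_path :: "vertex list \<Rightarrow> bool" where
  "is_path \<gamma> \<longleftrightarrow> 2 \<le> length \<gamma> \<and> successively adj \<gamma>"

definition is_star_path :: "vertex list \<Rightarrow> bool" where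
  "is_star_path \<gamma> \<longleftrightarrow> 2 \<le> length \<gamma> \<and> successively star_adj \<gamma>"

text \<open>In a configuration, \<open>True\<close> means open and \<open>False\<close> means closed.\<close>

type_synonym config = "vertex \<Rightarrow> bool"

definition open_path :: "config \<Rightarrow> vertex list \<Rightarrow> bool" where
  "open_path \<omega> \<gamma> \<longleftrightarrow> is_path \<gamma> \<and> (\<forall>v\<in>set \<gamma>. \<omega> v)"

definition closed_star_path :: "config \<Rightarrow> vertex list \<Rightarrow> bool" where
  "closed_star_path \<omega> \<gamma> \<longleftrightarrow> is_star_path \<gamma> \<and> (\<forall>v\<in>set \<gamma>. \<not> \<omega> v)"

definition percolation :: "real \<Rightarrow> config measure" where
  "percolation p = Pi\<^sub>M UNIV (\<lambda>_. measure_pmf (bernoulli_pmf p))"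

definition open_cluster :: "config \<Rightarrow> vertex \<Rightarrow> vertex set" where
  "open_cluster \<omega> v = {w. \<omega> v \<and> (\<lambda>x y. \<omega> x \<and> \<omega> y \<and> adj x y)\<^sup>*\<^sup>* v w}"

definition has_infinite_cluster :: "config \<Rightarrow> bool" where
  "has_infinite_cluster \<omega> \<longleftrightarrow> (\<exists>v. infinite (open_cluster \<omega> v))"

definition p_c :: real where
  "p_c = Sup {p \<in> {0..1}. AE \<omega> in percolation p. \<not> has_infinite_cluster \<omega>}"

definition ball_inf :: "nat \<Rightarrow> vertex set" where
  "ball_inf n = {v. norm_inf v \<le> int n}"

text \<open>Only used for \<open>1 \<le> n1\<close>, so the subtraction does not truncate.\<close>

definition annulus :: "nat \<Rightarrow> nat \<Rightarrow> vertex set" where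
  "annulus n1 n2 = ball_inf n2 - ball_inf (n1 - 1)"

definition ccw_ordered :: "nat \<Rightarrow> (nat \<Rightarrow> vertex) \<Rightarrow> bool" where
  "ccw_ordered k e \<longleftrightarrow>
    (\<exists>\<theta> :: nat \<Rightarrow> real.
      (\<forall>i\<in>{1..k}. \<exists>r>0. Complex (of_int (fst (e i))) (of_int (snd (e i))) = rcis r (\<theta> i)) \<and>
      strict_mono_on {1..k} \<theta> \<and> \<theta> k < \<theta> 1 + 2 * pi)"

text \<open>
  The cyclic order of the arms around the annulus is read off from their endpoints on the
  outer boundary. Starting points on the inner boundary would not do: a diagonal step of a
  closed *-path such as from \<open>(n1, n1 - 1)\<close> to \<open>(n1 - 1, n1)\<close> passes below the
  corner \<open>(n1, n1)\<close>, where an open arm may start, so the order of the starting points can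
  differ from that of the arms. At the outer corners this cannot happen, because the corner
  cut off by such a step is then not reachable by an open path.
\<close>

definition arm_event :: "nat \<Rightarrow> nat \<Rightarrow> nat \<Rightarrow> config set" where
  "arm_event k n1 n2 =
    {\<omega>. \<exists>\<gamma> :: nat \<Rightarrow> vertex list.
       (\<forall>i\<in>{1..k}.
          (if odd i then open_path \<omega> (\<gamma> i) else closed_star_path \<omega> (\<gamma> i)) \<and>
          set (\<gamma> i) \<subseteq> annulus n1 n2 \<and>
          norm_inf (hd (\<gamma> i)) = int n1 \<and> norm_inf (last (\<gamma> i)) = int n2) \<and>
       disjoint_family_on (\<lambda>i. set (\<gamma> i)) {1..k} \<and>
       ccw_ordered k (\<lambda>i. last (\<gamma> i))}"

definition arm_prob :: "nat \<Rightarrow> nat \<Rightarrow> nat \<Rightarrow> real" where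
  "arm_prob k n1 n2 = measure (percolation p_c) (arm_event k n1 n2)"

definition arm_exponent :: "nat \<Rightarrow> ereal" where
  "arm_exponent k = - limsup (\<lambda>n. ereal (ln (arm_prob k 1 n) / ln (real n)))"

end

theory Submission
  imports Defs
begin

text \<open>
  Fix a box of radius \<open>3 n\<close> and count the clusters of one colour that touch its boundary. Changing the
  colour of a vertex \<open>u\<close> changes this number \<open>N\<close> only if the two-arm event \<open>J u\<close> holds, that is, if \<open>u\<close>
  has an arm of each colour, and four arms around \<open>u\<close> allow to make \<open>u\<close> join two such clusters. So the
  four-arm probabilities are bounded by the influences of the vertices on \<open>N\<close>, whose sum is the
  expectation of \<open>N\<close> times the sum of the centred colours of the vertices \<open>u\<close> satisfying \<open>J u\<close>. The terms
  of the latter sum have nonpositive correlations: changing the colour of \<open>w\<close> affects \<open>J u\<close> only through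
  arms using \<open>w\<close>, and the effects on \<open>J u\<close> and on \<open>J w\<close> have opposite signs. By the Cauchy--Schwarz
  inequality, \<open>n\<^sup>2 \<pi>\<^sub>4\<close> is at most a constant times the square root of \<open>n\<^sup>2 \<pi>\<^sub>2\<close>, provided that \<open>N\<close>, restricted
  to clusters that reach the inner box, has bounded second moment.

  Exploring the clusters one by one, this holds as soon as an annulus has no crossing of the colour
  considered with probability bounded below. By duality one of the two colours has likely crossings
  of squares at two comparable scales, and an argument of Bollobas and Riordan turns these into
  circuits around the annulus. All constants depend on the critical parameter only, which is neither
  0 nor 1 by a Peierls argument.
\<close>


text \<open>One Boolean \<open>s\<close> carries the adjacency, \<open>True\<close> meaning
  *-adjacency, and in the application also the colour, since closed vertices come with *-adjacency.
  Site percolation on the square lattice is not self-dual: which colour crosses easily is unknown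
  and may depend on the scale. Hence every estimate is proved for both values of \<open>s\<close>,
  and the value is chosen anew at each scale. The number \<open>N\<close> also counts the many small
  clusters along the boundary, so its own second moment is of no use. It is replaced by the
  difference \<open>F\<close> between \<open>N\<close> after deletion of the inner box and
  \<open>N\<close>: the first term ignores the colours of the inner box, so \<open>F\<close> has the
  same influences up to sign, and \<open>F\<close> is at most the number of clusters crossing the
  annulus. Planar topology enters through parities only, namely the number of crossings of a ray and
  the side of an interface; no Jordan curve theorem is used. Probability is done with finite
  weighted sums, and the product measure is needed only for the critical parameter and for the final
  translation.\<close>

definition gadj :: "bool \<Rightarrow> vertex \<Rightarrow> vertex \<Rightarrow> bool" where
  "gadj s v w \<longleftrightarrow> (if s then star_adj v w else adj v w)"

definition rect :: "int \<Rightarrow> int \<Rightarrow> int \<Rightarrow> int \<Rightarrow> vertex set" where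
  "rect a b c d = {a..b} \<times> {c..d}"

text \<open>Reachability inside a vertex set replaces lists of vertices, so paths can be joined,
  restricted and mapped freely; lists return only in the translation to the arm events. The conjunct
  \<open>x \<in> X\<close> rules out the empty path at a vertex outside \<open>X\<close>.\<close>

definition conn :: "bool \<Rightarrow> vertex set \<Rightarrow> vertex \<Rightarrow> vertex \<Rightarrow> bool" where
  "conn s X x y \<longleftrightarrow> x \<in> X \<and> (\<lambda>u v. u \<in> X \<and> v \<in> X \<and> gadj s u v)\<^sup>*\<^sup>* x y"

section \<open>Adjacency in coordinates and connection inside a set\<close>

lemma adj_iff: "adj v w \<longleftrightarrow> \<bar>fst v - fst w\<bar> + \<bar>snd v - snd w\<bar> = 1"
proof -
  have "norm (real_of_int i, real_of_int j) = 1 \<longleftrightarrow> \<bar>i\<bar> + \<bar>j\<bar> = 1" for i j :: int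
  proof -
    have "norm (real_of_int i, real_of_int j) = 1 \<longleftrightarrow> (real_of_int i)\<^sup>2 + (real_of_int j)\<^sup>2 = 1"
      by (simp add: norm_Pair)
    also have "\<dots> \<longleftrightarrow> i\<^sup>2 + j\<^sup>2 = 1"
      by (metis (mono_tags) of_int_1 of_int_add of_int_eq_iff of_int_power)
    also have "\<dots> \<longleftrightarrow> \<bar>i\<bar> + \<bar>j\<bar> = 1"
    proof
      assume h: "i\<^sup>2 + j\<^sup>2 = 1"
      have "i\<^sup>2 \<le> 1" "j\<^sup>2 \<le> 1" using h by (smt (verit) zero_le_power2)+
      then have "\<bar>i\<bar> \<le> 1" "\<bar>j\<bar> \<le> 1" by (simp_all add: abs_square_le_1)
      then have "i \<in> {-1,0,1}" "j \<in> {-1,0,1}" by auto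
      then show "\<bar>i\<bar> + \<bar>j\<bar> = 1" using h by auto
    next
      assume h: "\<bar>i\<bar> + \<bar>j\<bar> = 1"
      then have "i \<in> {-1,0,1}" "j \<in> {-1,0,1}" by auto
      then show "i\<^sup>2 + j\<^sup>2 = 1" using h by auto
    qed
    finally show ?thesis .
  qed
  from this[of "fst v - fst w" "snd v - snd w"] show ?thesis unfolding adj_def .
qed

lemma star_adj_iff: "star_adj v w \<longleftrightarrow> max \<bar>fst v - fst w\<bar> \<bar>snd v - snd w\<bar> = 1"
  by (simp add: star_adj_def norm_inf_def)

lemma gadj_iff: "gadj s v w \<longleftrightarrow>
    (if s then max \<bar>fst v - fst w\<bar> \<bar>snd v - snd w\<bar> = 1 else \<bar>fst v - fst w\<bar> + \<bar>snd v - snd w\<bar> = 1)"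
  by (simp add: gadj_def adj_iff star_adj_iff)

lemma gadj_sym: "gadj s v w \<longleftrightarrow> gadj s w v"
  by (auto simp: gadj_iff abs_minus_commute)

lemma gadj_irrefl [simp]: "\<not> gadj s v v"
  by (auto simp: gadj_iff)

lemma gadj_False_imp: "gadj False v w \<Longrightarrow> gadj s v w"
  by (auto simp: gadj_iff split: if_splits)

lemma gadj_imp_True: "gadj s v w \<Longrightarrow> gadj True v w"
  by (auto simp: gadj_iff split: if_splits)

lemma conn_refl [intro]: "x \<in> X \<Longrightarrow> conn s X x x"
  by (simp add: conn_def)

lemma conn_in: "conn s X x y \<Longrightarrow> x \<in> X" "conn s X x y \<Longrightarrow> y \<in> X"
proof -
  show "conn s X x y \<Longrightarrow> x \<in> X" by (simp add: conn_def)
  show "y \<in> X" if "conn s X x y"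
    using that unfolding conn_def by (metis (mono_tags, lifting) rtranclp.cases)
qed

lemma conn_sym: "conn s X x y \<Longrightarrow> conn s X y x"
proof -
  assume h: "conn s X x y"
  have "symp (\<lambda>u v. u \<in> X \<and> v \<in> X \<and> gadj s u v)" by (auto simp: symp_def gadj_sym)
  then have "symp (\<lambda>u v. u \<in> X \<and> v \<in> X \<and> gadj s u v)\<^sup>*\<^sup>*" by (rule symp_rtranclp)
  then show ?thesis using h conn_in[OF h] unfolding conn_def symp_def by blast
qed

lemma conn_trans: "conn s X x y \<Longrightarrow> conn s X y z \<Longrightarrow> conn s X x z"
  unfolding conn_def by auto

lemma conn_step: "x \<in> X \<Longrightarrow> y \<in> X \<Longrightarrow> gadj s x y \<Longrightarrow> conn s X x y"
  unfolding conn_def by auto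

lemma conn_induct [consumes 1, case_names refl step]:
  assumes "conn s X x y"
    and "x \<in> X \<Longrightarrow> P x"
    and "\<And>y z. conn s X x y \<Longrightarrow> y \<in> X \<Longrightarrow> z \<in> X \<Longrightarrow> gadj s y z \<Longrightarrow> P y \<Longrightarrow> P z"
  shows "P y"
proof -
  have x: "x \<in> X" and r: "(\<lambda>u v. u \<in> X \<and> v \<in> X \<and> gadj s u v)\<^sup>*\<^sup>* x y" using assms(1) by (auto simp: conn_def)
  from r show ?thesis
    by (induction rule: rtranclp_induct) (use assms(2,3) x in \<open>auto simp: conn_def\<close>)
qed

lemma conn_mono: "conn s X x y \<Longrightarrow> X \<subseteq> Y \<Longrightarrow> conn s Y x y"
  by (induction rule: conn_induct) (blast intro: conn_trans conn_step)+

lemma conn_closed: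
  assumes "conn s X x y" "x \<in> Y" "\<And>u v. u \<in> Y \<Longrightarrow> u \<in> X \<Longrightarrow> v \<in> X \<Longrightarrow> gadj s u v \<Longrightarrow> v \<in> Y"
  shows "conn s (X \<inter> Y) x y"
  using assms(1)
proof (induction rule: conn_induct)
  case refl then show ?case using assms(2) by auto
next
  case (step y z)
  have "y \<in> X \<inter> Y" using conn_in[OF step.IH] by auto
  then have "z \<in> X \<inter> Y" using assms(3) step by blast
  then show ?case using step \<open>y \<in> X \<inter> Y\<close> by (blast intro: conn_trans conn_step)
qed

lemma conn_image:
  assumes "conn s X x y" "\<And>u v. gadj s u v \<Longrightarrow> gadj s (f u) (f v)"
  shows "conn s (f ` X) (f x) (f y)"
  using assms(1)
  by (induction rule: conn_induct) (use assms(2) in \<open>blast intro: conn_trans conn_step\<close>)+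

text \<open>Last visit to \<open>v\<close>: at every return to \<open>v\<close> the induction
  forgets the past, so what remains starts at a neighbour of \<open>v\<close> and avoids
  \<open>v\<close>.\<close>

lemma conn_leave:
  assumes "conn s X v w" "w \<noteq> v"
  obtains u where "gadj s v u" "conn s (X - {v}) u w"
proof -
  have "w = v \<or> (\<exists>u. gadj s v u \<and> conn s (X - {v}) u w)"
    using assms(1)
  proof (induction rule: conn_induct)
    case (step y z)
    show ?case
    proof (cases "z = v")
      case False
      show ?thesis
      proof (cases "y = v")
        case True
        then show ?thesis using step False by blast
      next
        case y: False
        then obtain u where "gadj s v u" "conn s (X - {v}) u y" using step by blast
        then show ?thesis using step False y by (blast intro: conn_trans conn_step)
      qed
    qed simp
  qed simp
  then show ?thesis using assms(2) that by blast
qed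

text \<open>First visit to \<open>Y\<close>. The vertex \<open>u\<close> before it is kept because
  the applications need that the step into \<open>Y\<close> starts outside \<open>Y\<close>.\<close>

lemma conn_first:
  assumes "conn s X x y" "y \<in> Y"
  obtains z where "z \<in> Y" "z \<in> X" "x = z \<or> (\<exists>u. conn s (X - Y) x u \<and> gadj s u z)"
proof -
  have "conn s (X - Y) x y \<or> (\<exists>z \<in> Y \<inter> X. x = z \<or> (\<exists>u. conn s (X - Y) x u \<and> gadj s u z))"
    using assms(1)
  proof (induction rule: conn_induct)
    case refl then show ?case by blast
  next
    case (step y z)
    then show ?case by (cases "z \<in> Y") (blast dest: conn_in intro: conn_trans conn_step)+
  qed
  then show ?thesis using assms(2) that conn_in by blast
qed

subsection \<open>A path and a *-path with interleaved ends meet\<close>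

definition bdry :: "int \<Rightarrow> int \<Rightarrow> int \<Rightarrow> int \<Rightarrow> vertex set" where
  "bdry a b c d = {(x, y) \<in> rect a b c d. x = a \<or> x = b \<or> y = c \<or> y = d}"

text \<open>The position is counted clockwise from the top right corner.\<close>

definition bpos :: "int \<Rightarrow> int \<Rightarrow> int \<Rightarrow> int \<Rightarrow> vertex \<Rightarrow> int" where
  "bpos a b c d v = (if fst v = b then d - snd v
     else if snd v = c then (d - c) + (b - fst v)
     else if fst v = a then (d - c) + (b - a) + (snd v - c)
     else 2 * (d - c) + (b - a) + (fst v - a))"

text \<open>Exactly one of \<open>e2\<close>, \<open>e4\<close> lies between \<open>e1\<close> and
  \<open>e3\<close> in the linear order of \<open>bpos\<close>; on a circle this is interlacing,
  whatever the base point of the order.\<close>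

definition interl :: "int \<Rightarrow> int \<Rightarrow> int \<Rightarrow> int \<Rightarrow> vertex \<Rightarrow> vertex \<Rightarrow> vertex \<Rightarrow> vertex \<Rightarrow> bool" where
  "interl a b c d e1 e3 e2 e4 \<longleftrightarrow>
    ((bpos a b c d e1 < bpos a b c d e2) \<noteq> (bpos a b c d e3 < bpos a b c d e2)) \<noteq>
    ((bpos a b c d e1 < bpos a b c d e4) \<noteq> (bpos a b c d e3 < bpos a b c d e4))"

text \<open>The proof of \<open>interl_meet\<close> counts the steps \<^term>\<open>(p, q)\<close> of the 4-path crossing the horizontal ray
  starting at height \<^term>\<open>snd w + 1 / 2\<close> from \<^term>\<open>w\<close>: \<^term>\<open>vst w p q\<close> says that the step crosses the ray.
  Modulo 2 this count changes along a step of the *-path only through the ends of the 4-path (\<^term>\<open>tray\<close>);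
  \<^term>\<open>ecorr\<close> absorbs that change, and \<^term>\<open>bval\<close> computes the count for \<^term>\<open>w\<close> on the boundary.\<close>

definition vst :: "vertex \<Rightarrow> vertex \<Rightarrow> vertex \<Rightarrow> bool" where
  "vst w p q \<longleftrightarrow> fst p = fst q \<and> fst w < fst p \<and>
     (snd p = snd w \<and> snd q = snd w + 1 \<or> snd q = snd w \<and> snd p = snd w + 1)"

definition tray :: "vertex \<Rightarrow> vertex \<Rightarrow> vertex \<Rightarrow> bool" where
  "tray w w' e \<longleftrightarrow> (snd w' = snd w + 1 \<and> snd e = snd w' \<and> fst w' < fst e) \<or>
     (snd w = snd w' + 1 \<and> snd e = snd w \<and> fst w < fst e)"

definition bval :: "int \<Rightarrow> int \<Rightarrow> int \<Rightarrow> int \<Rightarrow> vertex \<Rightarrow> vertex \<Rightarrow> bool" where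
  "bval a b c d w e \<longleftrightarrow> (if fst w = b then False
     else if snd w = c then snd e = c \<and> fst w < fst e
     else if fst w = a then snd w < snd e else False)"

definition ecorr :: "int \<Rightarrow> int \<Rightarrow> int \<Rightarrow> int \<Rightarrow> vertex \<Rightarrow> vertex \<Rightarrow> bool" where
  "ecorr a b c d e w \<longleftrightarrow> (if fst e = b then snd w < snd e
     else if snd e = c \<or> fst e = a then False else snd w = d \<and> fst w < fst e)"

text \<open>When \<open>w\<close> moves by a *-step to a new row, its ray sweeps over the vertices
  to the right of the upper of the two vertices, in the row of that vertex. \<open>tray\<close> is
  membership in this set, and a step crosses exactly one of the two rays iff it enters or leaves the
  set; the exceptions would pass through \<open>w\<close> or \<open>w'\<close>. Coordinates are
  spelled out so that only linear integer arithmetic remains.\<close>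

lemma vst_step_coords:
  fixes p1 p2 q1 q2 w1 w2 v1 v2 :: int
  assumes "q1 = p1 \<and> q2 = p2 + 1 \<or> q1 = p1 \<and> q2 = p2 - 1 \<or> q1 = p1 + 1 \<and> q2 = p2 \<or> q1 = p1 - 1 \<and> q2 = p2"
   "v1 = w1 \<or> v1 = w1 + 1 \<or> v1 = w1 - 1"  "v2 = w2 \<or> v2 = w2 + 1 \<or> v2 = w2 - 1"
   "p1 \<noteq> w1 \<or> p2 \<noteq> w2" "p1 \<noteq> v1 \<or> p2 \<noteq> v2"  "q1 \<noteq> w1 \<or> q2 \<noteq> w2" "q1 \<noteq> v1 \<or> q2 \<noteq> v2"
  shows "((p1 = q1 \<and> w1 < p1 \<and> (p2 = w2 \<and> q2 = w2 + 1 \<or> q2 = w2 \<and> p2 = w2 + 1)) \<noteq>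
     (p1 = q1 \<and> v1 < p1 \<and> (p2 = v2 \<and> q2 = v2 + 1 \<or> q2 = v2 \<and> p2 = v2 + 1))) =
     (((v2 = w2 + 1 \<and> p2 = v2 \<and> v1 < p1) \<or> (w2 = v2 + 1 \<and> p2 = w2 \<and> w1 < p1)) \<noteq>
      ((v2 = w2 + 1 \<and> q2 = v2 \<and> v1 < q1) \<or> (w2 = v2 + 1 \<and> q2 = w2 \<and> w1 < q1)))"
  using assms(1,2,3) by (elim disjE conjE; insert assms(4-7); hypsubst_thin; smt)

text \<open>Inside the rectangle the ray of a boundary vertex is empty on the right and top sides;
  on the bottom and left sides it cuts off the vertices described by \<open>bval\<close>, and the
  only other way around leads through \<open>w\<close>.\<close>

lemma vst_bdry_coords:
  fixes p1 p2 q1 q2 w1 w2 :: int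
  assumes "q1 = p1 \<and> q2 = p2 + 1 \<or> q1 = p1 \<and> q2 = p2 - 1 \<or> q1 = p1 + 1 \<and> q2 = p2 \<or> q1 = p1 - 1 \<and> q2 = p2"
  "w1 = a \<or> w1 = b \<or> w2 = c \<or> w2 = d" "a \<le> w1" "w1 \<le> b" "c \<le> w2" "w2 \<le> d"
  "a \<le> p1" "p1 \<le> b" "c \<le> p2" "p2 \<le> d" "a \<le> q1" "q1 \<le> b" "c \<le> q2" "q2 \<le> d"
   "p1 \<noteq> w1 \<or> p2 \<noteq> w2"  "q1 \<noteq> w1 \<or> q2 \<noteq> w2"
  shows "(p1 = q1 \<and> w1 < p1 \<and> (p2 = w2 \<and> q2 = w2 + 1 \<or> q2 = w2 \<and> p2 = w2 + 1)) =
    ((if w1 = b then False else if w2 = c then p2 = c \<and> w1 < p1 else if w1 = a then w2 < p2 else False) \<noteq>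
     (if w1 = b then False else if w2 = c then q2 = c \<and> w1 < q1 else if w1 = a then w2 < q2 else False))"
  using assms by smt

lemma ecorr_step_coords:
  fixes p1 p2 w1 w2 v1 v2 :: int
  assumes "v1 = w1 \<or> v1 = w1 + 1 \<or> v1 = w1 - 1"  "v2 = w2 \<or> v2 = w2 + 1 \<or> v2 = w2 - 1"
    "a \<le> w1" "w1 \<le> b" "c \<le> w2" "w2 \<le> d" "a \<le> v1" "v1 \<le> b" "c \<le> v2" "v2 \<le> d"
     "p1 = a \<or> p1 = b \<or> p2 = c \<or> p2 = d" "a \<le> p1" "p1 \<le> b" "c \<le> p2" "p2 \<le> d"
   "p1 \<noteq> w1 \<or> p2 \<noteq> w2" "p1 \<noteq> v1 \<or> p2 \<noteq> v2"
  shows "((if p1 = b then w2 < p2 else if p2 = c \<or> p1 = a then False else w2 = d \<and> w1 < p1) \<noteq>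
    (if p1 = b then v2 < p2 else if p2 = c \<or> p1 = a then False else v2 = d \<and> v1 < p1)) =
    ((v2 = w2 + 1 \<and> p2 = v2 \<and> v1 < p1) \<or> (w2 = v2 + 1 \<and> p2 = w2 \<and> w1 < p1))"
  using assms by smt

lemma bdry_value_coords:
  fixes p1 p2 w1 w2 :: int
  assumes "w1 = a \<or> w1 = b \<or> w2 = c \<or> w2 = d" "a \<le> w1" "w1 \<le> b" "c \<le> w2" "w2 \<le> d"
     "p1 = a \<or> p1 = b \<or> p2 = c \<or> p2 = d" "a \<le> p1" "p1 \<le> b" "c \<le> p2" "p2 \<le> d"
     "p1 \<noteq> w1 \<or> p2 \<noteq> w2"
  shows "((if w1 = b then False else if w2 = c then p2 = c \<and> w1 < p1 else if w1 = a then w2 < p2 else False) \<noteq>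
     (if p1 = b then w2 < p2 else if p2 = c \<or> p1 = a then False else w2 = d \<and> w1 < p1)) =
    (((if p1 = b then d - p2 else if p2 = c then d - c + (b - p1)
      else if p1 = a then d - c + (b - a) + (p2 - c) else 2 * (d - c) + (b - a) + (p1 - a)) <
     (if w1 = b then d - w2 else if w2 = c then d - c + (b - w1)
      else if w1 = a then d - c + (b - a) + (w2 - c) else 2 * (d - c) + (b - a) + (w1 - a))) \<noteq> (w1 \<noteq> b \<and> w2 \<noteq> c))"
  using assms by (cases "w1 = b"; cases "w2 = c"; cases "w1 = a"; cases "p1 = b"; cases "p2 = c"; cases "p1 = a"; simp (no_asm_simp); smt)

lemma vst_step:
  assumes "adj p q" "star_adj w w'" "p \<noteq> w" "p \<noteq> w'" "q \<noteq> w" "q \<noteq> w'"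
  shows "(vst w p q \<noteq> vst w' p q) = (tray w w' p \<noteq> tray w w' q)"
proof (cases p, cases q, cases w, cases w')
  fix p1 p2 q1 q2 w1 w2 v1 v2
  assume e: "p = (p1, p2)" "q = (q1, q2)" "w = (w1, w2)" "w' = (v1, v2)"
  have q: "q1 = p1 \<and> q2 = p2 + 1 \<or> q1 = p1 \<and> q2 = p2 - 1 \<or> q1 = p1 + 1 \<and> q2 = p2 \<or> q1 = p1 - 1 \<and> q2 = p2"
    using assms(1) unfolding adj_iff e by (simp; arith)
  have v1: "v1 = w1 \<or> v1 = w1 + 1 \<or> v1 = w1 - 1" and v2: "v2 = w2 \<or> v2 = w2 + 1 \<or> v2 = w2 - 1"
    using assms(2) unfolding star_adj_iff e by (simp; arith)+
  have ne: "p1 \<noteq> w1 \<or> p2 \<noteq> w2" "p1 \<noteq> v1 \<or> p2 \<noteq> v2" "q1 \<noteq> w1 \<or> q2 \<noteq> w2" "q1 \<noteq> v1 \<or> q2 \<noteq> v2"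
    using assms(3-6) unfolding e by auto
  show ?thesis unfolding e vst_def tray_def fst_conv snd_conv
    by (rule vst_step_coords[OF q v1 v2 ne])
qed

lemma vst_bdry:
  assumes "adj p q" "p \<in> rect a b c d" "q \<in> rect a b c d" "w \<in> bdry a b c d" "p \<noteq> w" "q \<noteq> w"
  shows "vst w p q = (bval a b c d w p \<noteq> bval a b c d w q)"
proof (cases p, cases q, cases w)
  fix p1 p2 q1 q2 w1 w2
  assume e: "p = (p1, p2)" "q = (q1, q2)" "w = (w1, w2)"
  have q: "q1 = p1 \<and> q2 = p2 + 1 \<or> q1 = p1 \<and> q2 = p2 - 1 \<or> q1 = p1 + 1 \<and> q2 = p2 \<or> q1 = p1 - 1 \<and> q2 = p2"
    using assms(1) unfolding adj_iff e by (simp; arith)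
  have w: "w1 = a \<or> w1 = b \<or> w2 = c \<or> w2 = d" "a \<le> w1" "w1 \<le> b" "c \<le> w2" "w2 \<le> d"
    using assms(4) unfolding bdry_def rect_def e by auto
  have pq: "a \<le> p1" "p1 \<le> b" "c \<le> p2" "p2 \<le> d" "a \<le> q1" "q1 \<le> b" "c \<le> q2" "q2 \<le> d"
    using assms(2,3) unfolding rect_def e by auto
  have ne: "p1 \<noteq> w1 \<or> p2 \<noteq> w2" "q1 \<noteq> w1 \<or> q2 \<noteq> w2"
    using assms(5,6) unfolding e by auto
  show ?thesis unfolding e vst_def bval_def fst_conv snd_conv
    by (rule vst_bdry_coords[OF q w pq ne])
qed

lemma ecorr_step:
  assumes "star_adj w w'" "w \<in> rect a b c d" "w' \<in> rect a b c d" "e \<in> bdry a b c d" "e \<noteq> w" "e \<noteq> w'"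
  shows "(ecorr a b c d e w \<noteq> ecorr a b c d e w') = tray w w' e"
proof (cases e, cases w, cases w')
  fix p1 p2 w1 w2 v1 v2
  assume e: "e = (p1, p2)" "w = (w1, w2)" "w' = (v1, v2)"
  have v1: "v1 = w1 \<or> v1 = w1 + 1 \<or> v1 = w1 - 1" and v2: "v2 = w2 \<or> v2 = w2 + 1 \<or> v2 = w2 - 1"
    using assms(1) unfolding star_adj_iff e by (simp; arith)+
  have w: "a \<le> w1" "w1 \<le> b" "c \<le> w2" "w2 \<le> d" "a \<le> v1" "v1 \<le> b" "c \<le> v2" "v2 \<le> d"
     "p1 = a \<or> p1 = b \<or> p2 = c \<or> p2 = d" "a \<le> p1" "p1 \<le> b" "c \<le> p2" "p2 \<le> d"
    using assms(2-4) unfolding rect_def bdry_def e by auto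
  have ne: "p1 \<noteq> w1 \<or> p2 \<noteq> w2" "p1 \<noteq> v1 \<or> p2 \<noteq> v2"
    using assms(5,6) unfolding e by auto
  show ?thesis unfolding e tray_def ecorr_def fst_conv snd_conv
    by (rule ecorr_step_coords[OF v1 v2 w ne])
qed

text \<open>The last term depends on \<open>w\<close> alone, so it cancels when the two ends
  \<open>e1\<close> and \<open>e3\<close> of a path are compared.\<close>

lemma bdry_value:
  assumes "w \<in> bdry a b c d" "e \<in> bdry a b c d" "e \<noteq> w"
  shows "(bval a b c d w e \<noteq> ecorr a b c d e w) =
    ((bpos a b c d e < bpos a b c d w) \<noteq> (fst w \<noteq> b \<and> snd w \<noteq> c))"
proof (cases e, cases w)
  fix p1 p2 w1 w2
  assume e: "e = (p1, p2)" "w = (w1, w2)"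
  have w: "w1 = a \<or> w1 = b \<or> w2 = c \<or> w2 = d" "a \<le> w1" "w1 \<le> b" "c \<le> w2" "w2 \<le> d"
     "p1 = a \<or> p1 = b \<or> p2 = c \<or> p2 = d" "a \<le> p1" "p1 \<le> b" "c \<le> p2" "p2 \<le> d"
    using assms(1,2) unfolding rect_def bdry_def e by auto
  have ne: "p1 \<noteq> w1 \<or> p2 \<noteq> w2" using assms(3) unfolding e by auto
  show ?thesis unfolding e bval_def ecorr_def bpos_def fst_conv snd_conv
    by (rule bdry_value_coords[OF w ne])
qed


text \<open>\<open>par w\<close> is the parity of the number of steps of the path crossing the ray
  of \<open>w\<close>. Each step adds \<open>vst w y z\<close>, and the contributions of the
  intermediate vertices telescope, leaving the two ends.\<close>

lemma path_index:
  assumes "conn False X e1 e3" "X \<subseteq> rect a b c d"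
  shows "\<exists>par. (\<forall>w w'. w \<notin> X \<longrightarrow> w' \<notin> X \<longrightarrow> star_adj w w' \<longrightarrow>
            (par w \<noteq> par w') = (tray w w' e1 \<noteq> tray w w' e3)) \<and>
          (\<forall>w. w \<notin> X \<longrightarrow> w \<in> bdry a b c d \<longrightarrow> par w = (bval a b c d w e1 \<noteq> bval a b c d w e3))"
  using assms(1)
proof (induction rule: conn_induct)
  case refl
  show ?case by (rule exI[of _ "\<lambda>_. False"]) simp
next
  case (step y z)
  from step.IH obtain par where
    p1: "\<And>w w'. w \<notin> X \<Longrightarrow> w' \<notin> X \<Longrightarrow> star_adj w w' \<Longrightarrow> (par w \<noteq> par w') = (tray w w' e1 \<noteq> tray w w' y)" and
    p2: "\<And>w. w \<notin> X \<Longrightarrow> w \<in> bdry a b c d \<Longrightarrow> par w = (bval a b c d w e1 \<noteq> bval a b c d w y)"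
    by blast
  have adj: "adj y z" using step by (simp add: gadj_def)
  have r: "y \<in> rect a b c d" "z \<in> rect a b c d" using step assms(2) by auto
  show ?case
  proof (rule exI[of _ "\<lambda>w. par w \<noteq> vst w y z"], intro conjI allI impI)
    fix w w' assume h: "w \<notin> X" "w' \<notin> X" "star_adj w w'"
    have "(vst w y z \<noteq> vst w' y z) = (tray w w' y \<noteq> tray w w' z)"
      by (rule vst_step) (use h step adj in auto)
    then show "((par w \<noteq> vst w y z) \<noteq> (par w' \<noteq> vst w' y z)) = (tray w w' e1 \<noteq> tray w w' z)"
      using p1[OF h] by argo
  next
    fix w assume h: "w \<notin> X" "w \<in> bdry a b c d"
    have "vst w y z = (bval a b c d w y \<noteq> bval a b c d w z)"
      by (rule vst_bdry[OF adj r h(2)]) (use h step in auto)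
    then show "(par w \<noteq> vst w y z) = (bval a b c d w e1 \<noteq> bval a b c d w z)"
      using p2[OF h] by argo
  qed
qed

lemma interl_meet:
  assumes X: "conn False X e1 e3" "X \<subseteq> rect a b c d"
    and Y: "conn True Y e2 e4" "Y \<subseteq> rect a b c d"
    and bd: "e1 \<in> bdry a b c d" "e2 \<in> bdry a b c d" "e3 \<in> bdry a b c d" "e4 \<in> bdry a b c d"
    and il: "interl a b c d e1 e3 e2 e4"
  shows "X \<inter> Y \<noteq> {}"
proof
  assume dis: "X \<inter> Y = {}"
  obtain par where
    p1: "\<And>w w'. w \<notin> X \<Longrightarrow> w' \<notin> X \<Longrightarrow> star_adj w w' \<Longrightarrow> (par w \<noteq> par w') = (tray w w' e1 \<noteq> tray w w' e3)" and
    p2: "\<And>w. w \<notin> X \<Longrightarrow> w \<in> bdry a b c d \<Longrightarrow> par w = (bval a b c d w e1 \<noteq> bval a b c d w e3)"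
    using path_index[OF X] by blast
  \<comment> \<open>The parity corrected by both ends is constant along *-steps avoiding
    \<open>X\<close>, while at boundary vertices it tells whether the vertex separates
    \<open>e1\<close> from \<open>e3\<close>.\<close>
  define J where "J w = (par w \<noteq> (ecorr a b c d e1 w \<noteq> ecorr a b c d e3 w))" for w
  have J: "J w = J w'" if "w \<in> Y" "w' \<in> Y" "star_adj w w'" for w w'
  proof -
    have nX: "w \<notin> X" "w' \<notin> X" using dis that by auto
    have ne: "e1 \<noteq> w" "e1 \<noteq> w'" "e3 \<noteq> w" "e3 \<noteq> w'" using nX conn_in[OF X(1)] by auto
    have r: "w \<in> rect a b c d" "w' \<in> rect a b c d" using that Y by auto
    show ?thesis
      using p1[OF nX that(3)] ecorr_step[OF that(3) r bd(1) ne(1,2)] ecorr_step[OF that(3) r bd(3) ne(3,4)]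
      unfolding J_def by argo
  qed
  have "J e2 = J e4"
    using Y(1) by (induction rule: conn_induct) (use J in \<open>auto simp: gadj_def\<close>)
  moreover have "J w = ((bpos a b c d e1 < bpos a b c d w) \<noteq> (bpos a b c d e3 < bpos a b c d w))"
    if "w \<in> Y" "w \<in> bdry a b c d" for w
  proof -
    have nX: "w \<notin> X" using dis that by auto
    then have ne: "e1 \<noteq> w" "e3 \<noteq> w" using conn_in[OF X(1)] by auto
    show ?thesis using p2[OF nX that(2)] bdry_value[OF that(2) bd(1) ne(1)] bdry_value[OF that(2) bd(3) ne(2)]
      unfolding J_def by argo
  qed
  ultimately show False using il bd conn_in[OF Y(1)] unfolding interl_def by auto
qed

text \<open>In the order of \<open>bpos\<close> the right end precedes the bottom end, which
  precedes the left end. The top end comes first if it is the top right corner and last otherwise;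
  either way it is not between the right and the left end.\<close>

lemma interl_LRTB:
  assumes "l \<in> rect a b c d" "r \<in> rect a b c d" "t \<in> rect a b c d" "u \<in> rect a b c d"
    and "fst l = a" "fst r = b" "snd t = d" "snd u = c" "a < b" "c < d"
    and "l \<noteq> t" "l \<noteq> u" "r \<noteq> t" "r \<noteq> u"
  shows "interl a b c d l r t u" "interl a b c d t u l r"
proof -
  obtain yl yr xt xu where e: "l = (a, yl)" "r = (b, yr)" "t = (xt, d)" "u = (xu, c)"
    using assms(5-8) by (metis prod.collapse)
  have bd: "c \<le> yl" "yl \<le> d" "c \<le> yr" "yr \<le> d" "a \<le> xt" "xt \<le> b" "a \<le> xu" "xu \<le> b"
    using assms(1-4) unfolding e rect_def by auto
  have ne: "\<not> (a = xt \<and> yl = d)" "\<not> (a = xu \<and> yl = c)" "\<not> (b = xt \<and> yr = d)" "\<not> (b = xu \<and> yr = c)"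
    using assms(11-14) unfolding e by auto
  have p: "bpos a b c d r = d - yr" "bpos a b c d u = (d - c) + (b - xu)"
    "bpos a b c d l = (d - c) + (b - a) + (yl - c)"
    "bpos a b c d t = (if xt = b then 0 else 2 * (d - c) + (b - a) + (xt - a))"
    using assms(9,10) unfolding e bpos_def by auto
  have 1: "bpos a b c d r < bpos a b c d u" "bpos a b c d u < bpos a b c d l"
    "\<not> bpos a b c d l < bpos a b c d u" "\<not> bpos a b c d u < bpos a b c d r"
    unfolding p using bd ne by smt+
  have 2: "(bpos a b c d l < bpos a b c d t) = (xt \<noteq> b)" "(bpos a b c d r < bpos a b c d t) = (xt \<noteq> b)"
    "(bpos a b c d t < bpos a b c d l) = (xt = b)" "(bpos a b c d t < bpos a b c d r) = (xt = b)"
    unfolding p using bd ne assms(9,10) by smt+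
  show "interl a b c d l r t u" "interl a b c d t u l r"
    unfolding interl_def by (simp_all only: 1 2 simp_thms)
qed

text \<open>\<open>interl_meet\<close> counts the crossings of the path with ordinary adjacency, so
  the two paths exchange roles when \<open>s\<close> is true.\<close>

lemma LR_TB_meet:
  assumes "a < b" "c < d"
    and X: "conn s X l r" "X \<subseteq> rect a b c d" "fst l = a" "fst r = b"
    and Y: "conn (\<not> s) Y t u" "Y \<subseteq> rect a b c d" "snd t = d" "snd u = c"
  shows "X \<inter> Y \<noteq> {}"
proof
  assume dis: "X \<inter> Y = {}"
  have i: "l \<in> X" "r \<in> X" "t \<in> Y" "u \<in> Y" using conn_in[OF X(1)] conn_in[OF Y(1)] by auto
  then have ne: "l \<noteq> t" "l \<noteq> u" "r \<noteq> t" "r \<noteq> u" using dis by auto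
  have re: "l \<in> rect a b c d" "r \<in> rect a b c d" "t \<in> rect a b c d" "u \<in> rect a b c d" using i X Y by auto
  have bd: "l \<in> bdry a b c d" "r \<in> bdry a b c d" "t \<in> bdry a b c d" "u \<in> bdry a b c d"
    using re X Y unfolding bdry_def by (cases l; cases r; cases t; cases u; auto)+
  show False
  proof (cases s)
    case False
    then show ?thesis using interl_meet[of X l r a b c d Y t u] X Y bd dis interl_LRTB(1)[OF re] ne assms(1,2) by auto
  next
    case True
    then show ?thesis using interl_meet[of Y t u a b c d X l r] X Y bd dis interl_LRTB(2)[OF re] ne assms(1,2) by auto
  qed
qed

lemma TB_LR_meet:
  assumes "a < b" "c < d"
    and X: "conn s X t u" "X \<subseteq> rect a b c d" "snd t = d" "snd u = c"
    and Y: "conn (\<not> s) Y l r" "Y \<subseteq> rect a b c d" "fst l = a" "fst r = b"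
  shows "X \<inter> Y \<noteq> {}"
  using LR_TB_meet[OF assms(1,2) Y, of X t u] X by auto

subsection \<open>Thickening and touching paths\<close>

definition nbhd :: "bool \<Rightarrow> vertex set \<Rightarrow> vertex set" where
  "nbhd s Z = {x. x \<in> Z \<or> (\<exists>z\<in>Z. gadj s x z)}"

text \<open>A diagonal step is replaced by two straight ones through the corner \<open>k\<close>,
  which is a *-neighbour of \<open>x\<close>; since \<open>x\<close> is outside the neighbourhood of
  \<open>Z\<close>, the corner avoids \<open>Z\<close>.\<close>

lemma thick_step:
  assumes "x \<in> rect a b c d" "y \<in> rect a b c d" "x \<notin> nbhd s Z" "y \<notin> Z" "gadj s x y"
  shows "conn (\<not> s) (rect a b c d - Z) x y"
proof (cases "gadj (\<not> s) x y")
  case True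
  then show ?thesis using assms by (intro conn_step) (auto simp: nbhd_def)
next
  case False
  then have s: "s" using assms(5) gadj_imp_True by (cases s) auto
  define k where "k = (fst x, snd y)"
  have k: "gadj False x k" "gadj False k y" "gadj True x k"
    using assms(5) False s unfolding gadj_iff k_def by auto
  have kr: "k \<in> rect a b c d - Z"
    using assms k(3) s unfolding k_def rect_def nbhd_def by (cases x; cases y) auto
  have "conn False (rect a b c d - Z) x k" "conn False (rect a b c d - Z) k y"
    using assms k kr by (auto intro!: conn_step simp: nbhd_def)
  then show ?thesis using s by (auto intro: conn_trans)
qed

lemma thick:
  assumes "conn s (X - nbhd s Z) x y" "X \<subseteq> rect a b c d"
  shows "conn (\<not> s) (rect a b c d - Z) x y"
  using assms(1)
proof (induction rule: conn_induct)
  case refl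
  then show ?case using assms(2) by (auto simp: nbhd_def)
next
  case (step y z)
  have "conn (\<not> s) (rect a b c d - Z) y z"
    using step assms(2) by (intro thick_step) (auto simp: nbhd_def)
  then show ?case using step conn_trans by blast
qed

text \<open>Otherwise the horizontal crossing would stay outside the neighbourhood of
  \<open>Z\<close> and could be turned by \<open>thick\<close> into a crossing for the dual
  adjacency avoiding \<open>Z\<close>, which must meet \<open>Z\<close>.\<close>

lemma LR_TB_touch:
  assumes "a < b" "c < d"
    and X: "conn s X l r" "X \<subseteq> rect a b c d" "fst l = a" "fst r = b"
    and Z: "conn s Z t u" "Z \<subseteq> rect a b c d" "snd t = d" "snd u = c"
  obtains x z where "x \<in> X" "z \<in> Z" "x = z \<or> gadj s x z"
proof -
  have "X \<inter> nbhd s Z \<noteq> {}"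
  proof
    assume "X \<inter> nbhd s Z = {}"
    then have "X - nbhd s Z = X" by blast
    then have "conn (\<not> s) (rect a b c d - Z) l r" using thick[of s X Z l r a b c d] X by auto
    from TB_LR_meet[OF assms(1,2) Z this _ X(3,4)] show False by auto
  qed
  then show ?thesis using that unfolding nbhd_def by blast
qed

subsection \<open>A parity potential\<close>

text \<open>The face condition says that \<open>H\<close> and \<open>V\<close> form a closed 1-form
  modulo 2. It is integrated along the bottom row and then up a column.\<close>

lemma grid_potential:
  fixes H V :: "int \<Rightarrow> int \<Rightarrow> bool"
  assumes face: "\<And>x y. a \<le> x \<Longrightarrow> x < b \<Longrightarrow> c \<le> y \<Longrightarrow> y < d \<Longrightarrow> (H x y \<noteq> V (x + 1) y) = (H x (y + 1) \<noteq> V x y)"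
  shows "\<exists>\<phi> :: int \<Rightarrow> int \<Rightarrow> bool.
    (\<forall>x y. a \<le> x \<longrightarrow> x < b \<longrightarrow> c \<le> y \<longrightarrow> y \<le> d \<longrightarrow> (\<phi> (x + 1) y \<noteq> \<phi> x y) = H x y) \<and>
    (\<forall>x y. a \<le> x \<longrightarrow> x \<le> b \<longrightarrow> c \<le> y \<longrightarrow> y < d \<longrightarrow> (\<phi> x (y + 1) \<noteq> \<phi> x y) = V x y)"
proof -
  define \<phi> where "\<phi> x y = odd (card {i \<in> {a..<x}. H i c} + card {j \<in> {c..<y}. V x j})" for x y
  have suc: "card {i \<in> {l..<k + 1}. P i} = card {i \<in> {l..<k}. P i} + (if P k then 1 else 0)"
    if "l \<le> k" for l k :: int and P
  proof -
    have "{i \<in> {l..<k + 1}. P i} = (if P k then insert k {i \<in> {l..<k}. P i} else {i \<in> {l..<k}. P i})"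
      using that by (auto simp: order_le_less)
    moreover have "finite {i \<in> {l..<k}. P i}" by (rule finite_subset[of _ "{l..<k}"]) auto
    moreover have "k \<notin> {i \<in> {l..<k}. P i}" by simp
    ultimately show ?thesis by (cases "P k") (simp_all only: card_insert_disjoint if_True if_False, simp_all)
  qed
  have v: "(\<phi> x (y + 1) \<noteq> \<phi> x y) = V x y" if "c \<le> y" for x y
    using suc[OF that, of "V x"] unfolding \<phi>_def by auto
  have h: "(\<phi> (x + 1) y \<noteq> \<phi> x y) = H x y" if x: "a \<le> x" "x < b" and y: "c \<le> y" "y \<le> d" for x y
    using y
  proof (induction y rule: int_ge_induct)
    case base
    then show ?case using suc[OF x(1), of "\<lambda>i. H i c"] unfolding \<phi>_def by auto
  next
    case (step y)
    then show ?case using v[of y x] v[of y "x + 1"] face[of x y] x by auto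
  qed
  show ?thesis by (rule exI[of _ \<phi>]) (use h v in blast)
qed

text \<open>\<open>A\<close>, \<open>B\<close>, \<open>D\<close>, \<open>F\<close> are the lower
  left, lower right, upper left and upper right corner of a unit face; the prefixes
  \<open>c\<close>, \<open>w\<close>, \<open>u\<close> stand for membership in \<open>C\<close>,
  \<open>W\<close>, \<open>U\<close>. Once the closure properties along the sides are listed, the
  parity of the face is propositional. Here the diagonals belong to the adjacency of
  \<open>C\<close>, in \<open>face_False\<close> to that of \<open>U\<close>.\<close>

lemma face_True:
  assumes "cA \<Longrightarrow> cB \<or> wB" "cB \<Longrightarrow> cA \<or> wA" "cA \<Longrightarrow> cD \<or> wD" "cD \<Longrightarrow> cA \<or> wA" "cB \<Longrightarrow> cF \<or> wF" "cF \<Longrightarrow> cB \<or> wB" "cD \<Longrightarrow> cF \<or> wF" "cF \<Longrightarrow> cD \<or> wD"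
   and "uA \<Longrightarrow> wB \<Longrightarrow> uB" "uB \<Longrightarrow> wA \<Longrightarrow> uA" "uA \<Longrightarrow> wD \<Longrightarrow> uD" "uD \<Longrightarrow> wA \<Longrightarrow> uA" "uB \<Longrightarrow> wF \<Longrightarrow> uF" "uF \<Longrightarrow> wB \<Longrightarrow> uB" "uD \<Longrightarrow> wF \<Longrightarrow> uF" "uF \<Longrightarrow> wD \<Longrightarrow> uD"
   and "uA \<Longrightarrow> wA" "uB \<Longrightarrow> wB" "uD \<Longrightarrow> wD" "uF \<Longrightarrow> wF" "cA \<Longrightarrow> wA \<Longrightarrow> False" "cB \<Longrightarrow> wB \<Longrightarrow> False" "cD \<Longrightarrow> wD \<Longrightarrow> False" "cF \<Longrightarrow> wF \<Longrightarrow> False"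
   and "cA \<Longrightarrow> cF \<or> wF" "cF \<Longrightarrow> cA \<or> wA" "cB \<Longrightarrow> cD \<or> wD" "cD \<Longrightarrow> cB \<or> wB"
  shows "((cA \<and> uB \<or> cB \<and> uA) \<noteq> (cB \<and> uF \<or> cF \<and> uB)) = ((cD \<and> uF \<or> cF \<and> uD) \<noteq> (cA \<and> uD \<or> cD \<and> uA))"
  using assms by satx

lemma face_False:
  assumes "cA \<Longrightarrow> cB \<or> wB" "cB \<Longrightarrow> cA \<or> wA" "cA \<Longrightarrow> cD \<or> wD" "cD \<Longrightarrow> cA \<or> wA" "cB \<Longrightarrow> cF \<or> wF" "cF \<Longrightarrow> cB \<or> wB" "cD \<Longrightarrow> cF \<or> wF" "cF \<Longrightarrow> cD \<or> wD"
   and "uA \<Longrightarrow> wB \<Longrightarrow> uB" "uB \<Longrightarrow> wA \<Longrightarrow> uA" "uA \<Longrightarrow> wD \<Longrightarrow> uD" "uD \<Longrightarrow> wA \<Longrightarrow> uA" "uB \<Longrightarrow> wF \<Longrightarrow> uF" "uF \<Longrightarrow> wB \<Longrightarrow> uB" "uD \<Longrightarrow> wF \<Longrightarrow> uF" "uF \<Longrightarrow> wD \<Longrightarrow> uD"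
   and "uA \<Longrightarrow> wA" "uB \<Longrightarrow> wB" "uD \<Longrightarrow> wD" "uF \<Longrightarrow> wF" "cA \<Longrightarrow> wA \<Longrightarrow> False" "cB \<Longrightarrow> wB \<Longrightarrow> False" "cD \<Longrightarrow> wD \<Longrightarrow> False" "cF \<Longrightarrow> wF \<Longrightarrow> False"
   and "uA \<Longrightarrow> wF \<Longrightarrow> uF" "uF \<Longrightarrow> wA \<Longrightarrow> uA" "uB \<Longrightarrow> wD \<Longrightarrow> uD" "uD \<Longrightarrow> wB \<Longrightarrow> uB"
  shows "((cA \<and> uB \<or> cB \<and> uA) \<noteq> (cB \<and> uF \<or> cF \<and> uB)) = ((cD \<and> uF \<or> cF \<and> uD) \<noteq> (cA \<and> uD \<or> cD \<and> uA))"
  using assms by satx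
text \<open>The edges between \<open>C\<close> and \<open>U\<close> are those crossed by the
  interface between components of opposite colours. Around each face their number is even, so the
  interface has two sides, and \<open>\<phi>\<close> tells them apart.\<close>

lemma cut_potential:
  assumes "C \<inter> W = {}" "U \<subseteq> W" "C \<subseteq> rect a b c d" "W \<subseteq> rect a b c d"
    and 1: "\<And>p q. p \<in> C \<Longrightarrow> q \<in> rect a b c d \<Longrightarrow> gadj s p q \<Longrightarrow> q \<in> C \<or> q \<in> W"
    and 2: "\<And>p q. p \<in> U \<Longrightarrow> q \<in> W \<Longrightarrow> gadj (\<not> s) p q \<Longrightarrow> q \<in> U"
  shows "\<exists>\<phi> :: vertex \<Rightarrow> bool. \<forall>p q. p \<in> rect a b c d \<longrightarrow> q \<in> rect a b c d \<longrightarrow> adj p q \<longrightarrow>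
     (\<phi> p \<noteq> \<phi> q) = (p \<in> C \<and> q \<in> U \<or> q \<in> C \<and> p \<in> U)"
proof -
  define E where "E p q \<longleftrightarrow> p \<in> C \<and> q \<in> U \<or> q \<in> C \<and> p \<in> U" for p q
  have face: "(E (x,y) (x+1,y) \<noteq> E (x+1,y) (x+1,y+1)) = (E (x,y+1) (x+1,y+1) \<noteq> E (x,y) (x,y+1))"
    if h: "a \<le> x" "x < b" "c \<le> y" "y < d" for x y
  proof -
    define A B D F where e: "A = (x,y)" "B = (x+1,y)" "D = (x,y+1)" "F = (x+1,y+1)"
    have r: "A \<in> rect a b c d" "B \<in> rect a b c d" "D \<in> rect a b c d" "F \<in> rect a b c d"
      using h unfolding e rect_def by auto
    have side: "gadj s' A B" "gadj s' B A" "gadj s' A D" "gadj s' D A" "gadj s' B F" "gadj s' F B"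
      "gadj s' D F" "gadj s' F D" for s'
      unfolding e gadj_iff by auto
    have dia: "gadj True A F" "gadj True F A" "gadj True B D" "gadj True D B"
      unfolding e gadj_iff by auto
    have sub: "\<And>p. p \<in> U \<Longrightarrow> p \<in> W" "\<And>p. p \<in> C \<Longrightarrow> p \<in> W \<Longrightarrow> False" using assms(1,2) by auto
    note f = 1[OF _ r(2) side(1)] 1[OF _ r(1) side(2)] 1[OF _ r(3) side(3)] 1[OF _ r(1) side(4)]
       1[OF _ r(4) side(5)] 1[OF _ r(2) side(6)] 1[OF _ r(4) side(7)] 1[OF _ r(3) side(8)]
    note g = 2[OF _ _ side(1)] 2[OF _ _ side(2)] 2[OF _ _ side(3)] 2[OF _ _ side(4)]
       2[OF _ _ side(5)] 2[OF _ _ side(6)] 2[OF _ _ side(7)] 2[OF _ _ side(8)]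
    note u = sub(1)[of A] sub(1)[of B] sub(1)[of D] sub(1)[of F] sub(2)[of A] sub(2)[of B] sub(2)[of D] sub(2)[of F]
    have "(E A B \<noteq> E B F) = (E D F \<noteq> E A D)"
    proof (cases s)
      case True
      have k: "A \<in> C \<Longrightarrow> F \<in> C \<or> F \<in> W" "F \<in> C \<Longrightarrow> A \<in> C \<or> A \<in> W" "B \<in> C \<Longrightarrow> D \<in> C \<or> D \<in> W" "D \<in> C \<Longrightarrow> B \<in> C \<or> B \<in> W"
        using 1[OF _ r(4), of A] 1[OF _ r(1), of F] 1[OF _ r(3), of B] 1[OF _ r(2), of D] dia
        by (simp_all add: True)
      show ?thesis unfolding E_def
        by (rule face_True[OF f g u k])
    next
      case False
      have k: "A \<in> U \<Longrightarrow> F \<in> W \<Longrightarrow> F \<in> U" "F \<in> U \<Longrightarrow> A \<in> W \<Longrightarrow> A \<in> U" "B \<in> U \<Longrightarrow> D \<in> W \<Longrightarrow> D \<in> U" "D \<in> U \<Longrightarrow> B \<in> W \<Longrightarrow> B \<in> U"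
        using 2[of A F] 2[of F A] 2[of B D] 2[of D B] dia by (simp_all add: False)
      show ?thesis unfolding E_def
        by (rule face_False[OF f g u k])
    qed
    then show ?thesis unfolding e .
  qed
  have "\<exists>\<phi> :: int \<Rightarrow> int \<Rightarrow> bool. (\<forall>x y. a \<le> x \<longrightarrow> x < b \<longrightarrow> c \<le> y \<longrightarrow> y \<le> d \<longrightarrow> (\<phi> (x + 1) y \<noteq> \<phi> x y) = E (x,y) (x+1,y)) \<and>
    (\<forall>x y. a \<le> x \<longrightarrow> x \<le> b \<longrightarrow> c \<le> y \<longrightarrow> y < d \<longrightarrow> (\<phi> x (y + 1) \<noteq> \<phi> x y) = E (x,y) (x,y+1))"
    by (rule grid_potential[where H = "\<lambda>x y. E (x,y) (x+1,y)" and V = "\<lambda>x y. E (x,y) (x,y+1)"]) (rule face)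
  then obtain \<phi> :: "int \<Rightarrow> int \<Rightarrow> bool" where \<phi>0: "(\<forall>x y. a \<le> x \<longrightarrow> x < b \<longrightarrow> c \<le> y \<longrightarrow> y \<le> d \<longrightarrow> (\<phi> (x + 1) y \<noteq> \<phi> x y) = E (x,y) (x+1,y)) \<and>
    (\<forall>x y. a \<le> x \<longrightarrow> x \<le> b \<longrightarrow> c \<le> y \<longrightarrow> y < d \<longrightarrow> (\<phi> x (y + 1) \<noteq> \<phi> x y) = E (x,y) (x,y+1))" ..
  have \<phi>: "a \<le> x \<Longrightarrow> x < b \<Longrightarrow> c \<le> y \<Longrightarrow> y \<le> d \<Longrightarrow> (\<phi> (x + 1) y \<noteq> \<phi> x y) = E (x,y) (x+1,y)"
    "a \<le> x \<Longrightarrow> x \<le> b \<Longrightarrow> c \<le> y \<Longrightarrow> y < d \<Longrightarrow> (\<phi> x (y + 1) \<noteq> \<phi> x y) = E (x,y) (x,y+1)" for x y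
    by (intro \<phi>0[THEN conjunct1, rule_format] \<phi>0[THEN conjunct2, rule_format]; assumption)+
  have Es: "E p q = E q p" for p q unfolding E_def by auto
  have "(\<phi> (fst p) (snd p) \<noteq> \<phi> (fst q) (snd q)) = E p q" if h: "p \<in> rect a b c d" "q \<in> rect a b c d" "adj p q" for p q
  proof -
    obtain p1 p2 q1 q2 where e: "p = (p1,p2)" "q = (q1,q2)" by (cases p; cases q) auto
    have r: "a \<le> p1" "p1 \<le> b" "c \<le> p2" "p2 \<le> d" "a \<le> q1" "q1 \<le> b" "c \<le> q2" "q2 \<le> d"
      using h unfolding e rect_def by auto
    consider "q1 = p1 + 1" "q2 = p2" | "p1 = q1 + 1" "q2 = p2" | "q2 = p2 + 1" "q1 = p1" | "p2 = q2 + 1" "q1 = p1"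
      using h(3) unfolding e adj_iff fst_conv snd_conv by smt
    then show ?thesis
    proof cases
      case 1
      then have "(\<phi> q1 q2 \<noteq> \<phi> p1 p2) = E p q" using \<phi>(1)[of p1 p2] r unfolding e by simp
      then show ?thesis using Es[of p q] unfolding e fst_conv snd_conv by satx
    next
      case 2
      then have "(\<phi> p1 p2 \<noteq> \<phi> q1 q2) = E q p" using \<phi>(1)[of q1 q2] r unfolding e by simp
      then show ?thesis using Es[of q p] unfolding e fst_conv snd_conv by satx
    next
      case 3
      then have "(\<phi> q1 q2 \<noteq> \<phi> p1 p2) = E p q" using \<phi>(2)[of p1 p2] r unfolding e by simp
      then show ?thesis using Es[of p q] unfolding e fst_conv snd_conv by satx
    next
      case 4
      then have "(\<phi> p1 p2 \<noteq> \<phi> q1 q2) = E q p" using \<phi>(2)[of q1 q2] r unfolding e by simp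
      then show ?thesis using Es[of q p] unfolding e fst_conv snd_conv by satx
    qed
  qed
  then show ?thesis unfolding E_def by (intro exI[of _ "\<lambda>p. \<phi> (fst p) (snd p)"]) blast
qed


section \<open>The Hex lemma and the dual arm of a vertex\<close>

lemma conn_extend: "conn s X x y \<Longrightarrow> z \<in> X \<Longrightarrow> gadj s y z \<Longrightarrow> conn s X x z"
  by (meson conn_in conn_step conn_trans)

lemma int_const:
  fixes f :: "int \<Rightarrow> 'a"
  assumes "\<And>x. a \<le> x \<Longrightarrow> x < b \<Longrightarrow> f (x + 1) = f x" "a \<le> x" "x \<le> b"
  shows "f x = f a"
  using assms(2,3)
  by (induction x rule: int_ge_induct) (use assms(1) in auto)

text \<open>Without the two crossings, the interface between the vertices reached from the left side
  and the dual vertices reached from the top side would meet the boundary an odd number of times on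
  the top side and nowhere else.\<close>

lemma hex:
  assumes ab: "a \<le> b" "c \<le> d"
  shows "(\<exists>l r. fst l = a \<and> fst r = b \<and> conn s (A \<inter> rect a b c d) l r) \<or>
    (\<exists>t u. snd t = d \<and> snd u = c \<and> conn (\<not> s) (rect a b c d - A) t u)"
proof (rule ccontr)
  assume neg: "\<not> ?thesis"
  let ?R = "rect a b c d" and ?R' = "rect (a - 1) b c d"
  \<comment> \<open>The extra column at abscissa \<open>a - 1\<close> belongs to \<open>C\<close> by
    definition; it starts the top row inside \<open>C\<close>, and \<open>\<phi>\<close> is constant
    along it.\<close>
  define C where "C = {(a - 1, y) |y. c \<le> y \<and> y \<le> d} \<union> {z. \<exists>l. fst l = a \<and> conn s (A \<inter> ?R) l z}"
  define W where "W = ?R - A"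
  define U where "U = {z. \<exists>t. snd t = d \<and> conn (\<not> s) (?R - A) t z}"
  have UW: "U \<subseteq> W" unfolding U_def W_def using conn_in by blast
  have cA: "conn s (A \<inter> ?R) l z \<Longrightarrow> z \<in> A \<inter> ?R" for l z by (rule conn_in(2))
  have "p \<notin> W" if "p \<in> C" for p
  proof (cases "fst p = a - 1")
    case True
    then show ?thesis unfolding W_def rect_def by auto
  next
    case False
    then have "\<exists>l. conn s (A \<inter> ?R) l p" using that unfolding C_def mem_Collect_eq Un_iff by force
    then obtain l where "conn s (A \<inter> ?R) l p" ..
    then show ?thesis using cA unfolding W_def by blast
  qed
  then have CW: "C \<inter> W = {}" by blast
  have "{(a - 1, y) |y. c \<le> y \<and> y \<le> d} \<subseteq> ?R'" using ab by (auto simp: rect_def)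
  moreover have "{z. \<exists>l. fst l = a \<and> conn s (A \<inter> ?R) l z} \<subseteq> ?R'"
  proof
    fix z assume "z \<in> {z. \<exists>l. fst l = a \<and> conn s (A \<inter> ?R) l z}"
    then have "z \<in> ?R" using cA by blast
    then show "z \<in> ?R'" by (auto simp: rect_def)
  qed
  ultimately have CR: "C \<subseteq> ?R'" unfolding C_def by blast
  have WR: "W \<subseteq> ?R'" unfolding W_def rect_def by auto
  have 1: "q \<in> C \<or> q \<in> W" if "p \<in> C" "q \<in> ?R'" "gadj s p q" for p q
  proof (cases "q \<in> ?R \<and> q \<in> A")
    case False
    then show ?thesis using that(2) unfolding C_def W_def rect_def by (cases q) auto
  next
    case True
    from that(1) consider y where "p = (a - 1, y)" | l where "fst l = a" "conn s (A \<inter> ?R) l p"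
      unfolding C_def by auto
    then show ?thesis
    proof cases
      case 1
      have "\<bar>fst p - fst q\<bar> \<le> 1" using that(3) by (auto simp: gadj_iff split: if_splits)
      then have "fst q = a" using 1 True by (auto simp: rect_def)
      then show ?thesis unfolding C_def using True by blast
    next
      case 2
      then have "conn s (A \<inter> ?R) l q" using True that(3) conn_extend[OF 2(2)] by blast
      then show ?thesis unfolding C_def using 2 by blast
    qed
  qed
  have 2: "q \<in> U" if "p \<in> U" "q \<in> W" "gadj (\<not> s) p q" for p q
    using that unfolding U_def W_def by (blast intro: conn_extend)
  obtain \<phi> :: "vertex \<Rightarrow> bool" where "\<forall>p q. p \<in> ?R' \<longrightarrow> q \<in> ?R' \<longrightarrow> adj p q \<longrightarrow>
     (\<phi> p \<noteq> \<phi> q) = (p \<in> C \<and> q \<in> U \<or> q \<in> C \<and> p \<in> U)"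
    using cut_potential[OF CW UW CR WR 1 2] ..
  then have \<phi>: "\<And>p q. p \<in> ?R' \<Longrightarrow> q \<in> ?R' \<Longrightarrow> adj p q \<Longrightarrow>
     (\<phi> p \<noteq> \<phi> q) = (p \<in> C \<and> q \<in> U \<or> q \<in> C \<and> p \<in> U)" by blast
  have nC: "(b, y) \<notin> C" for y
    using neg ab unfolding C_def by auto
  have nU: "(x, c) \<notin> U" for x using neg unfolding U_def by auto
  have CU: "p \<in> C \<Longrightarrow> p \<notin> U" for p using CW UW by auto
  \<comment> \<open>Every vertex of the top row outside \<open>A\<close> is in \<open>U\<close>, so
    along this row \<open>\<phi>\<close> flips exactly when \<open>C\<close> is entered or left. The
    row starts in \<open>C\<close> and ends outside \<open>C\<close>.\<close>
  have "\<phi> (x, d) = (\<phi> (a - 1, d) = ((x, d) \<in> C))" if "a - 1 \<le> x" "x \<le> b" for x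
    using that
  proof (induction x rule: int_ge_induct)
    case base
    then show ?case using ab by (auto simp: C_def)
  next
    case (step x)
    let ?p = "(x, d)" and ?q = "(x + 1, d)"
    have r: "?p \<in> ?R'" "?q \<in> ?R'" using step ab by (auto simp: rect_def)
    have ad: "adj ?p ?q" "gadj s ?p ?q" "gadj s ?q ?p" by (auto simp: adj_iff gadj_iff)
    have top: "(z, d) \<in> W \<Longrightarrow> (z, d) \<in> U" for z
      using conn_refl[of "(z, d)" "?R - A" "\<not> s"] unfolding W_def U_def by auto
    show ?case using step \<phi>[OF r ad(1)] 1[OF _ r(2) ad(2)] 1[OF _ r(1) ad(3)] top[of x] top[of "x + 1"] CU[of ?p] CU[of ?q]
      by (cases "?p \<in> C"; cases "?q \<in> C") auto
  qed
  from this[of b] have top: "\<phi> (b, d) \<noteq> \<phi> (a - 1, d)" using nC ab by auto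
  have bot: "\<phi> (b, c) = \<phi> (a - 1, c)"
  proof (rule int_const[of "a - 1" b "\<lambda>x. \<phi> (x, c)"])
    fix x assume "a - 1 \<le> x" "x < b"
    then show "\<phi> (x + 1, c) = \<phi> (x, c)" using \<phi>[of "(x, c)" "(x + 1, c)"] nU ab
      by (auto simp: rect_def adj_iff)
  qed (use ab in auto)
  have left: "\<phi> (a - 1, d) = \<phi> (a - 1, c)"
  proof (rule int_const[of c d "\<lambda>y. \<phi> (a - 1, y)"])
    fix y assume y: "c \<le> y" "y < d"
    then have "(a - 1, y) \<in> C" "(a - 1, y + 1) \<in> C" by (auto simp: C_def)
    then show "\<phi> (a - 1, y + 1) = \<phi> (a - 1, y)" using \<phi>[of "(a - 1, y)" "(a - 1, y + 1)"] CU[of "(a - 1, y)"] CU[of "(a - 1, y + 1)"] y ab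
      by (auto simp: rect_def adj_iff)
  qed (use ab in auto)
  have right: "\<phi> (b, d) = \<phi> (b, c)"
  proof (rule int_const[of c d "\<lambda>y. \<phi> (b, y)"])
    fix y assume y: "c \<le> y" "y < d"
    then show "\<phi> (b, y + 1) = \<phi> (b, y)" using \<phi>[of "(b, y)" "(b, y + 1)"] nC ab
      by (auto simp: rect_def adj_iff)
  qed (use ab in auto)
  show False using top bot left right by auto
qed

lemma gadj_corner:
  assumes "gadj s p q" "\<not> gadj False p q" "p \<in> rect a b c d" "q \<in> rect a b c d"
  obtains k where "s" "k \<in> rect a b c d" "gadj False p k" "gadj False k q"
proof -
  have s: s using assms(1,2) by (cases s) auto
  have "gadj False p (fst p, snd q)" "gadj False (fst p, snd q) q"
    using assms(1,2) s by (auto simp: gadj_iff)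
  moreover have "(fst p, snd q) \<in> rect a b c d" using assms(3,4) by (auto simp: rect_def)
  ultimately show ?thesis using that s by blast
qed

text \<open>The interface between the cluster \<open>C\<close> of \<open>u1\<close> and the dual
  component \<open>U\<close> of \<open>v\<close> separates \<open>u1\<close> from \<open>v\<close>
  but not \<open>v\<close> from \<open>u3\<close>. So \<open>\<phi>\<close> differs at
  \<open>x1\<close> and \<open>x3\<close>, and the interface must meet the boundary, which requires
  \<open>U\<close> to reach it.\<close>

lemma dual_arm:
  assumes ab: "a < b" "c < d" and v: "v \<in> rect a b c d" "v \<notin> bdry a b c d"
    and A': "A' = A \<inter> rect a b c d - {v}"
    and u: "gadj s v u1" "gadj s v u3" "conn s A' u1 x1" "conn s A' u3 x3"
    and x: "x1 \<in> bdry a b c d" "x3 \<in> bdry a b c d" and nc: "\<not> conn s A' u1 u3"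
  obtains u w where "gadj (\<not> s) v u" "w \<in> bdry a b c d" "conn (\<not> s) (rect a b c d - A - {v}) u w"
proof -
  let ?R = "rect a b c d"
  define C where "C = {z. conn s A' u1 z}"
  define W where "W = ?R - A'"
  define U where "U = {z. conn (\<not> s) W v z}"
  have vW: "v \<in> W" using v unfolding W_def A' by auto
  have W': "W - {v} = ?R - A - {v}" unfolding W_def A' by auto
  have UW: "U \<subseteq> W" unfolding U_def using conn_in by blast
  have CA: "C \<subseteq> A'" unfolding C_def using conn_in by blast
  have CW: "C \<inter> W = {}" using CA unfolding W_def by blast
  have CR: "C \<subseteq> ?R" using CA unfolding A' by auto
  have WR: "W \<subseteq> ?R" unfolding W_def by auto
  have 1: "q \<in> C \<or> q \<in> W" if "p \<in> C" "q \<in> ?R" "gadj s p q" for p q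
    using that unfolding C_def W_def by (blast intro: conn_extend)
  have 2: "q \<in> U" if "p \<in> U" "q \<in> W" "gadj (\<not> s) p q" for p q
    using that unfolding U_def by (blast intro: conn_extend)
  obtain \<phi> :: "vertex \<Rightarrow> bool" where "\<forall>p q. p \<in> ?R \<longrightarrow> q \<in> ?R \<longrightarrow> adj p q \<longrightarrow>
     (\<phi> p \<noteq> \<phi> q) = (p \<in> C \<and> q \<in> U \<or> q \<in> C \<and> p \<in> U)"
    using cut_potential[OF CW UW CR WR 1 2] ..
  then have \<phi>: "\<And>p q. p \<in> ?R \<Longrightarrow> q \<in> ?R \<Longrightarrow> adj p q \<Longrightarrow>
     (\<phi> p \<noteq> \<phi> q) = (p \<in> C \<and> q \<in> U \<or> q \<in> C \<and> p \<in> U)" by blast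
  have \<phi>': "(\<phi> p \<noteq> \<phi> q) = (p \<in> C \<and> q \<in> U \<or> q \<in> C \<and> p \<in> U)" if "p \<in> ?R" "q \<in> ?R" "gadj False p q" for p q
    using \<phi> that by (simp add: gadj_def)
  have CU: "p \<in> C \<Longrightarrow> p \<notin> U" for p using CW UW by auto
  \<comment> \<open>A diagonal step inside \<open>C\<close> goes around a corner, which is either in
    \<open>U\<close>, giving two flips, or not, giving none.\<close>
  have K1: "\<phi> p = \<phi> q" if "p \<in> C" "q \<in> C" "gadj s p q" for p q
  proof (cases "gadj False p q")
    case True
    then show ?thesis using \<phi>'[of p q] that CR CU[of p] CU[of q] by blast
  next
    case False
    have "p \<in> ?R" "q \<in> ?R" using that CR by auto
    from gadj_corner[OF that(3) False this] obtain k where k: "k \<in> ?R" "gadj False p k" "gadj False k q" .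
    then show ?thesis using \<phi>'[of p k] \<phi>'[of k q] that CR CU[of p] CU[of q] by blast
  qed
  have K2: "\<phi> p = \<phi> q" if "p \<notin> C" "q \<notin> C" "p \<notin> U" "q \<notin> U" "p \<in> ?R" "q \<in> ?R" "gadj s p q" for p q
  proof (cases "gadj False p q")
    case True
    then show ?thesis using \<phi>'[of p q] that by auto
  next
    case False
    from gadj_corner[OF that(7) False that(5,6)] obtain k where k: "k \<in> ?R" "gadj False p k" "gadj False k q" .
    then show ?thesis using \<phi>'[of p k] \<phi>'[of k q] that by auto
  qed
  have vU: "v \<in> U" unfolding U_def using vW by blast
  have u1C: "u1 \<in> C" unfolding C_def using conn_in[OF u(3)] by blast
  have K3: "\<phi> u1 \<noteq> \<phi> v"
  proof (cases "gadj False u1 v")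
    case True
    then show ?thesis using \<phi>'[of u1 v] u1C vU CR v by blast
  next
    case False
    then obtain k where k: "s" "k \<in> ?R" "gadj False u1 k" "gadj False k v"
      using gadj_corner[of s u1 v a b c d] u(1) gadj_sym u1C CR v by blast
    show ?thesis
    proof (cases "k \<in> C")
      case True
      then show ?thesis using \<phi>'[of k v] \<phi>'[of u1 k] k u1C vU CU[of k] CU[of u1] CR v by blast
    next
      case False
      then have "k \<in> W" using 1[OF u1C k(2)] k(3) gadj_False_imp by blast
      then have "k \<in> U" using 2[OF vU, of k] k(1,4) gadj_sym by auto
      then show ?thesis using \<phi>'[of k v] \<phi>'[of u1 k] k False u1C vU CU[of v] CU[of u1] CR v by blast
    qed
  qed
  have C3: "z \<notin> C \<and> z \<notin> U \<and> z \<in> ?R" if "conn s A' u3 z" for z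
    using nc conn_in(2)[OF that] UW conn_trans[OF _ conn_sym[OF that], of u1] unfolding C_def W_def A'
    by blast
  have u3: "conn s A' u3 u3" using u(4) conn_in(1) by blast
  have K4: "\<phi> v = \<phi> u3"
  proof (cases "gadj False v u3")
    case True
    then show ?thesis using \<phi>'[of v u3] C3[OF u3] vU CU[of v] v by blast
  next
    case False
    then obtain k where k: "s" "k \<in> ?R" "gadj False v k" "gadj False k u3"
      using gadj_corner[of s v u3 a b c d] u(2) C3[OF u3] v by blast
    have "k \<notin> C"
    proof
      assume "k \<in> C"
      then have "u3 \<in> C \<or> u3 \<in> W" using 1[of k u3] C3[OF u3] gadj_False_imp[OF k(4)] by simp
      then show False using C3[OF u3] conn_in(1)[OF u3] unfolding W_def by simp
    qed
    then show ?thesis using \<phi>'[of v k] \<phi>'[of k u3] k C3[OF u3] vU CU[of v] v by blast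
  qed
  have 5: "\<phi> u1 = \<phi> x1"
  proof -
    have "\<phi> u1 = \<phi> x1 \<and> x1 \<in> C" using u(3)
    proof (induction rule: conn_induct)
      case refl show ?case using u1C by auto
    next
      case (step y z)
      then have "z \<in> C" unfolding C_def by (blast intro: conn_extend)
      then show ?case using K1[of y z] step by auto
    qed
    then show ?thesis ..
  qed
  have 6: "\<phi> u3 = \<phi> x3"
    using u(4)
  proof (induction rule: conn_induct)
    case (step y z)
    have "conn s A' u3 z" using step by (blast intro: conn_extend)
    from C3[OF this] C3[OF step(1)] show ?case using K2[of y z] step by blast
  qed simp
  \<comment> \<open>If \<open>U\<close> missed the boundary, no boundary edge would join
    \<open>C\<close> to \<open>U\<close>, and \<open>\<phi>\<close> would be constant on the four
    sides.\<close>
  have "U \<inter> bdry a b c d \<noteq> {}"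
  proof
    assume nU: "U \<inter> bdry a b c d = {}"
    have bR: "p \<in> ?R" if "p \<in> bdry a b c d" for p using that unfolding bdry_def by auto
    have E: "\<phi> p = \<phi> q" if "p \<in> bdry a b c d" "q \<in> bdry a b c d" "adj p q" for p q
    proof -
      have "p \<notin> U" "q \<notin> U" using that nU by auto
      then show ?thesis using \<phi>[OF bR[OF that(1)] bR[OF that(2)] that(3)] by simp
    qed
    have bot: "\<phi> (x, c) = \<phi> (a, c)" if "a \<le> x" "x \<le> b" for x
    proof (rule int_const[of a b "\<lambda>x. \<phi> (x, c)"])
      fix z assume "a \<le> z" "z < b"
      then show "\<phi> (z + 1, c) = \<phi> (z, c)" by (intro E) (use ab in \<open>auto simp: bdry_def rect_def adj_iff\<close>)
    qed (use that in auto)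
    have left: "\<phi> (a, y) = \<phi> (a, c)" if "c \<le> y" "y \<le> d" for y
    proof (rule int_const[of c d "\<lambda>y. \<phi> (a, y)"])
      fix z assume "c \<le> z" "z < d"
      then show "\<phi> (a, z + 1) = \<phi> (a, z)" by (intro E) (use ab in \<open>auto simp: bdry_def rect_def adj_iff\<close>)
    qed (use that in auto)
    have top: "\<phi> (x, d) = \<phi> (a, d)" if "a \<le> x" "x \<le> b" for x
    proof (rule int_const[of a b "\<lambda>x. \<phi> (x, d)"])
      fix z assume "a \<le> z" "z < b"
      then show "\<phi> (z + 1, d) = \<phi> (z, d)" by (intro E) (use ab in \<open>auto simp: bdry_def rect_def adj_iff\<close>)
    qed (use that in auto)
    have right: "\<phi> (b, y) = \<phi> (b, c)" if "c \<le> y" "y \<le> d" for y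
    proof (rule int_const[of c d "\<lambda>y. \<phi> (b, y)"])
      fix z assume "c \<le> z" "z < d"
      then show "\<phi> (b, z + 1) = \<phi> (b, z)" by (intro E) (use ab in \<open>auto simp: bdry_def rect_def adj_iff\<close>)
    qed (use that in auto)
    have all: "\<phi> p = \<phi> (a, c)" if p: "p \<in> bdry a b c d" for p
    proof -
      obtain p1 p2 where e: "p = (p1, p2)" by (cases p)
      have r: "a \<le> p1" "p1 \<le> b" "c \<le> p2" "p2 \<le> d" and o: "p1 = a \<or> p1 = b \<or> p2 = c \<or> p2 = d"
        using p unfolding e bdry_def rect_def by auto
      from o show ?thesis
      proof (elim disjE)
        assume "p1 = a" then show ?thesis using left[of p2] r e by simp
      next
        assume "p1 = b" then show ?thesis using right[of p2] bot[of b] r e ab by simp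
      next
        assume "p2 = c" then show ?thesis using bot[of p1] r e by simp
      next
        assume "p2 = d" then show ?thesis using top[of p1] left[of d] r e ab by simp
      qed
    qed
    show False using K3 K4 5 6 all[OF x(1)] all[OF x(2)] by simp
  qed
  then obtain w where w: "w \<in> bdry a b c d" "conn (\<not> s) W v w" unfolding U_def by blast
  then have "w \<noteq> v" using v by auto
  from conn_leave[OF w(2) this] obtain u where "gadj (\<not> s) v u" "conn (\<not> s) (W - {v}) u w" .
  then show ?thesis using that w(1) unfolding W' by blast
qed


section \<open>Expectations over a random subset of a finite set\<close>

text \<open>The mean of \<open>f A\<close> when the elements of \<open>W\<close> belong to
  \<open>A\<close> independently with probability \<open>b\<close>. As a finite sum it is accessible
  to induction on \<open>W\<close>, conditioning on one element at a time.\<close>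

definition pexp :: "real \<Rightarrow> 'a set \<Rightarrow> ('a set \<Rightarrow> real) \<Rightarrow> real" where
  "pexp b W f = (\<Sum>A\<in>Pow W. b ^ card A * (1 - b) ^ card (W - A) * f A)"

definition pr :: "real \<Rightarrow> 'a set \<Rightarrow> ('a set \<Rightarrow> bool) \<Rightarrow> real" where
  "pr b W P = pexp b W (\<lambda>A. of_bool (P A))"

lemma pexp_cong: "(\<And>A. A \<subseteq> W \<Longrightarrow> f A = g A) \<Longrightarrow> pexp b W f = pexp b W g"
  unfolding pexp_def by (intro sum.cong) auto

lemma pr_cong: "(\<And>A. A \<subseteq> W \<Longrightarrow> P A = Q A) \<Longrightarrow> pr b W P = pr b W Q"
  unfolding pr_def by (intro pexp_cong) auto

lemma pexp_empty [simp]: "pexp b {} f = f {}"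
  by (simp add: pexp_def)

lemma pexp_insert:
  assumes "finite W" "x \<notin> W"
  shows "pexp b (insert x W) f = b * pexp b W (\<lambda>A. f (insert x A)) + (1 - b) * pexp b W f"
proof -
  have 1: "b ^ card (insert x A) * (1 - b) ^ card (insert x W - insert x A) * f (insert x A) =
     b * (b ^ card A * (1 - b) ^ card (W - A) * f (insert x A))" if "A \<in> Pow W" for A
  proof -
    have "insert x W - insert x A = W - A" "card (insert x A) = Suc (card A)"
      using that assms card_insert_disjoint[OF finite_subset[of A W], of x] by auto
    then show ?thesis by simp
  qed
  have 2: "b ^ card A * (1 - b) ^ card (insert x W - A) * f A =
     (1 - b) * (b ^ card A * (1 - b) ^ card (W - A) * f A)" if "A \<in> Pow W" for A
  proof -
    have "insert x W - A = insert x (W - A)" using that assms by auto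
    then show ?thesis using assms by simp
  qed
  have inj: "inj_on (insert x) (Pow W)" using assms(2) by (auto simp: inj_on_def)
  have "pexp b (insert x W) f =
    (\<Sum>A\<in>Pow W. b ^ card A * (1 - b) ^ card (insert x W - A) * f A) +
    (\<Sum>A\<in>insert x ` Pow W. b ^ card A * (1 - b) ^ card (insert x W - A) * f A)"
    unfolding pexp_def Pow_insert using assms by (intro sum.union_disjoint) auto
  also have "(\<Sum>A\<in>insert x ` Pow W. b ^ card A * (1 - b) ^ card (insert x W - A) * f A) =
     b * pexp b W (\<lambda>A. f (insert x A))"
    unfolding sum.reindex[OF inj] o_def pexp_def sum_distrib_left by (intro sum.cong 1) auto
  also have "(\<Sum>A\<in>Pow W. b ^ card A * (1 - b) ^ card (insert x W - A) * f A) = (1 - b) * pexp b W f"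
    unfolding pexp_def sum_distrib_left by (intro sum.cong 2) auto
  finally show ?thesis by simp
qed

lemma pexp_remove:
  assumes "finite W" "x \<in> W"
  shows "pexp b W f = b * pexp b (W - {x}) (\<lambda>A. f (insert x A)) + (1 - b) * pexp b (W - {x}) f"
  using pexp_insert[of "W - {x}" x b f] assms by (simp add: insert_absorb)

lemma pexp_add: "pexp b W (\<lambda>A. f A + g A) = pexp b W f + pexp b W g"
  unfolding pexp_def by (simp add: algebra_simps sum.distrib)

lemma pexp_cmult: "pexp b W (\<lambda>A. c * f A) = c * pexp b W f"
  unfolding pexp_def by (simp add: algebra_simps sum_distrib_left)

lemma pexp_diff: "pexp b W (\<lambda>A. f A - g A) = pexp b W f - pexp b W g"
  unfolding pexp_def by (simp add: algebra_simps sum_subtractf)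

lemma pexp_sum: "pexp b W (\<lambda>A. \<Sum>i\<in>I. f i A) = (\<Sum>i\<in>I. pexp b W (f i))"
proof -
  have "pexp b W (\<lambda>A. \<Sum>i\<in>I. f i A) = (\<Sum>A\<in>Pow W. \<Sum>i\<in>I. b ^ card A * (1 - b) ^ card (W - A) * f i A)"
    unfolding pexp_def by (simp add: sum_distrib_left)
  then show ?thesis unfolding pexp_def by (subst (asm) sum.swap)
qed

lemma pexp_mono:
  assumes "0 \<le> b" "b \<le> 1" "\<And>A. A \<subseteq> W \<Longrightarrow> f A \<le> g A"
  shows "pexp b W f \<le> pexp b W g"
  unfolding pexp_def by (intro sum_mono mult_left_mono) (use assms in auto)

lemma pexp_const [simp]: "finite W \<Longrightarrow> pexp b W (\<lambda>_. c) = c"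
  by (induction W rule: finite_induct) (auto simp: pexp_insert algebra_simps)

lemma pexp_nonneg:
  assumes "0 \<le> b" "b \<le> 1" "\<And>A. A \<subseteq> W \<Longrightarrow> 0 \<le> f A"
  shows "0 \<le> pexp b W f"
  unfolding pexp_def by (intro sum_nonneg) (use assms in auto)

lemma pexp_Un:
  assumes "finite W1" "finite W2" "W1 \<inter> W2 = {}"
  shows "pexp b (W1 \<union> W2) f = pexp b W1 (\<lambda>A. pexp b W2 (\<lambda>B. f (A \<union> B)))"
  using assms(1,3)
proof (induction W1 arbitrary: f rule: finite_induct)
  case (insert x W1)
  have "pexp b (insert x W1 \<union> W2) f = b * pexp b (W1 \<union> W2) (\<lambda>A. f (insert x A)) + (1 - b) * pexp b (W1 \<union> W2) f"
    using insert assms(2) pexp_insert[of "W1 \<union> W2" x b f] by simp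
  then show ?case using insert by (simp add: pexp_insert)
qed simp

lemma pexp_subset:
  assumes "finite W" "W1 \<subseteq> W" "\<And>A. A \<subseteq> W \<Longrightarrow> f A = f (A \<inter> W1)"
  shows "pexp b W f = pexp b W1 f"
proof -
  have fin: "finite W1" "finite (W - W1)" using assms(1,2) finite_subset by auto
  have W: "W = W1 \<union> (W - W1)" using assms(2) by auto
  have "pexp b W f = pexp b W1 (\<lambda>A. pexp b (W - W1) (\<lambda>B. f (A \<union> B)))"
    by (subst W, rule pexp_Un) (use fin in auto)
  also have "\<dots> = pexp b W1 (\<lambda>A. pexp b (W - W1) (\<lambda>B. f A))"
  proof (intro pexp_cong)
    fix A B assume h: "A \<subseteq> W1" "B \<subseteq> W - W1"
    have "f (A \<union> B) = f ((A \<union> B) \<inter> W1)" by (rule assms(3)) (use h assms(2) in auto)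
    also have "(A \<union> B) \<inter> W1 = A" using h by auto
    finally show "f (A \<union> B) = f A" .
  qed
  finally show ?thesis using fin by simp
qed

lemma pexp_indep:
  assumes "finite W" "W1 \<subseteq> W" "W2 \<subseteq> W" "W1 \<inter> W2 = {}"
    and f: "\<And>A. A \<subseteq> W \<Longrightarrow> f A = f (A \<inter> W1)" and g: "\<And>A. A \<subseteq> W \<Longrightarrow> g A = g (A \<inter> W2)"
  shows "pexp b W (\<lambda>A. f A * g A) = pexp b W f * pexp b W g"
proof -
  have fin: "finite W1" "finite W2" using assms(1-3) finite_subset by auto
  have "pexp b W (\<lambda>A. f A * g A) = pexp b (W1 \<union> W2) (\<lambda>A. f A * g A)"
  proof (rule pexp_subset)
    fix A assume A: "A \<subseteq> W"
    have "f (A \<inter> (W1 \<union> W2)) = f (A \<inter> (W1 \<union> W2) \<inter> W1)" "g (A \<inter> (W1 \<union> W2)) = g (A \<inter> (W1 \<union> W2) \<inter> W2)"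
      using A by (intro f g; auto)+
    moreover have "A \<inter> (W1 \<union> W2) \<inter> W1 = A \<inter> W1" "A \<inter> (W1 \<union> W2) \<inter> W2 = A \<inter> W2" by auto
    ultimately show "f A * g A = f (A \<inter> (W1 \<union> W2)) * g (A \<inter> (W1 \<union> W2))" using f[OF A] g[OF A] by simp
  qed (use assms in auto)
  also have "\<dots> = pexp b W1 (\<lambda>A. pexp b W2 (\<lambda>B. f (A \<union> B) * g (A \<union> B)))"
    by (rule pexp_Un) (use fin assms in auto)
  also have "\<dots> = pexp b W1 (\<lambda>A. pexp b W2 (\<lambda>B. f A * g B))"
  proof (intro pexp_cong)
    fix A B assume h: "A \<subseteq> W1" "B \<subseteq> W2"
    have "f (A \<union> B) = f ((A \<union> B) \<inter> W1)" "g (A \<union> B) = g ((A \<union> B) \<inter> W2)"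
      using h assms by (intro f g; auto)+
    moreover have "(A \<union> B) \<inter> W1 = A" "(A \<union> B) \<inter> W2 = B" using h assms(4) by auto
    ultimately show "f (A \<union> B) * g (A \<union> B) = f A * g B" by simp
  qed
  also have "\<dots> = pexp b W1 f * pexp b W2 g"
    by (simp add: pexp_cmult mult.commute[of _ "pexp b W2 g"])
  also have "pexp b W1 f = pexp b W f" by (rule pexp_subset[symmetric]) (use assms f in auto)
  also have "pexp b W2 g = pexp b W g" by (rule pexp_subset[symmetric]) (use assms g in auto)
  finally show ?thesis .
qed

lemma pexp_image:
  assumes "inj_on T W"
  shows "pexp b (T ` W) f = pexp b W (\<lambda>A. f (T ` A))"
proof -
  have inj: "inj_on (image T) (Pow W)" using assms by (auto simp: inj_on_def inj_on_image_eq_iff)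
  have "Pow (T ` W) = image T ` Pow W" by (rule image_Pow_surj[symmetric]) simp
  then have "pexp b (T ` W) f = (\<Sum>A\<in>Pow W. b ^ card (T ` A) * (1 - b) ^ card (T ` W - T ` A) * f (T ` A))"
    unfolding pexp_def by (simp add: sum.reindex[OF inj])
  also have "\<dots> = pexp b W (\<lambda>A. f (T ` A))"
    unfolding pexp_def
  proof (intro sum.cong refl)
    fix A assume A: "A \<in> Pow W"
    have "T ` W - T ` A = T ` (W - A)" using A assms by (intro inj_on_image_set_diff[symmetric]) auto
    moreover have "card (T ` A) = card A" "card (T ` (W - A)) = card (W - A)"
      using A assms by (intro card_image; auto intro: inj_on_subset)+
    ultimately show "b ^ card (T ` A) * (1 - b) ^ card (T ` W - T ` A) * f (T ` A) =
       b ^ card A * (1 - b) ^ card (W - A) * f (T ` A)" by simp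
  qed
  finally show ?thesis .
qed

lemma pexp_compl: "pexp b W f = pexp (1 - b) W (\<lambda>A. f (W - A))"
proof -
  have "pexp b W f = (\<Sum>A\<in>Pow W. b ^ card (W - A) * (1 - b) ^ card (W - (W - A)) * f (W - A))"
    unfolding pexp_def by (rule sum.reindex_bij_witness[of _ "\<lambda>A. W - A" "\<lambda>A. W - A"]) (auto simp: double_diff)
  also have "\<dots> = pexp (1 - b) W (\<lambda>A. f (W - A))"
    unfolding pexp_def by (intro sum.cong) (auto simp: double_diff)
  finally show ?thesis .
qed

text \<open>For one element this is Chebyshev's inequality
  \<open>(f1 - f0) * (g1 - g0) \<ge> 0\<close>; the induction conditions on one element and applies
  it to the conditional means.\<close>

lemma pexp_harris:
  assumes b: "0 \<le> b" "b \<le> 1" and fin: "finite W"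
    and "\<And>A B. A \<subseteq> B \<Longrightarrow> B \<subseteq> W \<Longrightarrow> f A \<le> f B" "\<And>A B. A \<subseteq> B \<Longrightarrow> B \<subseteq> W \<Longrightarrow> g A \<le> g B"
  shows "pexp b W f * pexp b W g \<le> pexp b W (\<lambda>A. f A * g A)"
  using fin assms(4,5)
proof (induction W arbitrary: f g rule: finite_induct)
  case (insert x W)
  define f1 f0 g1 g0 where d: "f1 = pexp b W (\<lambda>A. f (insert x A))" "f0 = pexp b W f"
    "g1 = pexp b W (\<lambda>A. g (insert x A))" "g0 = pexp b W g"
  have 1: "f1 * g1 \<le> pexp b W (\<lambda>A. f (insert x A) * g (insert x A))"
    unfolding d by (rule insert.IH) (rule insert.prems; auto)+
  have 0: "f0 * g0 \<le> pexp b W (\<lambda>A. f A * g A)"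
    unfolding d by (rule insert.IH) (rule insert.prems; auto)+
  have "f0 \<le> f1" "g0 \<le> g1" unfolding d using b by (intro pexp_mono insert.prems; auto)+
  then have "0 \<le> b * (1 - b) * ((f1 - f0) * (g1 - g0))" using b by simp
  then have "(b * f1 + (1 - b) * f0) * (b * g1 + (1 - b) * g0) \<le> b * (f1 * g1) + (1 - b) * (f0 * g0)"
    by (simp add: algebra_simps)
  also have "\<dots> \<le> b * pexp b W (\<lambda>A. f (insert x A) * g (insert x A)) + (1 - b) * pexp b W (\<lambda>A. f A * g A)"
    using b by (intro add_mono mult_left_mono 1 0) auto
  finally show ?case using insert(1,2) unfolding d by (simp add: pexp_insert)
qed simp

lemma pexp_CS:
  assumes "0 \<le> b" "b \<le> 1"
  shows "pexp b W (\<lambda>A. f A * g A) \<le> sqrt (pexp b W (\<lambda>A. (f A)\<^sup>2)) * sqrt (pexp b W (\<lambda>A. (g A)\<^sup>2))"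
proof -
  define w where "w A = sqrt (b ^ card A * (1 - b) ^ card (W - A))" for A
  have w: "b ^ card A * (1 - b) ^ card (W - A) = w A * w A" for A
    unfolding w_def using assms by simp
  have "(\<Sum>A\<in>Pow W. (w A * f A) * (w A * g A)) \<le> L2_set (\<lambda>A. w A * f A) (Pow W) * L2_set (\<lambda>A. w A * g A) (Pow W)"
    by (rule order_trans[OF _ L2_set_mult_ineq]) (intro sum_mono, metis abs_ge_self abs_mult)
  then show ?thesis unfolding pexp_def w L2_set_def by (simp add: power2_eq_square mult_ac)
qed

lemma pr_nonneg: "0 \<le> b \<Longrightarrow> b \<le> 1 \<Longrightarrow> 0 \<le> pr b W P"
  unfolding pr_def by (rule pexp_nonneg) auto

lemma pr_mono:
  assumes "0 \<le> b" "b \<le> 1" "\<And>A. A \<subseteq> W \<Longrightarrow> P A \<Longrightarrow> Q A"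
  shows "pr b W P \<le> pr b W Q"
  unfolding pr_def by (rule pexp_mono) (use assms in auto)

lemma pr_le_1: "finite W \<Longrightarrow> 0 \<le> b \<Longrightarrow> b \<le> 1 \<Longrightarrow> pr b W P \<le> 1"
  using pexp_mono[of b W "\<lambda>A. of_bool (P A)" "\<lambda>_. 1"] unfolding pr_def by auto

lemma pr_not: "finite W \<Longrightarrow> pr b W (\<lambda>A. \<not> P A) = 1 - pr b W P"
  using pexp_diff[of b W "\<lambda>_. 1" "\<lambda>A. of_bool (P A)"] unfolding pr_def
  by (auto simp: of_bool_not_iff)

lemma pr_disj_le:
  assumes "0 \<le> b" "b \<le> 1"
  shows "pr b W (\<lambda>A. P A \<or> Q A) \<le> pr b W P + pr b W Q"
  unfolding pr_def pexp_add[symmetric] by (rule pexp_mono) (use assms in auto)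

lemma pr_harris:
  assumes "0 \<le> b" "b \<le> 1" "finite W"
    and "\<And>A B. A \<subseteq> B \<Longrightarrow> B \<subseteq> W \<Longrightarrow> P A \<Longrightarrow> P B" "\<And>A B. A \<subseteq> B \<Longrightarrow> B \<subseteq> W \<Longrightarrow> Q A \<Longrightarrow> Q B"
  shows "pr b W P * pr b W Q \<le> pr b W (\<lambda>A. P A \<and> Q A)"
proof -
  have "pr b W P * pr b W Q \<le> pexp b W (\<lambda>A. of_bool (P A) * of_bool (Q A))"
    unfolding pr_def
    by (rule pexp_harris[OF assms(1-3)]) (use assms(4,5) in \<open>auto simp: of_bool_def\<close>)
  then show ?thesis unfolding pr_def by (simp add: of_bool_conj)
qed

lemma pr_subset:
  assumes "finite W" "W1 \<subseteq> W" "\<And>A. A \<subseteq> W \<Longrightarrow> P A = P (A \<inter> W1)"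
  shows "pr b W P = pr b W1 P"
  unfolding pr_def by (rule pexp_subset) (use assms in auto)

lemma pr_image: "inj_on T W \<Longrightarrow> pr b (T ` W) P = pr b W (\<lambda>A. P (T ` A))"
  unfolding pr_def by (rule pexp_image)

lemma pexp_partition:
  assumes "finite W" "\<And>A. A \<subseteq> W \<Longrightarrow> h A \<in> I" "finite I"
  shows "pexp b W f = (\<Sum>i\<in>I. pexp b W (\<lambda>A. of_bool (h A = i) * f A))"
proof -
  have "pexp b W f = pexp b W (\<lambda>A. \<Sum>i\<in>I. of_bool (h A = i) * f A)"
  proof (rule pexp_cong)
    fix A assume "A \<subseteq> W"
    then have "(\<Sum>i\<in>I. of_bool (h A = i) * f A) = (\<Sum>i\<in>I. if i = h A then f A else 0)"
      by (intro sum.cong) auto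
    also have "\<dots> = f A" using assms \<open>A \<subseteq> W\<close> by simp
    finally show "f A = (\<Sum>i\<in>I. of_bool (h A = i) * f A)" by simp
  qed
  then show ?thesis by (simp add: pexp_sum)
qed

subsection \<open>Influences and a second moment\<close>

text \<open>As \<open>J u\<close> ignores the colour of \<open>u\<close>, the variable
  \<open>c u\<close> has mean zero given the other colours, and pairing \<open>F\<close> with it
  extracts the influence of \<open>u\<close>. The correlation of \<open>c u\<close> and
  \<open>c w\<close> is an average of products of the two discrete derivatives in
  \<open>neg\<close>, hence nonpositive, so only the diagonal terms of the second moment remain for
  the Cauchy-Schwarz inequality.\<close>

lemma influence_bound:
  fixes J :: "'a \<Rightarrow> 'a set \<Rightarrow> bool" and F :: "'a set \<Rightarrow> real"
  assumes b: "0 \<le> b" "b \<le> 1" and fin: "finite W" and M: "M \<subseteq> W"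
    and J: "\<And>u A. u \<in> M \<Longrightarrow> A \<subseteq> W \<Longrightarrow> u \<notin> A \<Longrightarrow> J u (insert u A) = J u A"
    and F: "\<And>u A. u \<in> M \<Longrightarrow> A \<subseteq> W \<Longrightarrow> u \<notin> A \<Longrightarrow> \<not> J u A \<Longrightarrow> F (insert u A) = F A"
    and neg: "\<And>u w A. u \<in> M \<Longrightarrow> w \<in> M \<Longrightarrow> u \<noteq> w \<Longrightarrow> A \<subseteq> W \<Longrightarrow> u \<notin> A \<Longrightarrow> w \<notin> A \<Longrightarrow>
      (of_bool (J u (insert w A)) - of_bool (J u A)) * (of_bool (J w (insert u A)) - of_bool (J w A)) \<le> (0::real)"
  shows "b * (1 - b) * (\<Sum>u\<in>M. pexp b (W - {u}) (\<lambda>A. F (insert u A) - F A)) \<le>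
    sqrt (pexp b W (\<lambda>A. (F A)\<^sup>2)) * sqrt (b * (1 - b) * (\<Sum>u\<in>M. pr b W (J u)))"
proof -
  define c where "c u A = (of_bool (u \<in> A) - b) * of_bool (J u A)" for u A
  have fM: "finite M" using M fin finite_subset by auto
  have single: "pexp b W (\<lambda>A. F A * c u A) = b * (1 - b) * pexp b (W - {u}) (\<lambda>A. F (insert u A) - F A)"
    if u: "u \<in> M" for u
  proof -
    have "pexp b W (\<lambda>A. F A * c u A) =
      b * pexp b (W - {u}) (\<lambda>A. F (insert u A) * c u (insert u A)) + (1 - b) * pexp b (W - {u}) (\<lambda>A. F A * c u A)"
      by (rule pexp_remove) (use u M fin in auto)
    also have "\<dots> = pexp b (W - {u}) (\<lambda>A. b * (F (insert u A) * c u (insert u A)) + (1 - b) * (F A * c u A))"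
      by (simp add: pexp_add pexp_cmult)
    also have "\<dots> = pexp b (W - {u}) (\<lambda>A. b * (1 - b) * (F (insert u A) - F A))"
    proof (rule pexp_cong)
      fix A assume A: "A \<subseteq> W - {u}"
      then have "u \<notin> A" "A \<subseteq> W" by auto
      then show "b * (F (insert u A) * c u (insert u A)) + (1 - b) * (F A * c u A) = b * (1 - b) * (F (insert u A) - F A)"
        using J[OF u, of A] F[OF u, of A] unfolding c_def by (cases "J u A") (auto simp: algebra_simps)
    qed
    finally show ?thesis by (simp add: pexp_cmult)
  qed
  have diag: "pexp b W (\<lambda>A. c u A * c u A) = b * (1 - b) * pr b W (J u)" if u: "u \<in> M" for u
  proof -
    have "pexp b W (\<lambda>A. c u A * c u A) =
      b * pexp b (W - {u}) (\<lambda>A. c u (insert u A) * c u (insert u A)) + (1 - b) * pexp b (W - {u}) (\<lambda>A. c u A * c u A)"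
      by (rule pexp_remove) (use u M fin in auto)
    also have "\<dots> = pexp b (W - {u}) (\<lambda>A. b * (c u (insert u A) * c u (insert u A)) + (1 - b) * (c u A * c u A))"
      by (simp add: pexp_add pexp_cmult)
    also have "\<dots> = pexp b (W - {u}) (\<lambda>A. b * (1 - b) * (b * of_bool (J u (insert u A)) + (1 - b) * of_bool (J u A)))"
    proof (rule pexp_cong)
      fix A assume A: "A \<subseteq> W - {u}"
      then have "u \<notin> A" "A \<subseteq> W" by auto
      then show "b * (c u (insert u A) * c u (insert u A)) + (1 - b) * (c u A * c u A) =
         b * (1 - b) * (b * of_bool (J u (insert u A)) + (1 - b) * of_bool (J u A))"
        using J[OF u, of A] unfolding c_def by (cases "J u A") (auto simp: algebra_simps)
    qed
    also have "\<dots> = b * (1 - b) * (b * pexp b (W - {u}) (\<lambda>A. of_bool (J u (insert u A))) + (1 - b) * pexp b (W - {u}) (\<lambda>A. of_bool (J u A)))"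
      by (simp add: pexp_add pexp_cmult)
    also have "\<dots> = b * (1 - b) * pr b W (J u)"
      unfolding pr_def using pexp_remove[of W u b "\<lambda>A. of_bool (J u A)"] u M fin by auto
    finally show ?thesis .
  qed
  have off: "pexp b W (\<lambda>A. c u A * c w A) \<le> 0" if u: "u \<in> M" "w \<in> M" "u \<noteq> w" for u w
  proof -
    let ?V = "W - {u} - {w}"
    \<comment> \<open>The mean of \<open>c u * c w\<close> over the four colourings of
      \<open>u\<close> and \<open>w\<close>; it factors as \<open>(b * (1 - b))^2\<close> times the
      product in \<open>neg\<close>.\<close>
    define D where "D A = b * (b * (c u (insert u (insert w A)) * c w (insert u (insert w A))) + (1 - b) * (c u (insert u A) * c w (insert u A)))
      + (1 - b) * (b * (c u (insert w A) * c w (insert w A)) + (1 - b) * (c u A * c w A))" for A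
    have 1: "pexp b (W - {u}) f = b * pexp b ?V (\<lambda>A. f (insert w A)) + (1 - b) * pexp b ?V f" for f
      by (rule pexp_remove) (use u M fin in auto)
    have "pexp b W (\<lambda>A. c u A * c w A) = b * pexp b (W - {u}) (\<lambda>A. c u (insert u A) * c w (insert u A)) +
       (1 - b) * pexp b (W - {u}) (\<lambda>A. c u A * c w A)"
      by (rule pexp_remove) (use u M fin in auto)
    also have "\<dots> = pexp b ?V D"
      unfolding 1 D_def by (simp only: pexp_add pexp_cmult)
    also have "\<dots> \<le> pexp b ?V (\<lambda>_. 0)"
    proof (rule pexp_mono[OF b])
      fix A assume A: "A \<subseteq> ?V"
      then have A': "A \<subseteq> W" "insert w A \<subseteq> W" "insert u A \<subseteq> W" "u \<notin> A" "w \<notin> A" "u \<notin> insert w A" "w \<notin> insert u A"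
        using u M by auto
      have J1: "J u (insert u (insert w A)) = J u (insert w A)" "J u (insert u A) = J u A"
        "J w (insert u (insert w A)) = J w (insert u A)" "J w (insert w A) = J w A"
        using J[OF u(1) A'(2,6)] J[OF u(1) A'(1,4)] J[OF u(2) A'(3,7)] J[OF u(2) A'(1,5)]
        by (auto simp: insert_commute)
      have "D A = b * (1 - b) * (b * (1 - b)) * ((of_bool (J u (insert w A)) - of_bool (J u A)) * (of_bool (J w (insert u A)) - of_bool (J w A)))"
        unfolding D_def c_def J1 using A' u(3)
        by (simp add: algebra_simps)
      also have "\<dots> \<le> 0" by (rule mult_nonneg_nonpos[OF _ neg[OF u A'(1,4,5)]]) (use b in simp)
      finally show "D A \<le> 0" .
    qed
    finally show ?thesis using fin by simp
  qed
  have "b * (1 - b) * (\<Sum>u\<in>M. pexp b (W - {u}) (\<lambda>A. F (insert u A) - F A)) = (\<Sum>u\<in>M. pexp b W (\<lambda>A. F A * c u A))"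
    unfolding sum_distrib_left by (intro sum.cong) (auto simp: single)
  also have "\<dots> = pexp b W (\<lambda>A. F A * (\<Sum>u\<in>M. c u A))"
    by (simp add: pexp_sum[symmetric] sum_distrib_left)
  also have "\<dots> \<le> sqrt (pexp b W (\<lambda>A. (F A)\<^sup>2)) * sqrt (pexp b W (\<lambda>A. (\<Sum>u\<in>M. c u A)\<^sup>2))"
    by (rule pexp_CS[OF b])
  also have "\<dots> \<le> sqrt (pexp b W (\<lambda>A. (F A)\<^sup>2)) * sqrt (b * (1 - b) * (\<Sum>u\<in>M. pr b W (J u)))"
  proof (intro mult_left_mono real_sqrt_le_mono)
    have "pexp b W (\<lambda>A. (\<Sum>u\<in>M. c u A)\<^sup>2) = (\<Sum>u\<in>M. \<Sum>w\<in>M. pexp b W (\<lambda>A. c u A * c w A))"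
      by (simp add: power2_eq_square sum_product pexp_sum)
    also have "\<dots> \<le> (\<Sum>u\<in>M. \<Sum>w\<in>M. if w = u then b * (1 - b) * pr b W (J u) else 0)"
      by (intro sum_mono) (auto simp: diag off)
    also have "\<dots> = b * (1 - b) * (\<Sum>u\<in>M. pr b W (J u))"
      using fM by (simp add: sum_distrib_left)
    finally show "pexp b W (\<lambda>A. (\<Sum>u\<in>M. c u A)\<^sup>2) \<le> b * (1 - b) * (\<Sum>u\<in>M. pr b W (J u))" .
  qed (use b in \<open>auto intro: pexp_nonneg\<close>)
  finally show ?thesis .
qed

subsection \<open>The number of crossing clusters\<close>

definition cluster :: "bool \<Rightarrow> vertex set \<Rightarrow> vertex \<Rightarrow> vertex set" where
  "cluster s A x = {z. conn s A x z}"

text \<open>The sets are counted, not their starting points, so every cluster counts once. A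
  starting point outside \<open>A\<close> has the empty cluster, which does not meet
  \<open>Y\<close>.\<close>

definition ncross :: "bool \<Rightarrow> vertex set \<Rightarrow> vertex set \<Rightarrow> vertex set \<Rightarrow> nat" where
  "ncross s I Y A = card {C. \<exists>x\<in>I. C = cluster s A x \<and> C \<inter> Y \<noteq> {}}"

text \<open>The vertices that must be inspected to know that the cluster of \<open>x\<close> is
  \<open>C\<close>. The vertex \<open>x\<close> is listed separately for the case of an empty
  cluster, so that an exploration always uses up a vertex.\<close>

definition cbar :: "bool \<Rightarrow> vertex set \<Rightarrow> vertex \<Rightarrow> vertex set \<Rightarrow> vertex set" where
  "cbar s W x C = {z \<in> W. z = x \<or> z \<in> C \<or> (\<exists>c\<in>C. gadj s c z)}"

lemma cluster_subset: "cluster s A x \<subseteq> A"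
  unfolding cluster_def using conn_in by blast

lemma cluster_eq:
  assumes "y \<in> cluster s A x"
  shows "cluster s A y = cluster s A x"
proof -
  have xy: "conn s A x y" using assms by (simp add: cluster_def)
  show ?thesis unfolding cluster_def
    using conn_trans[OF xy] conn_trans[OF conn_sym[OF xy]] by auto
qed

lemma cluster_nonmem: "x \<notin> A \<Longrightarrow> cluster s A x = {}"
  unfolding cluster_def using conn_in by blast

text \<open>A path in \<open>B\<close> starting at \<open>x\<close> cannot leave \<open>C\<close>:
  its first vertex outside \<open>C\<close> would lie in \<open>cbar\<close>, where \<open>A\<close>
  and \<open>B\<close> agree.\<close>

lemma cluster_local:
  assumes "A \<subseteq> W" "B \<subseteq> W" "x \<in> W" "cluster s A x = C" "A \<inter> cbar s W x C = B \<inter> cbar s W x C"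
  shows "cluster s B x = C"
proof
  show "cluster s B x \<subseteq> C"
  proof
    fix z assume "z \<in> cluster s B x"
    then have "conn s B x z" by (simp add: cluster_def)
    then show "z \<in> C"
    proof (induction rule: conn_induct)
      case refl
      then have "x \<in> A" using assms(3,5) unfolding cbar_def by blast
      then show ?case using assms(4) unfolding cluster_def by blast
    next
      case (step y z)
      then have "z \<in> cbar s W x C" using assms(2) unfolding cbar_def by blast
      then have "z \<in> A" using step assms(5) by blast
      then show ?case using step assms(4) unfolding cluster_def by (blast intro: conn_extend)
    qed
  qed
  show "C \<subseteq> cluster s B x"
  proof
    fix z assume "z \<in> C"
    then have c: "conn s A x z" using assms(4) unfolding cluster_def by blast
    have "C \<subseteq> B"
    proof
      fix y assume y: "y \<in> C"
      then have "y \<in> A" using assms(4) cluster_subset by blast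
      then show "y \<in> B" using y assms(1,5) unfolding cbar_def by blast
    qed
    have "conn s (A \<inter> C) x z"
    proof (rule conn_closed[OF c])
      show "x \<in> C" using c conn_in(1)[OF c] assms(4) unfolding cluster_def by blast
      show "\<And>u v. u \<in> C \<Longrightarrow> u \<in> A \<Longrightarrow> v \<in> A \<Longrightarrow> gadj s u v \<Longrightarrow> v \<in> C"
        using assms(4) unfolding cluster_def by (blast intro: conn_extend)
    qed
    then have "conn s B x z" by (rule conn_mono) (use \<open>C \<subseteq> B\<close> in blast)
    then show "z \<in> cluster s B x" unfolding cluster_def by simp
  qed
qed

text \<open>A vertex of \<open>A\<close> in \<open>cbar\<close> is already in \<open>C\<close>, so
  deleting \<open>cbar\<close> removes exactly this cluster and leaves the others intact.\<close>

lemma ncross_explore: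
  assumes fin: "finite W" and A: "A \<subseteq> W" and x: "x \<in> W" "x \<in> I" and C: "cluster s A x = C"
  shows "ncross s I Y A = ncross s I Y (A - cbar s W x C) + of_bool (C \<inter> Y \<noteq> {})"
proof -
  let ?B = "A - cbar s W x C"
  define K where "K = {D. \<exists>y\<in>I. D = cluster s ?B y \<and> D \<inter> Y \<noteq> {}}"
  have out: "y \<notin> cbar s W x C" if yA: "y \<in> A" "y \<notin> C" for y
  proof
    assume "y \<in> cbar s W x C"
    then consider "y = x" | c where "c \<in> C" "gadj s c y" using yA(2) unfolding cbar_def by blast
    then show False
    proof cases
      case 1
      then have "conn s A x y" using yA by blast
      then show ?thesis using yA C unfolding cluster_def by blast
    next
      case 2
      then have "conn s A x c" using C unfolding cluster_def by blast
      from conn_extend[OF this yA(1) 2(2)] show ?thesis using yA C unfolding cluster_def by blast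
    qed
  qed
  have cl: "cluster s A y = cluster s ?B y" if y: "y \<in> A" "y \<notin> C" for y
  proof
    show "cluster s ?B y \<subseteq> cluster s A y"
      unfolding cluster_def using conn_mono[of s ?B y _ A] by auto
    show "cluster s A y \<subseteq> cluster s ?B y"
    proof
      fix z assume "z \<in> cluster s A y"
      then have c: "conn s A y z" by (simp add: cluster_def)
      have "conn s (A \<inter> (- C)) y z"
      proof (rule conn_closed[OF c])
        fix u v assume h: "u \<in> - C" "u \<in> A" "v \<in> A" "gadj s u v"
        show "v \<in> - C"
        proof
          assume "v \<in> C"
          then have "conn s A x v" using C unfolding cluster_def by blast
          from conn_extend[OF this h(2)] have "conn s A x u" using h(4) gadj_sym by simp
          then show False using h(1) C unfolding cluster_def by blast
        qed
      qed (use y in blast)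
      moreover have "A \<inter> - C \<subseteq> ?B" using out by blast
      ultimately have "conn s ?B y z" by (rule conn_mono)
      then show "z \<in> cluster s ?B y" unfolding cluster_def by simp
    qed
  qed
  have sub: "C \<subseteq> A" using C cluster_subset by blast
  have CB: "C \<inter> ?B = {}" using sub A unfolding cbar_def by blast
  have "{D. \<exists>y\<in>I. D = cluster s A y \<and> D \<inter> Y \<noteq> {}} = K \<union> {D. D = C \<and> C \<inter> Y \<noteq> {}}" (is "?L = ?R")
  proof (intro equalityI subsetI)
    fix D assume "D \<in> ?L"
    then obtain y where y: "y \<in> I" "D = cluster s A y" "D \<inter> Y \<noteq> {}" by blast
    then have "y \<in> A" using cluster_nonmem by blast
    show "D \<in> ?R"
    proof (cases "y \<in> C")
      case True
      then show ?thesis using y C cluster_eq by blast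
    next
      case False
      then show ?thesis using y cl \<open>y \<in> A\<close> unfolding K_def by blast
    qed
  next
    fix D assume "D \<in> ?R"
    then consider "D \<in> K" | "D = C" "C \<inter> Y \<noteq> {}" by blast
    then show "D \<in> ?L"
    proof cases
      case 1
      then obtain y where y: "y \<in> I" "D = cluster s ?B y" "D \<inter> Y \<noteq> {}" unfolding K_def by blast
      then have "y \<in> ?B" using cluster_nonmem by blast
      then have "y \<in> A" "y \<notin> C" using CB by auto
      then show ?thesis using y cl by blast
    next
      case 2
      then show ?thesis using x C by blast
    qed
  qed
  moreover have "finite K"
  proof (rule finite_subset)
    show "K \<subseteq> Pow W" unfolding K_def using A cluster_subset[of s ?B] by blast
  qed (use fin in simp)
  moreover have "K \<inter> {D. D = C \<and> C \<inter> Y \<noteq> {}} = {}"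
  proof -
    have "D \<subseteq> ?B" if "D \<in> K" for D using that cluster_subset unfolding K_def by blast
    then show ?thesis using CB unfolding K_def by blast
  qed
  ultimately have "ncross s I Y A = card K + card {D. D = C \<and> C \<inter> Y \<noteq> {}}"
    unfolding ncross_def by (simp add: card_Un_disjoint)
  moreover have "card {D. D = C \<and> C \<inter> Y \<noteq> {}} = of_bool (C \<inter> Y \<noteq> {})" by auto
  ultimately show ?thesis unfolding ncross_def K_def by simp
qed

text \<open>The event that the cluster is \<open>C\<close> depends on \<open>cbar\<close> only, so
  the unexplored vertices keep their product law.\<close>

lemma ncross_recursion:
  assumes fin: "finite W" and x: "x \<in> W" "x \<in> I"
  shows "pr b W (\<lambda>A. k \<le> ncross s I Y A) =
    (\<Sum>C\<in>Pow W. pr b W (\<lambda>A. cluster s A x = C) *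
       pr b (W - cbar s W x C) (\<lambda>A. k \<le> ncross s I Y A + of_bool (C \<inter> Y \<noteq> {})))"
proof -
  have "pr b W (\<lambda>A. k \<le> ncross s I Y A) =
    (\<Sum>C\<in>Pow W. pexp b W (\<lambda>A. of_bool (cluster s A x = C) * of_bool (k \<le> ncross s I Y A)))"
    unfolding pr_def
  proof (rule pexp_partition[OF fin])
    fix A assume "A \<subseteq> W" then show "cluster s A x \<in> Pow W" using cluster_subset[of s A x] by auto
  qed (use fin in simp)
  also have "\<dots> = (\<Sum>C\<in>Pow W. pr b W (\<lambda>A. cluster s A x = C) *
       pr b (W - cbar s W x C) (\<lambda>A. k \<le> ncross s I Y A + of_bool (C \<inter> Y \<noteq> {})))"
  proof (intro sum.cong refl)
    fix C assume "C \<in> Pow W"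
    let ?g = "\<lambda>A. of_bool (k \<le> ncross s I Y (A - cbar s W x C) + of_bool (C \<inter> Y \<noteq> {})) :: real"
    have "pexp b W (\<lambda>A. of_bool (cluster s A x = C) * of_bool (k \<le> ncross s I Y A)) =
      pexp b W (\<lambda>A. of_bool (cluster s A x = C) * ?g A)"
      by (rule pexp_cong) (use ncross_explore[OF fin _ x] in \<open>auto simp: of_bool_def\<close>)
    also have "\<dots> = pexp b W (\<lambda>A. of_bool (cluster s A x = C)) * pexp b W ?g"
    proof (rule pexp_indep[OF fin, of "cbar s W x C" "W - cbar s W x C"])
      show "cbar s W x C \<subseteq> W" unfolding cbar_def by blast
      fix A assume A: "A \<subseteq> W"
      show "of_bool (cluster s A x = C) = (of_bool (cluster s (A \<inter> cbar s W x C) x = C) :: real)"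
        using cluster_local[of A W "A \<inter> cbar s W x C" x s C] cluster_local[of "A \<inter> cbar s W x C" W A x s C] A x
        by (auto simp: of_bool_def)
      have "A \<inter> (W - cbar s W x C) - cbar s W x C = A - cbar s W x C" using A by blast
      then show "?g A = ?g (A \<inter> (W - cbar s W x C))" by simp
    qed auto
    also have "pexp b W ?g = pexp b (W - cbar s W x C) ?g"
    proof (rule pexp_subset[OF fin])
      fix A assume A: "A \<subseteq> W"
      have "A \<inter> (W - cbar s W x C) - cbar s W x C = A - cbar s W x C" using A by blast
      then show "?g A = ?g (A \<inter> (W - cbar s W x C))" by simp
    qed auto
    also have "\<dots> = pr b (W - cbar s W x C) (\<lambda>A. k \<le> ncross s I Y A + of_bool (C \<inter> Y \<noteq> {}))"
      unfolding pr_def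
    proof (rule pexp_cong)
      fix A assume "A \<subseteq> W - cbar s W x C"
      then have "A - cbar s W x C = A" by blast
      then show "?g A = of_bool (k \<le> ncross s I Y A + of_bool (C \<inter> Y \<noteq> {}))" by simp
    qed
    finally show "pexp b W (\<lambda>A. of_bool (cluster s A x = C) * of_bool (k \<le> ncross s I Y A)) =
      pr b W (\<lambda>A. cluster s A x = C) * pr b (W - cbar s W x C) (\<lambda>A. k \<le> ncross s I Y A + of_bool (C \<inter> Y \<noteq> {}))"
      unfolding pr_def .
  qed
  finally show ?thesis .
qed

lemma ncross_empty: "I \<inter> A = {} \<Longrightarrow> ncross s I Y A = 0"
proof -
  assume "I \<inter> A = {}"
  then have "{C. \<exists>x\<in>I. C = cluster s A x \<and> C \<inter> Y \<noteq> {}} = {}" using cluster_nonmem by blast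
  then show ?thesis unfolding ncross_def by (metis card.empty)
qed

lemma ncross_pos:
  assumes "finite A"
  shows "1 \<le> ncross s I Y A \<longleftrightarrow> (\<exists>x\<in>I. \<exists>y\<in>Y. conn s A x y)"
proof -
  have "finite {C. \<exists>x\<in>I. C = cluster s A x \<and> C \<inter> Y \<noteq> {}}"
  proof (rule finite_subset)
    show "{C. \<exists>x\<in>I. C = cluster s A x \<and> C \<inter> Y \<noteq> {}} \<subseteq> Pow A"
    proof
      fix C assume "C \<in> {C. \<exists>x\<in>I. C = cluster s A x \<and> C \<inter> Y \<noteq> {}}"
      then obtain x where "C = cluster s A x" by auto
      then show "C \<in> Pow A" using cluster_subset[of s A x] by simp
    qed
  qed (use assms in simp)
  then have "1 \<le> ncross s I Y A \<longleftrightarrow> {C. \<exists>x\<in>I. C = cluster s A x \<and> C \<inter> Y \<noteq> {}} \<noteq> {}"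
    unfolding ncross_def One_nat_def Suc_le_eq card_gt_0_iff by simp
  also have "\<dots> \<longleftrightarrow> (\<exists>x\<in>I. cluster s A x \<inter> Y \<noteq> {})" by auto
  also have "\<dots> \<longleftrightarrow> (\<exists>x\<in>I. \<exists>y\<in>Y. conn s A x y)" by (auto simp: cluster_def)
  finally show ?thesis .
qed

text \<open>The clusters of the vertices of \<open>I\<close> are explored one by one. A cluster
  meeting \<open>Y\<close> uses up one crossing, and the unexplored remainder has another one with
  probability at most \<open>q\<close>, whatever was explored.\<close>

lemma ncross_tail:
  assumes b: "0 \<le> b" "b \<le> 1" and fin: "finite W"
    and q: "pr b W (\<lambda>A. \<exists>x\<in>I. \<exists>y\<in>Y. conn s A x y) \<le> q"
  shows "pr b W (\<lambda>A. k \<le> ncross s I Y A) \<le> q ^ k"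
proof -
  have q0: "0 \<le> q" by (rule order_trans[OF pr_nonneg[OF b] q])
  \<comment> \<open>A smaller vertex set has fewer connections, so the single bound \<open>q\<close>
    serves all remainders.\<close>
  have Q1: "pr b V (\<lambda>A. 1 \<le> ncross s I Y A) \<le> q" if V: "V \<subseteq> W" for V
  proof -
    have fV: "finite V" using V fin finite_subset by auto
    have "pr b V (\<lambda>A. 1 \<le> ncross s I Y A) = pr b V (\<lambda>A. \<exists>x\<in>I. \<exists>y\<in>Y. conn s A x y)"
      by (rule pr_cong, rule ncross_pos, erule finite_subset[OF _ fV])
    also have "\<dots> = pr b V (\<lambda>A. \<exists>x\<in>I. \<exists>y\<in>Y. conn s (A \<inter> V) x y)"
      by (rule pr_cong) (simp add: inf.absorb1)
    also have "\<dots> = pr b W (\<lambda>A. \<exists>x\<in>I. \<exists>y\<in>Y. conn s (A \<inter> V) x y)"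
      by (rule pr_subset[symmetric]) (use V fin in \<open>auto simp: Int_assoc\<close>)
    also have "\<dots> \<le> pr b W (\<lambda>A. \<exists>x\<in>I. \<exists>y\<in>Y. conn s A x y)"
      by (rule pr_mono[OF b]) (meson conn_mono inf_le1)
    finally show ?thesis using q by simp
  qed
  \<comment> \<open>The probability of one crossing is kept as a factor: with it the terms of the
    recursion for \<open>Suc j\<close> add up to the recursion for 1.\<close>
  have main: "pr b V (\<lambda>A. Suc j \<le> ncross s I Y A) \<le> q ^ j * pr b V (\<lambda>A. 1 \<le> ncross s I Y A)" if "V \<subseteq> W" for V j
    using that
  proof (induction "card V" arbitrary: V j rule: less_induct)
    case less
    have fV: "finite V" using less fin finite_subset by auto
    show ?case
    proof (cases "V \<inter> I = {}")
      case True
      then have "ncross s I Y A = 0" if "A \<subseteq> V" for A using that by (intro ncross_empty) auto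
      then have "pr b V (\<lambda>A. Suc j \<le> ncross s I Y A) = pr b V (\<lambda>A. False)"
        by (intro pr_cong) auto
      also have "\<dots> = 0" using fV by (simp add: pr_def)
      also have "0 \<le> q ^ j * pr b V (\<lambda>A. 1 \<le> ncross s I Y A)"
        by (intro mult_nonneg_nonneg pr_nonneg[OF b]) (use q0 in simp)
      finally show ?thesis .
    next
      case False
      then obtain x where x: "x \<in> V" "x \<in> I" by blast
      let ?U = "\<lambda>C. V - cbar s V x C"
      have st: "pr b (?U C) (\<lambda>A. Suc j \<le> ncross s I Y A + of_bool (C \<inter> Y \<noteq> {})) \<le>
        q ^ j * pr b (?U C) (\<lambda>A. 1 \<le> ncross s I Y A + of_bool (C \<inter> Y \<noteq> {}))" for C
      proof -
        have cU: "card (?U C) < card V" "?U C \<subseteq> W"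
          using x fV less(2) by (auto intro!: psubset_card_mono simp: cbar_def)
        have fU: "finite (?U C)" using fV by auto
        show ?thesis
        proof (cases "C \<inter> Y = {}")
          case True
          then show ?thesis using less(1)[OF cU, of j] by simp
        next
          case nc: False
          have "pr b (?U C) (\<lambda>A. j \<le> ncross s I Y A) \<le> q ^ j"
          proof (cases j)
            case 0
            then show ?thesis using pr_le_1[OF fU b] by simp
          next
            case (Suc i)
            have "pr b (?U C) (\<lambda>A. j \<le> ncross s I Y A) \<le> q ^ i * pr b (?U C) (\<lambda>A. 1 \<le> ncross s I Y A)"
              using less(1)[OF cU, of i] Suc by simp
            also have "\<dots> \<le> q ^ i * q" by (intro mult_left_mono Q1 cU) (use q0 in auto)
            finally show ?thesis using Suc by (simp add: mult.commute)
          qed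
          moreover have "pr b (?U C) (\<lambda>A. True) = 1" using fU by (simp add: pr_def)
          ultimately show ?thesis using nc by simp
        qed
      qed
      have "pr b V (\<lambda>A. Suc j \<le> ncross s I Y A) \<le> (\<Sum>C\<in>Pow V. pr b V (\<lambda>A. cluster s A x = C) *
         (q ^ j * pr b (?U C) (\<lambda>A. 1 \<le> ncross s I Y A + of_bool (C \<inter> Y \<noteq> {}))))"
        unfolding ncross_recursion[OF fV x, of b "Suc j"]
        by (intro sum_mono mult_left_mono st pr_nonneg[OF b])
      also have "\<dots> = q ^ j * pr b V (\<lambda>A. 1 \<le> ncross s I Y A)"
        unfolding ncross_recursion[OF fV x, of b 1] by (simp add: sum_distrib_left mult_ac)
      finally show ?thesis .
    qed
  qed
  show ?thesis
  proof (cases k)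
    case 0
    then show ?thesis using pr_le_1[OF fin b] by simp
  next
    case (Suc j)
    have "pr b W (\<lambda>A. k \<le> ncross s I Y A) \<le> q ^ j * pr b W (\<lambda>A. 1 \<le> ncross s I Y A)"
      using main[of W j] Suc by simp
    also have "\<dots> \<le> q ^ j * q" by (intro mult_left_mono Q1) (use q0 in auto)
    finally show ?thesis using Suc by (simp add: mult.commute)
  qed
qed

lemma ncross_second_moment:
  assumes b: "0 \<le> b" "b \<le> 1" and fin: "finite W"
    and q: "pr b W (\<lambda>A. \<exists>x\<in>I. \<exists>y\<in>Y. conn s A x y) \<le> q" "q < 1"
  shows "pexp b W (\<lambda>A. (real (ncross s I Y A))\<^sup>2) \<le> 2 / (1 - q)\<^sup>2"
proof -
  have q0: "0 \<le> q" by (rule order_trans[OF pr_nonneg[OF b] q(1)])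
  define m where "m = Max (ncross s I Y ` Pow W)"
  have m: "ncross s I Y A \<le> m" if "A \<subseteq> W" for A
    unfolding m_def by (rule Max_ge) (use that fin in simp_all)
  have sq: "(real n)\<^sup>2 = (\<Sum>j<m. (2 * real j + 1) * of_bool (Suc j \<le> n))" if "n \<le> m" for n
  proof -
    have "(\<Sum>j<m. (2 * real j + 1) * of_bool (Suc j \<le> n)) = (\<Sum>j<n. 2 * real j + 1)"
      by (rule sum.mono_neutral_cong_right) (use that in auto)
    also have "\<dots> = (real n)\<^sup>2" by (induction n) (auto simp: power2_eq_square algebra_simps)
    finally show ?thesis by simp
  qed
  have "pexp b W (\<lambda>A. (real (ncross s I Y A))\<^sup>2) =
     pexp b W (\<lambda>A. \<Sum>j<m. (2 * real j + 1) * of_bool (Suc j \<le> ncross s I Y A))"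
    by (rule pexp_cong) (use sq m in blast)
  also have "\<dots> = (\<Sum>j<m. (2 * real j + 1) * pr b W (\<lambda>A. Suc j \<le> ncross s I Y A))"
    unfolding pexp_sum pexp_cmult pr_def ..
  \<comment> \<open>The square is a sum of odd numbers; \<open>2 * j + 1\<close> and
    \<open>q ^ Suc j\<close> are relaxed so that the derivative of the geometric series
    appears.\<close>
  also have "\<dots> \<le> (\<Sum>j<m. 2 * (real (Suc j) * q ^ j))"
  proof (rule sum_mono)
    fix j
    have "pr b W (\<lambda>A. Suc j \<le> ncross s I Y A) \<le> q ^ Suc j" by (rule ncross_tail[OF b fin q(1)])
    also have "\<dots> \<le> q ^ j" by (rule power_decreasing) (use q0 q(2) in auto)
    finally have le: "pr b W (\<lambda>A. Suc j \<le> ncross s I Y A) \<le> q ^ j" .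
    have 1: "(2 * real j + 1) * pr b W (\<lambda>A. Suc j \<le> ncross s I Y A) \<le> (2 * real j + 1) * q ^ j"
      by (rule mult_left_mono[OF le]) simp
    have 2: "(2 * real j + 1) * q ^ j \<le> (2 * real (Suc j)) * q ^ j"
      by (rule mult_right_mono) (use q0 in simp_all)
    show "(2 * real j + 1) * pr b W (\<lambda>A. Suc j \<le> ncross s I Y A) \<le> 2 * (real (Suc j) * q ^ j)"
      using order_trans[OF 1 2] by (simp only: mult.assoc)
  qed
  also have "\<dots> = 2 * (\<Sum>j<m. real (Suc j) * q ^ j)" by (simp add: sum_distrib_left)
  also have "\<dots> \<le> 2 * (1 / (1 - q)\<^sup>2)"
  proof (intro mult_left_mono)
    have s: "(\<lambda>j. real (Suc j) * q ^ j) sums (1 / (1 - q)\<^sup>2)"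
      by (rule geometric_deriv_sums) (use q0 q(2) in simp)
    have "(\<Sum>j<m. real (Suc j) * q ^ j) \<le> (\<Sum>j. real (Suc j) * q ^ j)"
      by (rule sum_le_suminf[OF sums_summable[OF s]]) (use q0 in simp_all)
    then show "(\<Sum>j<m. real (Suc j) * q ^ j) \<le> 1 / (1 - q)\<^sup>2"
      by (simp only: sums_unique[OF s])
  qed simp
  also have "\<dots> = 2 / (1 - q)\<^sup>2" by simp
  finally show ?thesis .
qed


subsection \<open>Symmetries of the lattice\<close>

lemma conn_iso:
  assumes "inj T" "\<And>u v. gadj s (T u) (T v) = gadj s u v"
  shows "conn s (T ` X) (T x) (T y) = conn s X x y"
proof
  assume "conn s X x y"
  then show "conn s (T ` X) (T x) (T y)" by (rule conn_image) (simp add: assms)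
next
  assume "conn s (T ` X) (T x) (T y)"
  then have "\<exists>y'. T y = T y' \<and> conn s X x y'"
  proof (induction rule: conn_induct)
    case refl
    then have "x \<in> X" using assms(1) by (auto dest: injD)
    then show ?case using conn_refl[of x X s] by (intro exI[of _ x]) simp
  next
    case (step y z)
    then obtain y' z' where h: "y = T y'" "conn s X x y'" "z = T z'" "z' \<in> X" by auto
    then have "gadj s y' z'" using step(4) assms(2) by auto
    then show ?case using h conn_extend by blast
  qed
  then show "conn s X x y" using assms(1) by (auto dest: injD)
qed

lemma conn_iso_ex:
  assumes "inj T" "\<And>u v. gadj s (T u) (T v) = gadj s u v"
  shows "(\<exists>l r. Q l r \<and> conn s (T ` X) l r) = (\<exists>l r. Q (T l) (T r) \<and> conn s X l r)"
proof
  assume "\<exists>l r. Q l r \<and> conn s (T ` X) l r"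
  then obtain l r where h: "Q l r" "conn s (T ` X) l r" by blast
  then obtain l' r' where "l = T l'" "r = T r'" using conn_in[OF h(2)] by blast
  then show "\<exists>l r. Q (T l) (T r) \<and> conn s X l r" using h conn_iso[OF assms] by blast
next
  assume "\<exists>l r. Q (T l) (T r) \<and> conn s X l r"
  then show "\<exists>l r. Q l r \<and> conn s (T ` X) l r" using conn_iso[OF assms] by blast
qed

lemma conn_all:
  assumes "conn s X x y" "\<And>z. conn s X x z \<Longrightarrow> z \<in> Y"
  shows "conn s (X \<inter> Y) x y"
  using assms(1)
proof (induction rule: conn_induct)
  case refl
  then show ?case using assms(2) by blast
next
  case (step y z)
  have "conn s X x z" by (rule conn_extend[OF step(1,3,4)])
  then show ?case using step assms(2) by (intro conn_extend[OF step(5)]) auto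
qed

definition shift :: "vertex \<Rightarrow> vertex \<Rightarrow> vertex" where
  "shift v w = (fst v + fst w, snd v + snd w)"

lemma shift_simps [simp]: "fst (shift v w) = fst v + fst w" "snd (shift v w) = snd v + snd w"
  by (simp_all add: shift_def)

lemma inj_shift: "inj (shift v)"
  by (auto simp: inj_on_def shift_def prod_eq_iff)

lemma gadj_shift: "gadj s (shift v u) (shift v w) = gadj s u w"
  by (simp add: gadj_iff)

lemma inj_swap: "inj (prod.swap :: vertex \<Rightarrow> vertex)" by simp

lemma gadj_swap: "gadj s (prod.swap u) (prod.swap w) = gadj s u w"
  by (simp add: gadj_iff max.commute add.commute)

definition xrefl :: "int \<Rightarrow> vertex \<Rightarrow> vertex" where "xrefl k v = (k - fst v, snd v)"

definition yrefl :: "int \<Rightarrow> vertex \<Rightarrow> vertex" where "yrefl k v = (fst v, k - snd v)"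

lemma refl_simps [simp]: "fst (xrefl k v) = k - fst v" "snd (xrefl k v) = snd v"
  "fst (yrefl k v) = fst v" "snd (yrefl k v) = k - snd v"
  "xrefl k (xrefl k v) = v" "yrefl k (yrefl k v) = v"
  by (simp_all add: xrefl_def yrefl_def)

lemma inj_refl: "inj (xrefl k)" "inj (yrefl k)"
  by (auto simp: inj_on_def xrefl_def yrefl_def prod_eq_iff)

lemma gadj_refl: "gadj s (xrefl k u) (xrefl k w) = gadj s u w" "gadj s (yrefl k u) (yrefl k w) = gadj s u w"
  by (simp_all add: gadj_iff abs_minus_commute)

lemma in_rect: "v \<in> rect a b c d \<longleftrightarrow> a \<le> fst v \<and> fst v \<le> b \<and> c \<le> snd v \<and> snd v \<le> d"
  by (cases v) (auto simp: rect_def)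

lemma image_invol:
  assumes "\<And>v. T (T v) = v" "\<And>v. v \<in> X \<Longrightarrow> T v \<in> Y" "\<And>v. v \<in> Y \<Longrightarrow> T v \<in> X"
  shows "T ` X = Y"
  using assms by (metis image_eqI image_subsetI subsetI subset_antisym)

lemma finite_rect [simp]: "finite (rect a b c d)"
  by (simp add: rect_def)

subsection \<open>Crossing events\<close>

definition LR :: "bool \<Rightarrow> int \<Rightarrow> int \<Rightarrow> int \<Rightarrow> int \<Rightarrow> vertex set \<Rightarrow> bool" where
  "LR s a b c d A \<longleftrightarrow> (\<exists>l r. (fst l = a \<and> fst r = b) \<and> conn s (A \<inter> rect a b c d) l r)"

definition TB :: "bool \<Rightarrow> int \<Rightarrow> int \<Rightarrow> int \<Rightarrow> int \<Rightarrow> vertex set \<Rightarrow> bool" where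
  "TB s a b c d A \<longleftrightarrow> (\<exists>t u. (snd t = d \<and> snd u = c) \<and> conn s (A \<inter> rect a b c d) t u)"

definition hp :: "bool \<Rightarrow> real \<Rightarrow> int \<Rightarrow> int \<Rightarrow> int \<Rightarrow> int \<Rightarrow> real" where
  "hp s p a b c d = pr p (rect a b c d) (LR s a b c d)"

definition vp :: "bool \<Rightarrow> real \<Rightarrow> int \<Rightarrow> int \<Rightarrow> int \<Rightarrow> int \<Rightarrow> real" where
  "vp s p a b c d = pr p (rect a b c d) (TB s a b c d)"

lemma LR_local: "rect a b c d \<subseteq> W \<Longrightarrow> LR s a b c d (A \<inter> W) = LR s a b c d A"
  unfolding LR_def by (simp add: Int_assoc inf.absorb2)

lemma TB_local: "rect a b c d \<subseteq> W \<Longrightarrow> TB s a b c d (A \<inter> W) = TB s a b c d A"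
  unfolding TB_def by (simp add: Int_assoc inf.absorb2)

lemma LR_mono: "LR s a b c d A \<Longrightarrow> A \<subseteq> B \<Longrightarrow> LR s a b c d B"
  unfolding LR_def using conn_mono[of s "A \<inter> rect a b c d" _ _ "B \<inter> rect a b c d"] by blast

lemma TB_mono: "TB s a b c d A \<Longrightarrow> A \<subseteq> B \<Longrightarrow> TB s a b c d B"
  unfolding TB_def using conn_mono[of s "A \<inter> rect a b c d" _ _ "B \<inter> rect a b c d"] by blast

lemma hp_eq: "finite W \<Longrightarrow> rect a b c d \<subseteq> W \<Longrightarrow> pr p W (LR s a b c d) = hp s p a b c d"
  unfolding hp_def by (rule pr_subset) (auto simp: LR_local)

lemma vp_eq: "finite W \<Longrightarrow> rect a b c d \<subseteq> W \<Longrightarrow> pr p W (TB s a b c d) = vp s p a b c d"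
  unfolding vp_def by (rule pr_subset) (auto simp: TB_local)

lemma hp_shift: "hp s p (a + i) (b + i) (c + j) (d + j) = hp s p a b c d"
proof -
  let ?T = "shift (i, j)"
  have im: "?T ` rect a b c d = rect (a + i) (b + i) (c + j) (d + j)"
  proof
    show "rect (a + i) (b + i) (c + j) (d + j) \<subseteq> ?T ` rect a b c d"
    proof
      fix v assume "v \<in> rect (a + i) (b + i) (c + j) (d + j)"
      then have "shift (- i, - j) v \<in> rect a b c d" by (auto simp: in_rect)
      moreover have "v = ?T (shift (- i, - j) v)" by (simp add: prod_eq_iff)
      ultimately show "v \<in> ?T ` rect a b c d" by blast
    qed
  qed (auto simp: in_rect)
  have "pr p (?T ` rect a b c d) (LR s (a + i) (b + i) (c + j) (d + j)) = pr p (rect a b c d) (LR s a b c d)"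
  proof (subst pr_image)
    show "inj_on ?T (rect a b c d)" using inj_shift inj_on_subset by blast
    show "pr p (rect a b c d) (\<lambda>A. LR s (a + i) (b + i) (c + j) (d + j) (?T ` A)) = pr p (rect a b c d) (LR s a b c d)"
    proof (rule pr_cong)
      fix A assume A: "A \<subseteq> rect a b c d"
      then have "?T ` A \<inter> rect (a + i) (b + i) (c + j) (d + j) = ?T ` A" "A \<inter> rect a b c d = A"
        using im by blast+
      then have "LR s (a + i) (b + i) (c + j) (d + j) (?T ` A) \<longleftrightarrow>
          (\<exists>l r. (fst l = a + i \<and> fst r = b + i) \<and> conn s (?T ` A) l r)"
        unfolding LR_def by (simp only:)
      also have "\<dots> \<longleftrightarrow> (\<exists>l r. (fst (?T l) = a + i \<and> fst (?T r) = b + i) \<and> conn s A l r)"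
        by (rule conn_iso_ex[OF inj_shift gadj_shift])
      also have "\<dots> \<longleftrightarrow> LR s a b c d A"
        unfolding LR_def \<open>A \<inter> rect a b c d = A\<close> by (intro ex_cong1) auto
      finally show "LR s (a + i) (b + i) (c + j) (d + j) (?T ` A) = LR s a b c d A" .
    qed
  qed
  then show ?thesis unfolding hp_def im .
qed

lemma swap_rect: "prod.swap ` rect a b c d = rect c d a b"
  by (auto simp: rect_def image_iff)

lemma vp_hp: "vp s p a b c d = hp s p c d a b"
proof -
  have "pr p (prod.swap ` rect a b c d) (LR s c d a b) = pr p (rect a b c d) (TB s a b c d)"
  proof (subst pr_image)
    show "inj_on prod.swap (rect a b c d)" by (simp add: inj_on_def prod_eq_iff)
    show "pr p (rect a b c d) (\<lambda>A. LR s c d a b (prod.swap ` A)) = pr p (rect a b c d) (TB s a b c d)"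
    proof (rule pr_cong)
      fix A assume A: "A \<subseteq> rect a b c d"
      then have "prod.swap ` A \<inter> rect c d a b = prod.swap ` A" "A \<inter> rect a b c d = A"
        using swap_rect by blast+
      then have "LR s c d a b (prod.swap ` A) \<longleftrightarrow> (\<exists>l r. (fst l = c \<and> fst r = d) \<and> conn s (prod.swap ` A) l r)"
        unfolding LR_def by (simp only:)
      also have "\<dots> \<longleftrightarrow> (\<exists>l r. (fst (prod.swap l) = c \<and> fst (prod.swap r) = d) \<and> conn s A l r)"
        by (rule conn_iso_ex[OF inj_swap gadj_swap])
      also have "\<dots> \<longleftrightarrow> TB s a b c d A"
        unfolding TB_def \<open>A \<inter> rect a b c d = A\<close> fst_swap using conn_sym[of s A] by blast
      finally show "LR s c d a b (prod.swap ` A) = TB s a b c d A" .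
    qed
  qed
  then show ?thesis unfolding hp_def vp_def swap_rect by simp
qed

lemma LR_shrink:
  assumes "LR s a b c d A" "a \<le> b'" "b' \<le> b"
  shows "LR s a b' c d A"
proof -
  obtain l r where h: "fst l = a" "fst r = b" "conn s (A \<inter> rect a b c d) l r"
    using assms(1) unfolding LR_def by blast
  obtain z where z: "z \<in> {z. b' \<le> fst z}" "z \<in> A \<inter> rect a b c d"
    "l = z \<or> (\<exists>u. conn s (A \<inter> rect a b c d - {z. b' \<le> fst z}) l u \<and> gadj s u z)"
    by (rule conn_first[OF h(3), of "{z. b' \<le> fst z}"]) (use h assms in auto)
  from z(3) show ?thesis
  proof
    assume "l = z"
    then have "fst z = b'" "z \<in> A \<inter> rect a b' c d" using h z assms by (auto simp: in_rect)
    then show ?thesis unfolding LR_def using h \<open>l = z\<close> by blast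
  next
    assume "\<exists>u. conn s (A \<inter> rect a b c d - {z. b' \<le> fst z}) l u \<and> gadj s u z"
    then obtain u where u: "conn s (A \<inter> rect a b c d - {z. b' \<le> fst z}) l u" "gadj s u z" by blast
    have "fst u < b'" using conn_in(2)[OF u(1)] by auto
    moreover have "\<bar>fst u - fst z\<bar> \<le> 1" using u(2) by (auto simp: gadj_iff split: if_splits)
    ultimately have fz: "fst z = b'" using z(1) by auto
    have "conn s (A \<inter> rect a b' c d) l u" by (rule conn_mono[OF u(1)]) (auto simp: in_rect)
    then have "conn s (A \<inter> rect a b' c d) l z" by (rule conn_extend) (use z u fz in \<open>auto simp: in_rect\<close>)
    then show ?thesis unfolding LR_def using h fz by blast
  qed
qed

lemma hp_shrink:
  assumes "0 \<le> p" "p \<le> 1" "a \<le> b'" "b' \<le> b"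
  shows "hp s p a b c d \<le> hp s p a b' c d"
proof -
  have "hp s p a b c d \<le> pr p (rect a b c d) (LR s a b' c d)"
    unfolding hp_def using assms LR_shrink by (intro pr_mono) auto
  also have "\<dots> = hp s p a b' c d" by (rule hp_eq) (use assms in \<open>auto simp: in_rect\<close>)
  finally show ?thesis .
qed

text \<open>Applied to the clusters of the two crossings, \<open>LR_TB_touch\<close> yields a common
  vertex or two adjacent ones, so the clusters coincide.\<close>

lemma crossing_conn:
  assumes "a < b" "c < d" "conn s (A \<inter> rect a b c d) l r" "fst l = a" "fst r = b"
    and "conn s (A \<inter> rect a b c d) t u" "snd t = d" "snd u = c"
  shows "conn s (A \<inter> rect a b c d) l t"
proof -
  let ?X = "A \<inter> rect a b c d"
  have 1: "conn s (?X \<inter> {z. conn s ?X l z}) l r" by (rule conn_all) (use assms in auto)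
  have 2: "conn s (?X \<inter> {z. conn s ?X t z}) t u" by (rule conn_all) (use assms in auto)
  obtain x z where "x \<in> ?X \<inter> {z. conn s ?X l z}" "z \<in> ?X \<inter> {z. conn s ?X t z}" "x = z \<or> gadj s x z"
    by (rule LR_TB_touch[OF assms(1,2) 1 _ assms(4,5) 2 _ assms(7,8)]) auto
  then have lx: "conn s ?X l x" and tz: "conn s ?X t z" by auto
  have "conn s ?X x z"
    using \<open>x = z \<or> gadj s x z\<close> conn_step[OF conn_in(2)[OF lx] conn_in(2)[OF tz], of s] conn_refl[OF conn_in(2)[OF lx], of s]
    by auto
  from conn_trans[OF conn_trans[OF lx this] conn_sym[OF tz]] show ?thesis .
qed

text \<open>The vertical crossing of the overlap lies in both rectangles and is therefore connected
  to each horizontal crossing.\<close>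

lemma LR_glue:
  assumes "a \<le> a'" "a' < b" "b \<le> b'" "c < d" "LR s a b c d A" "LR s a' b' c d A" "TB s a' b c d A"
  shows "LR s a b' c d A"
proof -
  obtain l r where 1: "fst l = a" "fst r = b" "conn s (A \<inter> rect a b c d) l r"
    using assms unfolding LR_def by blast
  obtain l' r' where 2: "fst l' = a'" "fst r' = b'" "conn s (A \<inter> rect a' b' c d) l' r'"
    using assms unfolding LR_def by blast
  obtain t u where 3: "snd t = d" "snd u = c" "conn s (A \<inter> rect a' b c d) t u"
    using assms unfolding TB_def by blast
  have "conn s (A \<inter> rect a b c d) t u" "conn s (A \<inter> rect a' b' c d) t u"
    by (rule conn_mono[OF 3(3)]; use assms in \<open>auto simp: in_rect\<close>)+
  then have "conn s (A \<inter> rect a b c d) l t" "conn s (A \<inter> rect a' b' c d) l' t"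
    using crossing_conn[OF _ assms(4) 1(3,1,2)] crossing_conn[OF _ assms(4) 2(3,1,2)] 3 assms by auto
  then have "conn s (A \<inter> rect a b' c d) l t" "conn s (A \<inter> rect a' b' c d) t r'"
    using assms conn_sym conn_trans[OF _ 2(3)] by (auto elim!: conn_mono simp: in_rect)
  moreover have "conn s (A \<inter> rect a b' c d) t r'"
    by (rule conn_mono[OF calculation(2)]) (use assms in \<open>auto simp: in_rect\<close>)
  ultimately show ?thesis unfolding LR_def using 1 2 conn_trans by blast
qed

lemma hp_glue:
  assumes p: "0 \<le> p" "p \<le> 1" and "a \<le> a'" "a' < b" "b \<le> b'" "c < d"
  shows "hp s p a b c d * hp s p a' b' c d * vp s p a' b c d \<le> hp s p a b' c d"
proof -
  let ?W = "rect a b' c d"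
  have sub: "rect a b c d \<subseteq> ?W" "rect a' b' c d \<subseteq> ?W" "rect a' b c d \<subseteq> ?W"
    using assms by (auto simp: in_rect)
  have "hp s p a b c d * hp s p a' b' c d * vp s p a' b c d =
    pr p ?W (LR s a b c d) * pr p ?W (LR s a' b' c d) * pr p ?W (TB s a' b c d)"
    using sub by (simp add: hp_eq vp_eq)
  also have "\<dots> \<le> pr p ?W (\<lambda>A. LR s a b c d A \<and> LR s a' b' c d A) * pr p ?W (TB s a' b c d)"
    by (intro mult_right_mono pr_harris pr_nonneg) (use p LR_mono in auto)
  also have "\<dots> \<le> pr p ?W (\<lambda>A. (LR s a b c d A \<and> LR s a' b' c d A) \<and> TB s a' b c d A)"
    by (intro pr_harris) (use p LR_mono TB_mono in auto)
  also have "\<dots> \<le> hp s p a b' c d"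
    unfolding hp_def by (intro pr_mono) (use assms LR_glue in auto)
  finally show ?thesis .
qed

subsection \<open>The Bollobas--Riordan step\<close>

text \<open>If the dual paths from the left side of a square do not reach its right side, then the leftmost
  black crossing lies in the closure of the region they explore, and the configuration outside this
  closure is independent of the region.\<close>

definition lregion :: "bool \<Rightarrow> int \<Rightarrow> vertex set \<Rightarrow> vertex set" where
  "lregion s n A = {z. \<exists>l. fst l = 0 \<and> conn (\<not> s) (rect 0 (n - 1) 0 (n - 1) - A) l z}"

text \<open>The left column is included because the exploration starts there and inspects it in any
  case.\<close>

definition lclosure :: "bool \<Rightarrow> int \<Rightarrow> vertex set \<Rightarrow> vertex set" where
  "lclosure s n D = {z \<in> rect 0 (n - 1) 0 (n - 1). fst z = 0 \<or> z \<in> D \<or> (\<exists>w\<in>D. gadj (\<not> s) w z)}"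

lemma lregion_sub: "z \<in> lregion s n A \<Longrightarrow> z \<in> rect 0 (n - 1) 0 (n - 1) - A"
  unfolding lregion_def using conn_in(2) by blast

lemma lregion_step:
  assumes "z \<in> lclosure s n (lregion s n A)" "z \<notin> A"
  shows "z \<in> lregion s n A"
proof -
  have z: "z \<in> rect 0 (n - 1) 0 (n - 1) - A" using assms unfolding lclosure_def by auto
  from assms(1) consider "fst z = 0" | "z \<in> lregion s n A" | w where "w \<in> lregion s n A" "gadj (\<not> s) w z"
    unfolding lclosure_def by auto
  then show ?thesis
  proof cases
    case 1
    then show ?thesis unfolding lregion_def using conn_refl[OF z] by blast
  next
    case 3
    then show ?thesis unfolding lregion_def using z conn_extend by blast
  qed
qed

lemma lregion_local_subset:
  assumes "A \<inter> lclosure s n D = B \<inter> lclosure s n D" "D = lregion s n A"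
  shows "lregion s n B \<subseteq> D"
proof
  fix z assume "z \<in> lregion s n B"
  then obtain l where l: "fst l = 0" "conn (\<not> s) (rect 0 (n - 1) 0 (n - 1) - B) l z"
    unfolding lregion_def by auto
  from l(2) show "z \<in> D"
  proof (induction rule: conn_induct)
    case refl
    then have "l \<in> lclosure s n D" using l unfolding lclosure_def by auto
    moreover have "l \<notin> A" using refl assms(1) calculation by blast
    ultimately show ?case using lregion_step assms(2) by simp
  next
    case (step y z)
    then have "z \<in> lclosure s n D" unfolding lclosure_def by auto
    moreover have "z \<notin> A" using step assms(1) calculation by blast
    ultimately show ?case using lregion_step assms(2) by simp
  qed
qed

text \<open>The region has no vertex in the black set, and its closure is black outside the region,
  so the colours on the closure decide whether the region is \<open>D\<close>.\<close>

lemma lregion_local: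
  assumes e: "A \<inter> lclosure s n D = B \<inter> lclosure s n D" and D: "D = lregion s n A"
  shows "lregion s n B = D"
proof
  show "lregion s n B \<subseteq> D" by (rule lregion_local_subset[OF e D])
  show "D \<subseteq> lregion s n B"
  proof
    fix z assume "z \<in> D"
    then obtain l where l: "fst l = 0" "conn (\<not> s) (rect 0 (n - 1) 0 (n - 1) - A) l z"
      unfolding D lregion_def by auto
    have DB: "D \<inter> B = {}"
    proof -
      have "D \<subseteq> lclosure s n D" using lregion_sub unfolding D lclosure_def by blast
      then show ?thesis using e lregion_sub unfolding D by blast
    qed
    have "conn (\<not> s) ((rect 0 (n - 1) 0 (n - 1) - A) \<inter> D) l z"
      by (rule conn_all[OF l(2)]) (unfold D lregion_def, use l(1) in blast)
    then have "conn (\<not> s) (rect 0 (n - 1) 0 (n - 1) - B) l z"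
      by (rule conn_mono) (use DB in blast)
    then show "z \<in> lregion s n B" unfolding lregion_def using l by blast
  qed
qed

text \<open>The small square is the lower left quarter of the large one. Such an event and its
  mirror image, both anchored in the small square, can later be joined by a horizontal crossing of
  that square.\<close>

definition XR :: "bool \<Rightarrow> int \<Rightarrow> vertex set \<Rightarrow> bool" where
  "XR s n A \<longleftrightarrow> (\<exists>z t u. fst z = 2 * n - 1 \<and> snd t = n - 1 \<and> snd u = 0 \<and>
     conn s (A \<inter> rect 0 (n - 1) 0 (n - 1)) t u \<and> conn s (A \<inter> rect 0 (2 * n - 1) 0 (2 * n - 1)) t z)"

text \<open>A dual path from the left side avoiding the closure outside \<open>D\<close> stays in
  \<open>D\<close>, so it does not reach the right side, and the Hex lemma gives a vertical crossing
  within that part of the closure. \<open>P\<close> is the whole component of this crossing, which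
  depends on \<open>D\<close> but not on further colours.\<close>

lemma left_boundary:
  assumes n: "2 \<le> n" and D: "D = lregion s n A0" and good: "\<And>z. z \<in> D \<Longrightarrow> fst z \<noteq> n - 1"
  obtains P t u where "P \<subseteq> lclosure s n D - D" "snd t = n - 1" "snd u = 0" "conn s P t u"
    "\<And>v. v \<in> P \<Longrightarrow> conn s P t v"
proof -
  let ?S = "rect 0 (n - 1) 0 (n - 1)"
  define E where "E = lclosure s n D - D"
  have ES: "E \<subseteq> ?S" unfolding E_def lclosure_def by auto
  have "\<not> (\<exists>l r. fst l = 0 \<and> fst r = n - 1 \<and> conn (\<not> s) (- E \<inter> ?S) l r)"
  proof safe
    fix l r assume h: "fst l = 0" "fst r = n - 1" "conn (\<not> s) (- E \<inter> ?S) l r"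
    from h(3) have "r \<in> D"
    proof (induction rule: conn_induct)
      case refl then show ?case using h(1) unfolding E_def lclosure_def by auto
    next
      case (step y z) then show ?case unfolding E_def lclosure_def by auto
    qed
    then show False using good h(2) by blast
  qed
  then have "\<exists>t u. snd t = n - 1 \<and> snd u = 0 \<and> conn (\<not> \<not> s) (?S - (- E)) t u"
    using hex[of 0 "n - 1" 0 "n - 1" "\<not> s" "- E"] n by auto
  then obtain t u where tu: "snd t = n - 1" "snd u = 0" "conn s (?S - (- E)) t u" by auto
  have "?S - (- E) = E" using ES by blast
  then have tu3: "conn s E t u" using tu(3) by simp
  define P where "P = {v. conn s E t v}"
  have P: "conn s P t v" if "conn s E t v" for v
    using conn_all[OF that, of P] conn_mono[of s "E \<inter> P" t v P] unfolding P_def by auto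
  have "P \<subseteq> E" unfolding P_def using conn_in(2)[of s E t] by auto
  moreover have "conn s P t u" by (rule P[OF tu3])
  moreover have "conn s P t v" if "v \<in> P" for v using that P unfolding P_def by simp
  ultimately show ?thesis using that[of P t u] tu unfolding E_def by blast
qed

text \<open>\<open>P\<close> and its mirror image form a vertical crossing \<open>Z\<close> of the
  large square. A horizontal crossing followed from the right must come next to \<open>Z\<close>,
  and up to the first such moment it stays outside the closure of \<open>D\<close> and its mirror
  image.\<close>

lemma right_reaches:
  assumes n: "2 \<le> n" and D: "D = lregion s n A0" and good: "\<And>z. z \<in> D \<Longrightarrow> fst z \<noteq> n - 1"
    and P: "P \<subseteq> lclosure s n D - D" "snd t = n - 1" "snd u = 0" "conn s P t u"
    and B: "LR s 0 (2 * n - 1) 0 (2 * n - 1) B"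
    and U: "U = rect 0 (2 * n - 1) 0 (2 * n - 1) - lclosure s n D - yrefl (2 * n - 1) ` lclosure s n D"
  shows "(\<exists>z w. fst z = 2 * n - 1 \<and> conn s (B \<inter> U) z w \<and> (\<exists>p\<in>P. gadj s w p)) \<or>
    (\<exists>z w. fst z = 2 * n - 1 \<and> conn s (B \<inter> U) z w \<and> (\<exists>p\<in>yrefl (2 * n - 1) ` P. gadj s w p))"
proof -
  let ?S = "rect 0 (n - 1) 0 (n - 1)" and ?R = "rect 0 (2 * n - 1) 0 (2 * n - 1)"
  let ?\<rho> = "yrefl (2 * n - 1)"
  have ab: "(0::int) < 2 * n - 1" using n by simp
  have cS: "lclosure s n D \<subseteq> ?S" unfolding lclosure_def by auto
  have PS: "P \<subseteq> ?S" using P cS by auto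
  define Z where "Z = P \<union> ?\<rho> ` P"
  have \<rho>R: "?\<rho> v \<in> ?R \<longleftrightarrow> v \<in> ?R" for v by (auto simp: in_rect)
  have ZR: "Z \<subseteq> ?R" unfolding Z_def using PS n by (auto simp: in_rect)
  have Zx: "fst z \<le> n - 1" if "z \<in> Z" for z using that PS unfolding Z_def by (auto simp: in_rect)
  have DZ: "D \<inter> Z = {}"
  proof -
    have "v \<notin> ?\<rho> ` P" if "v \<in> D" for v
    proof
      assume "v \<in> ?\<rho> ` P"
      then obtain w where "w \<in> P" "v = ?\<rho> w" by blast
      then have "snd v \<ge> n" using PS by (auto simp: in_rect)
      moreover have "v \<in> ?S" using that D lregion_sub by blast
      ultimately show False by (auto simp: in_rect)
    qed
    then show ?thesis using P(1) unfolding Z_def by blast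
  qed
  have \<rho>Z: "?\<rho> ` Z = Z"
    by (rule image_invol) (auto simp: Z_def)
  \<comment> \<open>The reflection exchanges the rows \<open>n - 1\<close> and \<open>n\<close>, so
    \<open>t\<close> is adjacent to its mirror image and the two halves join.\<close>
  have ZTB: "conn s Z (?\<rho> u) u"
  proof -
    have 1: "conn s Z t u" by (rule conn_mono[OF P(4)]) (simp add: Z_def)
    have "conn s (?\<rho> ` P) (?\<rho> t) (?\<rho> u)" by (simp add: conn_iso[OF inj_refl(2) gadj_refl(2)] P(4))
    then have 2: "conn s Z (?\<rho> t) (?\<rho> u)" by (rule conn_mono) (simp add: Z_def)
    have "gadj False t (?\<rho> t)" using P(2) by (simp add: gadj_iff)
    then have "conn s Z t (?\<rho> t)"
      by (rule conn_step[OF conn_in(1)[OF 1] conn_in(1)[OF 2] gadj_False_imp])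
    from conn_trans[OF conn_sym[OF conn_trans[OF this 2]] 1] show ?thesis .
  qed
  \<comment> \<open>The closure outside \<open>Z\<close> is connected to the left side by dual paths
    avoiding \<open>Z\<close>. A dual path from the right side reaching it would complete a
    horizontal dual crossing that misses the vertical crossing \<open>Z\<close>.\<close>
  have nohit: "w \<notin> lclosure s n D" if r: "fst r = 2 * n - 1" and w: "w \<notin> Z" "conn (\<not> s) (?R - Z) r w" for r w
  proof
    assume wc: "w \<in> lclosure s n D"
    have wR: "w \<in> ?R - Z" using conn_in[OF w(2)] by blast
    have Dc: "\<exists>l. fst l = 0 \<and> conn (\<not> s) (?R - Z) l v" if "v \<in> D" for v
    proof -
      from that obtain l where l: "fst l = 0" "conn (\<not> s) (?S - A0) l v" unfolding D lregion_def by blast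
      have "conn (\<not> s) ((?S - A0) \<inter> D) l v"
        by (rule conn_all[OF l(2)]) (unfold D lregion_def, use l(1) in blast)
      then have "conn (\<not> s) (?R - Z) l v" by (rule conn_mono) (use DZ n in \<open>auto simp: in_rect\<close>)
      then show ?thesis using l(1) by blast
    qed
    have "\<exists>l. fst l = 0 \<and> conn (\<not> s) (?R - Z) l w"
    proof -
      from wc consider "fst w = 0" | "w \<in> D" | v where "v \<in> D" "gadj (\<not> s) v w" unfolding lclosure_def by auto
      then show ?thesis
      proof cases
        case 1
        then show ?thesis using wR conn_refl by blast
      next
        case 2
        then show ?thesis using Dc by blast
      next
        case 3
        then obtain l where "fst l = 0" "conn (\<not> s) (?R - Z) l v" using Dc by blast
        then show ?thesis using conn_extend[OF _ wR 3(2)] by blast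
      qed
    qed
    then obtain l where l: "fst l = 0" "conn (\<not> s) (?R - Z) l w" by blast
    have lr: "conn (\<not> s) (?R - Z) l r" by (rule conn_trans[OF l(2) conn_sym[OF w(2)]])
    have "Z \<inter> (?R - Z) \<noteq> {}"
      by (rule TB_LR_meet[OF ab ab ZTB ZR _ P(3) lr _ l(1) r]) (use P(3) in auto)
    then show False by blast
  qed
  have nohit': "w \<notin> ?\<rho> ` lclosure s n D" if r: "fst r = 2 * n - 1" and w: "w \<notin> Z" "conn (\<not> s) (?R - Z) r w" for r w
  proof
    assume "w \<in> ?\<rho> ` lclosure s n D"
    then have wc: "?\<rho> w \<in> lclosure s n D" by auto
    have im: "?\<rho> ` (?R - Z) = ?R - Z"
    proof (rule image_invol)
      fix v assume v: "v \<in> ?R - Z"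
      have "?\<rho> v \<notin> Z"
      proof
        assume "?\<rho> v \<in> Z"
        then have "?\<rho> (?\<rho> v) \<in> Z" using \<rho>Z by blast
        then show False using v by simp
      qed
      then show "?\<rho> v \<in> ?R - Z" using v \<rho>R by blast
      then show "?\<rho> v \<in> ?R - Z" .
    qed simp
    have "conn (\<not> s) (?\<rho> ` (?R - Z)) (?\<rho> r) (?\<rho> w)" by (simp add: conn_iso[OF inj_refl(2) gadj_refl(2)] w)
    then have c: "conn (\<not> s) (?R - Z) (?\<rho> r) (?\<rho> w)" unfolding im .
    then have "?\<rho> w \<notin> Z" using conn_in(2) by blast
    from nohit[OF _ this c] show False using r wc by simp
  qed
  have inU: "w \<in> U" if "fst r = 2 * n - 1" "w \<notin> Z" "conn (\<not> s) (?R - Z) r w" for r w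
    using nohit[OF that] nohit'[OF that] conn_in(2)[OF that(3)] unfolding U by blast
  obtain l r where lr: "fst l = 0" "fst r = 2 * n - 1" "conn s (B \<inter> ?R) l r"
    using B unfolding LR_def by blast
  have 1: "conn s (B \<inter> ?R \<inter> {z. conn s (B \<inter> ?R) l z}) l r" by (rule conn_all[OF lr(3)]) simp
  obtain x z where xz: "x \<in> B \<inter> ?R \<inter> {z. conn s (B \<inter> ?R) l z}" "z \<in> Z" "x = z \<or> gadj s x z"
    by (rule LR_TB_touch[OF ab ab 1 _ lr(1,2) ZTB ZR]) (use P(3) in auto)
  then have rx: "conn s (B \<inter> ?R) r x" using conn_trans[OF conn_sym[OF lr(3)]] by blast
  have xN: "x \<in> nbhd s Z" using xz unfolding nbhd_def by blast
  obtain w where w: "w \<in> nbhd s Z" "w \<in> B \<inter> ?R"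
    "r = w \<or> (\<exists>v. conn s (B \<inter> ?R - nbhd s Z) r v \<and> gadj s v w)"
    using conn_first[OF rx xN] by blast
  have rR: "r \<in> ?R" using conn_in[OF rx] by blast
  have main: "w \<notin> Z \<and> conn s (B \<inter> U) r w"
    using w(3)
  proof
    assume e: "r = w"
    then have nZ: "w \<notin> Z" using lr(2) Zx n by fastforce
    have "conn (\<not> s) (?R - Z) r w" using e nZ rR conn_refl by blast
    from inU[OF lr(2) nZ this] show ?thesis using e w(2) nZ conn_refl by blast
  next
    assume "\<exists>v. conn s (B \<inter> ?R - nbhd s Z) r v \<and> gadj s v w"
    then obtain v where v: "conn s (B \<inter> ?R - nbhd s Z) r v" "gadj s v w" by blast
    \<comment> \<open>Away from the neighbourhood of \<open>Z\<close> the path is also a dual path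
      avoiding \<open>Z\<close> by \<open>thick\<close>, so the preceding facts apply to each of its
      vertices.\<close>
    have th: "conn (\<not> s) (?R - Z) r y \<and> y \<notin> Z" if "conn s (B \<inter> ?R - nbhd s Z) r y" for y
      using thick[of s "B \<inter> ?R" Z r y 0 "2 * n - 1" 0 "2 * n - 1"] that conn_in(2)[OF that]
      by (auto simp: nbhd_def)
    have vN: "v \<notin> nbhd s Z" "v \<in> ?R" using conn_in(2)[OF v(1)] by auto
    have nZ: "w \<notin> Z" using vN v(2) unfolding nbhd_def by blast
    have "conn (\<not> s) (?R - Z) v w" by (rule thick_step) (use vN w(2) nZ v(2) in auto)
    then have cw: "conn (\<not> s) (?R - Z) r w" using th[OF v(1)] conn_trans by blast
    have wU: "w \<in> U" by (rule inU[OF lr(2) nZ cw])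
    have "conn s ((B \<inter> ?R - nbhd s Z) \<inter> U) r v"
      by (rule conn_all[OF v(1)]) (use inU[OF lr(2)] th in blast)
    then have "conn s (B \<inter> U) r v" by (rule conn_mono) blast
    from conn_extend[OF this _ v(2)] show ?thesis using wU w(2) nZ by blast
  qed
  then obtain q where "q \<in> Z" "gadj s w q" using w(1) unfolding nbhd_def by blast
  then show ?thesis using main lr(2) unfolding Z_def by blast
qed

text \<open>Given that the region is \<open>D\<close>, its closure is known, and the configuration
  in \<open>U\<close> is independent of it. Since \<open>U\<close> is symmetric under the
  reflection, reaching \<open>P\<close> is as likely as reaching its mirror image; one of them
  occurs whenever the large square is crossed, whence the factor 1/2.\<close>

lemma XR_prob:
  assumes n: "2 \<le> n" and p: "0 \<le> p" "p \<le> 1"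
  shows "hp s p 0 (2 * n - 1) 0 (2 * n - 1) * vp s p 0 (n - 1) 0 (n - 1) / 2 \<le>
    pr p (rect 0 (2 * n - 1) 0 (2 * n - 1)) (XR s n)"
proof -
  let ?S = "rect 0 (n - 1) 0 (n - 1)" and ?R = "rect 0 (2 * n - 1) 0 (2 * n - 1)"
  let ?\<rho> = "yrefl (2 * n - 1)"
  let ?h = "hp s p 0 (2 * n - 1) 0 (2 * n - 1)"
  have SR: "?S \<subseteq> ?R" using n by (auto simp: in_rect)
  define good where "good D \<longleftrightarrow> (\<forall>z\<in>D. fst z \<noteq> n - 1)" for D :: "vertex set"
  have h0: "0 \<le> ?h" unfolding hp_def by (rule pr_nonneg[OF p])
  have step: "pr p ?R (\<lambda>A. lregion s n A = D) * (?h / 2) \<le> pexp p ?R (\<lambda>A. of_bool (lregion s n A = D) * of_bool (XR s n A))"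
    if gD: "good D" for D
  proof (cases "\<exists>A0. lregion s n A0 = D")
    case False
    then have "pr p ?R (\<lambda>A. lregion s n A = D) = 0" by (simp add: pr_def)
    then show ?thesis by (simp add: pexp_nonneg[OF p])
  next
    case True
    then obtain A0 where D: "D = lregion s n A0" by blast
    have g: "\<And>z. z \<in> D \<Longrightarrow> fst z \<noteq> n - 1" using gD unfolding good_def by blast
    obtain P t u where P: "P \<subseteq> lclosure s n D - D" "snd t = n - 1" "snd u = 0" "conn s P t u"
      "\<And>v. v \<in> P \<Longrightarrow> conn s P t v" using left_boundary[OF n D g] by blast
    define U where "U = ?R - lclosure s n D - ?\<rho> ` lclosure s n D"
    define E where "E Q B \<longleftrightarrow> (\<exists>z w. fst z = 2 * n - 1 \<and> conn s (B \<inter> U) z w \<and> (\<exists>q\<in>Q. gadj s w q))" for Q B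
    have cS: "lclosure s n D \<subseteq> ?S" unfolding lclosure_def by auto
    have \<rho>R: "?\<rho> ` ?R = ?R" by (rule image_invol) (auto simp: in_rect)
    have \<rho>U: "?\<rho> ` U = U"
    proof (rule image_invol)
      fix v assume v: "v \<in> U"
      have "?\<rho> v \<in> ?R" using v unfolding U_def by (auto simp: in_rect)
      moreover have "?\<rho> v \<notin> lclosure s n D"
      proof
        assume "?\<rho> v \<in> lclosure s n D"
        then have "?\<rho> (?\<rho> v) \<in> ?\<rho> ` lclosure s n D" by (rule imageI)
        then show False using v unfolding U_def by simp
      qed
      moreover have "?\<rho> v \<notin> ?\<rho> ` lclosure s n D" using v unfolding U_def by (auto dest: injD[OF inj_refl(2)])
      ultimately show "?\<rho> v \<in> U" unfolding U_def by blast
      then show "?\<rho> v \<in> U" .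
    qed simp
    have psym: "pr p ?R (E (?\<rho> ` P)) = pr p ?R (E P)"
    proof -
      have "pr p (?\<rho> ` ?R) (E (?\<rho> ` P)) = pr p ?R (\<lambda>A. E (?\<rho> ` P) (?\<rho> ` A))"
        by (rule pr_image) (use inj_refl(2) inj_on_subset in blast)
      also have "\<dots> = pr p ?R (E P)"
      proof (rule pr_cong)
        fix A assume "A \<subseteq> ?R"
        have im: "?\<rho> ` A \<inter> U = ?\<rho> ` (A \<inter> U)"
          using \<rho>U image_Int[OF inj_refl(2), of "2 * n - 1" A U] by simp
        have "E (?\<rho> ` P) (?\<rho> ` A) \<longleftrightarrow> (\<exists>z w. (fst z = 2 * n - 1 \<and> (\<exists>q\<in>?\<rho> ` P. gadj s w q)) \<and> conn s (?\<rho> ` (A \<inter> U)) z w)"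
          unfolding E_def im by blast
        also have "\<dots> \<longleftrightarrow> (\<exists>z w. (fst (?\<rho> z) = 2 * n - 1 \<and> (\<exists>q\<in>?\<rho> ` P. gadj s (?\<rho> w) q)) \<and> conn s (A \<inter> U) z w)"
          by (rule conn_iso_ex[OF inj_refl(2) gadj_refl(2)])
        also have "\<dots> \<longleftrightarrow> E P A"
          unfolding E_def by (auto simp: gadj_refl)
        finally show "E (?\<rho> ` P) (?\<rho> ` A) = E P A" .
      qed
      finally show ?thesis unfolding \<rho>R .
    qed
    have "?h \<le> pr p ?R (\<lambda>B. E P B \<or> E (?\<rho> ` P) B)"
      unfolding hp_def
    proof (rule pr_mono[OF p])
      fix B assume "LR s 0 (2 * n - 1) 0 (2 * n - 1) B"
      from right_reaches[OF n D g P(1-4) this U_def] show "E P B \<or> E (?\<rho> ` P) B" unfolding E_def .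
    qed
    also have "\<dots> \<le> pr p ?R (E P) + pr p ?R (E (?\<rho> ` P))" by (rule pr_disj_le[OF p])
    finally have hE: "?h / 2 \<le> pr p ?R (E P)" using psym by simp
    have "pr p ?R (\<lambda>A. lregion s n A = D) * (?h / 2) \<le> pr p ?R (\<lambda>A. lregion s n A = D) * pr p ?R (E P)"
      by (rule mult_left_mono[OF hE pr_nonneg[OF p]])
    also have "\<dots> = pexp p ?R (\<lambda>A. of_bool (lregion s n A = D) * of_bool (E P A))"
      unfolding pr_def
    proof (rule pexp_indep[symmetric, of _ "lclosure s n D" U])
      show "lclosure s n D \<subseteq> ?R" using cS SR by blast
      fix A
      show "of_bool (lregion s n A = D) = (of_bool (lregion s n (A \<inter> lclosure s n D) = D) :: real)"
      proof -
        have e: "A \<inter> lclosure s n D = (A \<inter> lclosure s n D) \<inter> lclosure s n D" by blast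
        have "lregion s n A = D \<longleftrightarrow> lregion s n (A \<inter> lclosure s n D) = D"
          using lregion_local[OF e sym] lregion_local[OF e[symmetric] sym] by (intro iffI)
        then show ?thesis by simp
      qed
      show "of_bool (E P A) = (of_bool (E P (A \<inter> U)) :: real)" unfolding E_def by (simp add: Int_assoc)
    qed (auto simp: U_def)
    also have "\<dots> \<le> pexp p ?R (\<lambda>A. of_bool (lregion s n A = D) * of_bool (XR s n A))"
    proof (rule pexp_mono[OF p])
      fix A assume A: "A \<subseteq> ?R"
      have "XR s n A" if DA: "lregion s n A = D" and EA: "E P A"
      proof -
        have "lclosure s n D - D \<subseteq> A" using lregion_step[of _ s n A] DA by blast
        then have PA: "P \<subseteq> A" using P(1) by blast
        have PS: "P \<subseteq> ?S" using P(1) cS by blast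
        have tu: "conn s (A \<inter> ?S) t u" by (rule conn_mono[OF P(4)]) (use PA PS in blast)
        obtain z w q where e: "fst z = 2 * n - 1" "conn s (A \<inter> U) z w" "q \<in> P" "gadj s w q"
          using EA unfolding E_def by blast
        have "conn s (A \<inter> ?R) z w" by (rule conn_mono[OF e(2)]) (auto simp: U_def)
        from conn_extend[OF this _ e(4)] have zq: "conn s (A \<inter> ?R) z q" using PA PS SR e(3) by blast
        have "conn s (A \<inter> ?R) t q" by (rule conn_mono[OF P(5)[OF e(3)]]) (use PA PS SR in blast)
        from conn_trans[OF this conn_sym[OF zq]] show ?thesis unfolding XR_def using e(1) P(2,3) tu by blast
      qed
      then show "of_bool (lregion s n A = D) * of_bool (E P A) \<le> (of_bool (lregion s n A = D) * of_bool (XR s n A) :: real)"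
        by (auto simp: of_bool_def)
    qed
    finally show ?thesis .
  qed
  \<comment> \<open>A vertical crossing of the small square keeps the dual paths from the left away
    from its right side, so the good regions carry at least its probability.\<close>
  have TBg: "good (lregion s n A)" if "TB s 0 (n - 1) 0 (n - 1) A" for A
    unfolding good_def
  proof (intro ballI notI)
    fix z assume z: "z \<in> lregion s n A" "fst z = n - 1"
    obtain t u where tu: "snd t = n - 1" "snd u = 0" "conn s (A \<inter> ?S) t u"
      using \<open>TB s 0 (n - 1) 0 (n - 1) A\<close> unfolding TB_def by blast
    obtain l where l: "fst l = 0" "conn (\<not> s) (?S - A) l z" using z(1) unfolding lregion_def by blast
    have "A \<inter> ?S \<inter> (?S - A) \<noteq> {}"
      by (rule TB_LR_meet[OF _ _ tu(3) _ tu(1,2) l(2) _ l(1) z(2)]) (use n in auto)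
    then show False by blast
  qed
  have lP: "lregion s n A \<in> Pow ?S" for A using lregion_sub by blast
  have vpR: "vp s p 0 (n - 1) 0 (n - 1) = pr p ?R (TB s 0 (n - 1) 0 (n - 1))"
    by (rule vp_eq[symmetric]) (use SR in auto)
  also have "\<dots> \<le> pr p ?R (\<lambda>A. good (lregion s n A))" by (rule pr_mono[OF p]) (use TBg in blast)
  also have "\<dots> = (\<Sum>D\<in>Pow ?S. pexp p ?R (\<lambda>A. of_bool (lregion s n A = D) * of_bool (good (lregion s n A))))"
    unfolding pr_def by (rule pexp_partition) (use lP in auto)
  also have "\<dots> = (\<Sum>D\<in>Pow ?S. of_bool (good D) * pr p ?R (\<lambda>A. lregion s n A = D))"
    unfolding pr_def pexp_cmult[symmetric] by (intro sum.cong refl pexp_cong) (auto simp: of_bool_def)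
  finally have v: "vp s p 0 (n - 1) 0 (n - 1) \<le> (\<Sum>D\<in>Pow ?S. of_bool (good D) * pr p ?R (\<lambda>A. lregion s n A = D))" .
  have "?h * vp s p 0 (n - 1) 0 (n - 1) / 2 = (?h / 2) * vp s p 0 (n - 1) 0 (n - 1)" by simp
  also have "\<dots> \<le> (?h / 2) * (\<Sum>D\<in>Pow ?S. of_bool (good D) * pr p ?R (\<lambda>A. lregion s n A = D))"
    by (rule mult_left_mono[OF v]) (use h0 in simp)
  also have "\<dots> = (\<Sum>D\<in>Pow ?S. of_bool (good D) * (pr p ?R (\<lambda>A. lregion s n A = D) * (?h / 2)))"
    unfolding sum_distrib_left by (intro sum.cong refl) simp
  also have "\<dots> \<le> (\<Sum>D\<in>Pow ?S. pexp p ?R (\<lambda>A. of_bool (lregion s n A = D) * of_bool (XR s n A)))"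
  proof (rule sum_mono)
    fix D
    show "of_bool (good D) * (pr p ?R (\<lambda>A. lregion s n A = D) * (?h / 2)) \<le>
      pexp p ?R (\<lambda>A. of_bool (lregion s n A = D) * of_bool (XR s n A))"
      using step[of D] pexp_nonneg[OF p, of ?R "\<lambda>A. of_bool (lregion s n A = D) * of_bool (XR s n A)"]
      by (cases "good D") auto
  qed
  also have "\<dots> = pr p ?R (XR s n)"
    unfolding pr_def by (rule pexp_partition[symmetric]) (use lP in auto)
  finally show ?thesis .
qed

definition XL :: "bool \<Rightarrow> int \<Rightarrow> vertex set \<Rightarrow> bool" where
  "XL s n A \<longleftrightarrow> (\<exists>z t u. fst z = - n \<and> snd t = n - 1 \<and> snd u = 0 \<and>
     conn s (A \<inter> rect 0 (n - 1) 0 (n - 1)) t u \<and> conn s (A \<inter> rect (- n) (n - 1) 0 (2 * n - 1)) t z)"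

lemma XR_mono: "XR s n A \<Longrightarrow> A \<subseteq> B \<Longrightarrow> XR s n B"
  unfolding XR_def by (meson Int_mono conn_mono order_refl)

lemma XL_mono: "XL s n A \<Longrightarrow> A \<subseteq> B \<Longrightarrow> XL s n B"
  unfolding XL_def by (meson Int_mono conn_mono order_refl)

lemma XL_XR: "XL s n (xrefl (n - 1) ` A) = XR s n A"
proof -
  let ?T = "xrefl (n - 1)"
  have im: "?T ` A \<inter> rect 0 (n - 1) 0 (n - 1) = ?T ` (A \<inter> rect 0 (n - 1) 0 (n - 1))"
    "?T ` A \<inter> rect (- n) (n - 1) 0 (2 * n - 1) = ?T ` (A \<inter> rect 0 (2 * n - 1) 0 (2 * n - 1))"
    by (force simp: in_rect image_iff)+
  show ?thesis
  proof
    assume "XR s n A"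
    then obtain z t u where h: "fst z = 2 * n - 1" "snd t = n - 1" "snd u = 0"
      "conn s (A \<inter> rect 0 (n - 1) 0 (n - 1)) t u" "conn s (A \<inter> rect 0 (2 * n - 1) 0 (2 * n - 1)) t z"
      unfolding XR_def by blast
    show "XL s n (?T ` A)" unfolding XL_def im
      by (rule exI[of _ "?T z"], rule exI[of _ "?T t"], rule exI[of _ "?T u"])
        (simp add: h conn_iso[OF inj_refl(1) gadj_refl(1)])
  next
    assume "XL s n (?T ` A)"
    then obtain z t u where h: "fst z = - n" "snd t = n - 1" "snd u = 0"
      "conn s (?T ` (A \<inter> rect 0 (n - 1) 0 (n - 1))) t u" "conn s (?T ` (A \<inter> rect 0 (2 * n - 1) 0 (2 * n - 1))) t z"
      unfolding XL_def im by blast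
    have c: "conn s X (?T v) (?T w)" if "conn s (?T ` X) v w" for X v w
      using that conn_iso[OF inj_refl(1) gadj_refl(1), of s "n - 1" X "?T v" "?T w"] by simp
    show "XR s n A" unfolding XR_def
      by (rule exI[of _ "?T z"], rule exI[of _ "?T t"], rule exI[of _ "?T u"])
        (simp add: h(1-3) c[OF h(4)] c[OF h(5)])
  qed
qed

lemma XL_prob:
  assumes n: "2 \<le> n" and p: "0 \<le> p" "p \<le> 1"
  shows "pr p (rect (- n) (n - 1) 0 (2 * n - 1)) (XL s n) = pr p (rect 0 (2 * n - 1) 0 (2 * n - 1)) (XR s n)"
proof -
  let ?T = "xrefl (n - 1)"
  have im: "?T ` rect 0 (2 * n - 1) 0 (2 * n - 1) = rect (- n) (n - 1) 0 (2 * n - 1)"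
    by (rule image_invol) (auto simp: in_rect)
  have "pr p (?T ` rect 0 (2 * n - 1) 0 (2 * n - 1)) (XL s n) =
    pr p (rect 0 (2 * n - 1) 0 (2 * n - 1)) (\<lambda>A. XL s n (?T ` A))"
    by (rule pr_image) (rule inj_on_subset[OF inj_refl(1)], simp)
  then show ?thesis unfolding im XL_XR .
qed

text \<open>The horizontal crossing of the small square meets both vertical crossings there, which
  in turn lead to the far left and the far right.\<close>

lemma LR_long:
  assumes n: "2 \<le> n" and h: "XR s n A" "XL s n A" "LR s 0 (n - 1) 0 (n - 1) A"
  shows "LR s (- n) (2 * n - 1) 0 (2 * n - 1) A"
proof -
  let ?S = "rect 0 (n - 1) 0 (n - 1)" and ?L = "rect (- n) (2 * n - 1) 0 (2 * n - 1)"
  obtain z t u where 1: "fst z = 2 * n - 1" "snd t = n - 1" "snd u = 0"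
    "conn s (A \<inter> ?S) t u" "conn s (A \<inter> rect 0 (2 * n - 1) 0 (2 * n - 1)) t z"
    using h(1) unfolding XR_def by blast
  obtain z' t' u' where 2: "fst z' = - n" "snd t' = n - 1" "snd u' = 0"
    "conn s (A \<inter> ?S) t' u'" "conn s (A \<inter> rect (- n) (n - 1) 0 (2 * n - 1)) t' z'"
    using h(2) unfolding XL_def by blast
  obtain l r where 3: "fst l = 0" "fst r = n - 1" "conn s (A \<inter> ?S) l r"
    using h(3) unfolding LR_def by blast
  have n1: "0 < n - 1" using n by simp
  have "conn s (A \<inter> ?S) l t" "conn s (A \<inter> ?S) l t'"
    by (rule crossing_conn[OF n1 n1 3(3,1,2) 1(4,2,3)], rule crossing_conn[OF n1 n1 3(3,1,2) 2(4,2,3)])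
  then have "conn s (A \<inter> ?S) t' t" using conn_trans[OF conn_sym] by blast
  then have a: "conn s (A \<inter> ?L) t' t" by (rule conn_mono) (use n in \<open>auto simp: in_rect\<close>)
  have b: "conn s (A \<inter> ?L) t z" by (rule conn_mono[OF 1(5)]) (use n in \<open>auto simp: in_rect\<close>)
  have c: "conn s (A \<inter> ?L) t' z'" by (rule conn_mono[OF 2(5)]) (use n in \<open>auto simp: in_rect\<close>)
  show ?thesis unfolding LR_def using conn_trans[OF conn_sym[OF c] conn_trans[OF a b]] 1(1) 2(1) by blast
qed

lemma hp_rect: "hp s p 0 (w - 1) 0 (t - 1) = hp s p i (i + w - 1) j (j + t - 1)"
  using hp_shift[of s p 0 i "w - 1" 0 j "t - 1"] by (simp add: algebra_simps)

lemma hp_long: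
  assumes n: "2 \<le> n" and p: "0 \<le> p" "p \<le> 1" and c: "0 \<le> c"
    "c \<le> hp s p 0 (n - 1) 0 (n - 1)" "c \<le> hp s p 0 (2 * n - 1) 0 (2 * n - 1)"
  shows "c ^ 5 / 4 \<le> hp s p 0 (3 * n - 1) 0 (2 * n - 1)"
proof -
  let ?S = "rect 0 (n - 1) 0 (n - 1)" and ?L = "rect (- n) (2 * n - 1) 0 (2 * n - 1)"
  let ?R = "rect 0 (2 * n - 1) 0 (2 * n - 1)" and ?R' = "rect (- n) (n - 1) 0 (2 * n - 1)"
  have sub: "?S \<subseteq> ?L" "?R \<subseteq> ?L" "?R' \<subseteq> ?L" "?S \<subseteq> ?R" "?S \<subseteq> ?R'" using n by (auto simp: in_rect)
  have loc: "XR s n A = XR s n (A \<inter> ?R)" "XL s n A = XL s n (A \<inter> ?R')" for A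
    unfolding XR_def XL_def Int_assoc using sub by (simp_all add: inf.absorb2)
  have R: "pr p ?L (XR s n) = pr p ?R (XR s n)" by (rule pr_subset) (use sub loc in auto)
  have L: "pr p ?L (XL s n) = pr p ?R (XR s n)"
    unfolding XL_prob[OF n p, symmetric] by (rule pr_subset) (use sub loc in auto)
  have "c * c / 2 \<le> hp s p 0 (2 * n - 1) 0 (2 * n - 1) * vp s p 0 (n - 1) 0 (n - 1) / 2"
    unfolding vp_hp using c by (intro divide_right_mono mult_mono) auto
  also have "\<dots> \<le> pr p ?R (XR s n)" by (rule XR_prob[OF n p])
  finally have x: "c * c / 2 \<le> pr p ?R (XR s n)" .
  \<comment> \<open>Two mirror-image events of probability at least \<open>c * c / 2\<close> each,
    and one crossing of the small square of probability at least \<open>c\<close>.\<close>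
  have "c ^ 5 / 4 = (c * c / 2) * (c * c / 2) * c" by (simp add: eval_nat_numeral)
  also have "\<dots> \<le> pr p ?L (XR s n) * pr p ?L (XL s n) * pr p ?L (LR s 0 (n - 1) 0 (n - 1))"
    unfolding R L hp_eq[OF finite_rect sub(1)]
    by (intro mult_mono x c(2)) (use c in \<open>auto intro!: mult_nonneg_nonneg pr_nonneg p\<close>)
  also have "\<dots> \<le> pr p ?L (\<lambda>A. XR s n A \<and> XL s n A) * pr p ?L (LR s 0 (n - 1) 0 (n - 1))"
    by (intro mult_right_mono pr_nonneg p, rule pr_harris[OF p finite_rect]; use XR_mono XL_mono in blast)
  also have "\<dots> \<le> pr p ?L (\<lambda>A. (XR s n A \<and> XL s n A) \<and> LR s 0 (n - 1) 0 (n - 1) A)"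
    by (rule pr_harris[OF p finite_rect]; use XR_mono XL_mono LR_mono in blast)
  also have "\<dots> \<le> hp s p (- n) (2 * n - 1) 0 (2 * n - 1)"
    unfolding hp_def by (intro pr_mono p) (use LR_long[OF n] in blast)
  also have "\<dots> = hp s p 0 (3 * n - 1) 0 (2 * n - 1)"
    using hp_rect[of s p "3 * n" "2 * n" "- n" 0] by (simp add: algebra_simps)
  finally show ?thesis .
qed

text \<open>The first factor is a crossing of a \<open>3 * n\<close> by \<open>2 * n\<close>
  rectangle. Each of four gluings adds length \<open>n\<close> and costs another such rectangle and
  a vertical crossing of a square of side \<open>2 * n\<close>.\<close>

definition rsw_const :: "real \<Rightarrow> real" where
  "rsw_const c = (c ^ 5 / 4) * ((c ^ 5 / 4) * c) ^ 4"

lemma hp_very_long: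
  assumes n: "2 \<le> n" and p: "0 \<le> p" "p \<le> 1" and c: "0 \<le> c"
    "c \<le> hp s p 0 (n - 1) 0 (n - 1)" "c \<le> hp s p 0 (2 * n - 1) 0 (2 * n - 1)"
  shows "rsw_const c \<le> hp s p 0 (7 * n - 1) 0 (2 * n - 1)"
proof -
  let ?h = "c ^ 5 / 4"
  have h3: "?h \<le> hp s p 0 (3 * n - 1) 0 (2 * n - 1)" by (rule hp_long[OF assms])
  have h0: "0 \<le> ?h" using c by simp
  have "?h * (?h * c) ^ k \<le> hp s p 0 ((3 + int k) * n - 1) 0 (2 * n - 1)" for k
  proof (induction k)
    case 0 then show ?case using h3 by simp
  next
    case (Suc k)
    let ?w = "(3 + int k) * n"
    have w: "2 * n \<le> ?w" using n by (intro mult_right_mono) auto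
    have "?h * (?h * c) ^ Suc k = (?h * (?h * c) ^ k) * ?h * c" by simp
    also have "\<dots> \<le> hp s p 0 (?w - 1) 0 (2 * n - 1) * hp s p (?w - 2 * n) (?w + n - 1) 0 (2 * n - 1) *
      vp s p (?w - 2 * n) (?w - 1) 0 (2 * n - 1)"
    proof (intro mult_mono Suc.IH)
      show "?h \<le> hp s p (?w - 2 * n) (?w + n - 1) 0 (2 * n - 1)"
        using h3 hp_rect[of s p "3 * n" "2 * n" "?w - 2 * n" 0] by (simp add: algebra_simps)
      have "vp s p (?w - 2 * n) (?w - 1) 0 (2 * n - 1) = hp s p 0 (2 * n - 1) 0 (2 * n - 1)"
        unfolding vp_hp using hp_rect[of s p "2 * n" "2 * n" 0 "?w - 2 * n"] by (simp add: algebra_simps)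
      then show "c \<le> vp s p (?w - 2 * n) (?w - 1) 0 (2 * n - 1)" using c by simp
    qed (use c h0 in \<open>auto intro!: mult_nonneg_nonneg simp: hp_def pr_nonneg p\<close>)
    also have "\<dots> \<le> hp s p 0 (?w + n - 1) 0 (2 * n - 1)"
      by (rule hp_glue[OF p]) (use n w in auto)
    also have "?w + n - 1 = (3 + int (Suc k)) * n - 1" by (simp add: algebra_simps)
    finally show ?case .
  qed
  from this[of 4] show ?thesis unfolding rsw_const_def by simp
qed

subsection \<open>Circuits in annuli\<close>

definition box :: "int \<Rightarrow> vertex set" where "box n = rect (- n) n (- n) n"

lemma in_box: "v \<in> box n \<longleftrightarrow> norm_inf v \<le> n"
  by (auto simp: box_def in_rect norm_inf_def)

lemma finite_box [simp]: "finite (box n)" by (simp add: box_def)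

definition rot :: "vertex \<Rightarrow> vertex" where "rot v = (- snd v, fst v)"

lemma inj_rot: "inj (rot ^^ k)"
proof (rule inj_fn)
  show "inj rot" by (auto simp: inj_on_def rot_def prod_eq_iff)
qed

lemma gadj_rot: "gadj s ((rot ^^ k) u) ((rot ^^ k) w) = gadj s u w"
  by (induction k) (auto simp: gadj_iff rot_def abs_minus_commute max.commute add.commute)

lemma norm_rot: "norm_inf ((rot ^^ k) v) = norm_inf v"
proof (induction k)
  case (Suc k)
  have "norm_inf (rot w) = norm_inf w" for w by (simp add: norm_inf_def rot_def max.commute)
  then show ?case using Suc by simp
qed simp

lemma rot4: "(rot ^^ 4) v = v"
  by (simp add: rot_def eval_nat_numeral)

lemma rot_image:
  assumes "k \<le> 4" "\<And>v. v \<in> X \<longleftrightarrow> Q (norm_inf v)"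
  shows "(rot ^^ k) ` X = X"
proof
  show "(rot ^^ k) ` X \<subseteq> X"
  proof
    fix w assume "w \<in> (rot ^^ k) ` X"
    then obtain v where "v \<in> X" "w = (rot ^^ k) v" by blast
    then show "w \<in> X" using assms(2)[of v] assms(2)[of w] norm_rot[of k v] by simp
  qed
  show "X \<subseteq> (rot ^^ k) ` X"
  proof
    fix v assume "v \<in> X"
    then have "(rot ^^ (4 - k)) v \<in> X"
      using assms(2)[of v] assms(2)[of "(rot ^^ (4 - k)) v"] norm_rot[of "4 - k" v] by simp
    moreover have "(rot ^^ k) ((rot ^^ (4 - k)) v) = v"
      using rot4[of v] assms(1) funpow_add[of k "4 - k" rot] by (simp add: o_def)
    ultimately show "v \<in> (rot ^^ k) ` X" by force
  qed
qed

lemma rot_to_top: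
  obtains k where "k < 4" "snd ((rot ^^ k) v) = norm_inf v"
proof -
  have "snd v = norm_inf v \<or> fst v = norm_inf v \<or> - snd v = norm_inf v \<or> - fst v = norm_inf v"
    by (auto simp: norm_inf_def max_def abs_if)
  moreover have "snd ((rot ^^ 0) v) = snd v" "snd ((rot ^^ 1) v) = fst v" "snd ((rot ^^ 2) v) = - snd v"
    "snd ((rot ^^ 3) v) = - fst v"
    by (simp_all add: rot_def eval_nat_numeral)
  ultimately show ?thesis using that[of 0] that[of 1] that[of 2] that[of 3] by auto
qed

text \<open>A path from the top side towards \<open>x\<close>, which is not above height
  \<open>n + 1\<close>, stays in the strip until it first reaches that height; this piece is a
  vertical crossing and is stopped by the horizontal one.\<close>

lemma strip_blocks:
  assumes n: "1 \<le> n" and W: "W = box (3 * n) - box n"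
    and top: "LR s (- (3 * n)) (3 * n) (n + 1) (3 * n) A"
    and xy: "norm_inf x = n + 1" "snd y = 3 * n"
  shows "\<not> conn (\<not> s) (W - A) x y"
proof
  assume c: "conn (\<not> s) (W - A) x y"
  let ?Y = "{v. snd v \<le> n + 1}" and ?T = "rect (- (3 * n)) (3 * n) (n + 1) (3 * n)"
  have "x \<in> ?Y" using xy(1) by (auto simp: norm_inf_def)
  from conn_first[OF conn_sym[OF c] this] obtain z where z: "z \<in> ?Y" "z \<in> W - A"
    "y = z \<or> (\<exists>u. conn (\<not> s) (W - A - ?Y) y u \<and> gadj (\<not> s) u z)" by blast
  have "y \<noteq> z" using z(1) xy(2) n by auto
  then obtain u where u: "conn (\<not> s) (W - A - ?Y) y u" "gadj (\<not> s) u z" using z(3) by blast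
  have "snd u > n + 1" using conn_in(2)[OF u(1)] by auto
  moreover have "\<bar>snd u - snd z\<bar> \<le> 1" using u(2) by (auto simp: gadj_iff split: if_splits)
  ultimately have sz: "snd z = n + 1" using z(1) by auto
  have WT: "v \<in> ?T" if "v \<in> W" "n + 1 \<le> snd v" for v
    using that unfolding W by (auto simp: box_def in_rect)
  have "conn (\<not> s) (?T - A) y u" by (rule conn_mono[OF u(1)]) (use WT in auto)
  from conn_extend[OF this _ u(2)] have yz: "conn (\<not> s) (?T - A) y z" using z(2) sz WT[of z] by auto
  obtain l r where lr: "fst l = - (3 * n)" "fst r = 3 * n" "conn s (A \<inter> ?T) l r"
    using top unfolding LR_def by blast
  have "(A \<inter> ?T) \<inter> (?T - A) \<noteq> {}"
    by (rule LR_TB_meet[OF _ _ lr(3) _ lr(1,2) yz _ xy(2) sz]) (use n in auto)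
  then show False by blast
qed

text \<open>The strips at the four sides of the annulus are rotations of one another and are crossed
  simultaneously with probability at least \<open>rsw_const c ^ 4\<close> by Harris's inequality. A
  path of the other colour ends on one of the four sides and is blocked there.\<close>

lemma annulus_crossing:
  assumes n: "2 \<le> n" and p: "0 \<le> p" "p \<le> 1" and c: "0 \<le> c"
    "c \<le> hp s p 0 (n - 1) 0 (n - 1)" "c \<le> hp s p 0 (2 * n - 1) 0 (2 * n - 1)"
    and W: "W = box (3 * n) - box n"
  shows "pr p W (\<lambda>A. \<exists>x y. norm_inf x = n + 1 \<and> norm_inf y = 3 * n \<and> conn (\<not> s) (W - A) x y) \<le> 1 - rsw_const c ^ 4"
proof -
  let ?T = "rect (- (3 * n)) (3 * n) (n + 1) (3 * n)"
  define top where "top k A \<longleftrightarrow> LR s (- (3 * n)) (3 * n) (n + 1) (3 * n) ((rot ^^ k) ` A)" for k :: nat and A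
  have fW: "finite W" unfolding W by simp
  have TW: "?T \<subseteq> W" unfolding W using n by (auto simp: box_def in_rect)
  have r0: "0 \<le> rsw_const c" unfolding rsw_const_def using c by simp
  \<comment> \<open>The strip has \<open>6 * n + 1\<close> columns and \<open>2 * n\<close> rows, so
    length \<open>7 * n\<close> is enough.\<close>
  have "rsw_const c \<le> hp s p 0 (7 * n - 1) 0 (2 * n - 1)" by (rule hp_very_long) fact+
  also have "\<dots> = hp s p (- (3 * n)) (4 * n - 1) (n + 1) (3 * n)"
    using hp_rect[of s p "7 * n" "2 * n" "- (3 * n)" "n + 1"] by (simp add: algebra_simps)
  also have "\<dots> \<le> hp s p (- (3 * n)) (3 * n) (n + 1) (3 * n)"
    by (rule hp_shrink[OF p]) (use n in auto)
  also have "\<dots> = pr p W (LR s (- (3 * n)) (3 * n) (n + 1) (3 * n))" by (rule hp_eq[OF fW TW, symmetric])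
  finally have t0: "rsw_const c \<le> pr p W (LR s (- (3 * n)) (3 * n) (n + 1) (3 * n))" .
  have Wn: "v \<in> W \<longleftrightarrow> norm_inf v \<le> 3 * n \<and> n < norm_inf v" for v unfolding W by (auto simp: in_box)
  have top: "rsw_const c \<le> pr p W (top k)" if "k < 4" for k
  proof -
    have im: "(rot ^^ k) ` W = W" by (rule rot_image[of _ _ "\<lambda>m. m \<le> 3 * n \<and> n < m"]) (use that Wn in auto)
    have "pr p ((rot ^^ k) ` W) (LR s (- (3 * n)) (3 * n) (n + 1) (3 * n)) = pr p W (top k)"
      unfolding top_def by (rule pr_image) (rule inj_on_subset[OF inj_rot], simp)
    then show ?thesis using t0 unfolding im by simp
  qed
  have mono: "top k A \<Longrightarrow> A \<subseteq> B \<Longrightarrow> top k B" for k A B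
    unfolding top_def by (erule LR_mono) (rule image_mono)
  have "rsw_const c ^ 4 = ((rsw_const c * rsw_const c) * rsw_const c) * rsw_const c" by (simp add: eval_nat_numeral)
  also have "\<dots> \<le> ((pr p W (top 0) * pr p W (top 1)) * pr p W (top 2)) * pr p W (top 3)"
    by (intro mult_mono top) (use r0 in \<open>auto intro!: mult_nonneg_nonneg pr_nonneg p\<close>)
  also have "\<dots> \<le> (pr p W (\<lambda>A. top 0 A \<and> top 1 A) * pr p W (top 2)) * pr p W (top 3)"
    by (intro mult_right_mono pr_nonneg p, rule pr_harris[OF p fW]; use mono in blast)
  also have "\<dots> \<le> pr p W (\<lambda>A. (top 0 A \<and> top 1 A) \<and> top 2 A) * pr p W (top 3)"
    by (intro mult_right_mono pr_nonneg p, rule pr_harris[OF p fW]; use mono in blast)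
  also have "\<dots> \<le> pr p W (\<lambda>A. ((top 0 A \<and> top 1 A) \<and> top 2 A) \<and> top 3 A)"
    by (rule pr_harris[OF p fW]; use mono in blast)
  also have "\<dots> \<le> pr p W (\<lambda>A. \<not> (\<exists>x y. norm_inf x = n + 1 \<and> norm_inf y = 3 * n \<and> conn (\<not> s) (W - A) x y))"
  proof (rule pr_mono[OF p])
    fix A assume h: "((top 0 A \<and> top 1 A) \<and> top 2 A) \<and> top 3 A"
    have tk: "top k A" if "k < 4" for k
    proof -
      have "k = 0 \<or> k = 1 \<or> k = 2 \<or> k = 3" using that by auto
      then show ?thesis using h by auto
    qed
    show "\<not> (\<exists>x y. norm_inf x = n + 1 \<and> norm_inf y = 3 * n \<and> conn (\<not> s) (W - A) x y)"
    proof safe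
      fix x y assume xy: "norm_inf x = n + 1" "norm_inf y = 3 * n" "conn (\<not> s) (W - A) x y"
      obtain k where k: "k < 4" "snd ((rot ^^ k) y) = norm_inf y" by (rule rot_to_top)
      have "(rot ^^ k) ` W = W" by (rule rot_image[of _ _ "\<lambda>m. m \<le> 3 * n \<and> n < m"]) (use k Wn in auto)
      then have im: "(rot ^^ k) ` (W - A) = W - (rot ^^ k) ` A" using image_set_diff[OF inj_rot, of k W A] by simp
      have "conn (\<not> s) ((rot ^^ k) ` (W - A)) ((rot ^^ k) x) ((rot ^^ k) y)"
        by (simp add: conn_iso[OF inj_rot gadj_rot] xy(3))
      then have cc: "conn (\<not> s) (W - (rot ^^ k) ` A) ((rot ^^ k) x) ((rot ^^ k) y)" unfolding im .
      have "\<not> conn (\<not> s) (W - (rot ^^ k) ` A) ((rot ^^ k) x) ((rot ^^ k) y)"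
      proof (rule strip_blocks[OF _ W])
        show "LR s (- (3 * n)) (3 * n) (n + 1) (3 * n) ((rot ^^ k) ` A)" using tk[OF k(1)] unfolding top_def .
      qed (use n k xy norm_rot in auto)
      then show False using cc by simp
    qed
  qed
  also have "\<dots> = 1 - pr p W (\<lambda>A. \<exists>x y. norm_inf x = n + 1 \<and> norm_inf y = 3 * n \<and> conn (\<not> s) (W - A) x y)"
    by (rule pr_not[OF fW])
  finally show ?thesis by simp
qed

subsection \<open>Choice of a scale\<close>

lemma pr_single: "finite W \<Longrightarrow> x \<in> W \<Longrightarrow> pr p W (\<lambda>B. x \<in> B) = p"
proof -
  assume h: "finite W" "x \<in> W"
  have "pr p W (\<lambda>B. x \<in> B) = p * pexp p (W - {x}) (\<lambda>B. 1) + (1 - p) * pexp p (W - {x}) (\<lambda>B. of_bool (x \<in> B))"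
    unfolding pr_def using pexp_remove[OF h, of p "\<lambda>B. of_bool (x \<in> B)"] by simp
  also have "pexp p (W - {x}) (\<lambda>B. of_bool (x \<in> B)) = pexp p (W - {x}) (\<lambda>B. 0)"
    by (rule pexp_cong) auto
  finally show ?thesis using h by simp
qed

text \<open>A crossing extends by the vertex to the right of its end. That vertex lies outside the
  smaller square, hence is black with probability \<open>p\<close> independently.\<close>

lemma hp_step:
  assumes k: "1 \<le> k" and p: "0 \<le> p" "p \<le> 1"
  shows "p * hp s p 0 (k - 1) 0 (k - 1) \<le> hp s p 0 k 0 k"
proof -
  let ?W1 = "rect 0 (k - 1) 0 (k - 1)" and ?W = "rect 0 k 0 k"
  have W: "?W = ?W1 \<union> (?W - ?W1)" by (auto simp: in_rect)
  have "p * hp s p 0 (k - 1) 0 (k - 1) = pexp p ?W1 (\<lambda>A. p * of_bool (LR s 0 (k - 1) 0 (k - 1) A))"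
    unfolding hp_def pr_def pexp_cmult ..
  also have "\<dots> \<le> pexp p ?W1 (\<lambda>A. pexp p (?W - ?W1) (\<lambda>B. of_bool (LR s 0 k 0 k (A \<union> B))))"
  proof (rule pexp_mono[OF p])
    fix A assume A: "A \<subseteq> ?W1"
    show "p * of_bool (LR s 0 (k - 1) 0 (k - 1) A) \<le> pexp p (?W - ?W1) (\<lambda>B. of_bool (LR s 0 k 0 k (A \<union> B)))"
    proof (cases "LR s 0 (k - 1) 0 (k - 1) A")
      case False
      then show ?thesis by (simp add: pexp_nonneg[OF p])
    next
      case True
      then obtain l r where lr: "fst l = 0" "fst r = k - 1" "conn s (A \<inter> ?W1) l r" unfolding LR_def by blast
      let ?x = "(k, snd r)"
      have x: "?x \<in> ?W - ?W1" using conn_in(2)[OF lr(3)] k by (auto simp: in_rect)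
      have "p = pr p (?W - ?W1) (\<lambda>B. ?x \<in> B)" by (rule pr_single[symmetric]) (use x in auto)
      also have "\<dots> \<le> pr p (?W - ?W1) (\<lambda>B. LR s 0 k 0 k (A \<union> B))"
      proof (rule pr_mono[OF p])
        fix B assume B: "?x \<in> B"
        have 1: "conn s ((A \<union> B) \<inter> ?W) l r" by (rule conn_mono[OF lr(3)]) (auto simp: in_rect)
        have 2: "gadj s r ?x" using lr(2) by (auto simp: gadj_iff)
        have 3: "?x \<in> (A \<union> B) \<inter> ?W" using B x by blast
        have "conn s ((A \<union> B) \<inter> ?W) l ?x" by (rule conn_extend[OF 1 3 2])
        moreover have "fst ?x = k" by simp
        ultimately show "LR s 0 k 0 k (A \<union> B)" unfolding LR_def using lr(1) by blast
      qed
      finally show ?thesis using True unfolding pr_def by simp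
    qed
  qed
  also have "\<dots> = pexp p (?W1 \<union> (?W - ?W1)) (\<lambda>A. of_bool (LR s 0 k 0 k A))"
    by (rule pexp_Un[symmetric]) auto
  also have "\<dots> = hp s p 0 k 0 k" unfolding hp_def pr_def W[symmetric] ..
  finally show ?thesis .
qed

text \<open>By the Hex lemma one of the colours crosses, and the symmetry of the square turns a
  vertical crossing into a horizontal one.\<close>

lemma hp_dual:
  assumes k: "1 \<le> k" and p: "0 \<le> p" "p \<le> 1"
  shows "1 \<le> hp s p 0 (k - 1) 0 (k - 1) + hp (\<not> s) (1 - p) 0 (k - 1) 0 (k - 1)"
proof -
  let ?W = "rect 0 (k - 1) 0 (k - 1)"
  have "1 = pr p ?W (\<lambda>A. True)" by (simp add: pr_def)
  also have "\<dots> \<le> pr p ?W (\<lambda>A. LR s 0 (k - 1) 0 (k - 1) A \<or> TB (\<not> s) 0 (k - 1) 0 (k - 1) (?W - A))"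
  proof (rule pr_mono[OF p])
    fix A assume "A \<subseteq> ?W"
    have "(?W - A) \<inter> ?W = ?W - A" by blast
    then show "LR s 0 (k - 1) 0 (k - 1) A \<or> TB (\<not> s) 0 (k - 1) 0 (k - 1) (?W - A)"
      using hex[of 0 "k - 1" 0 "k - 1" s A] k unfolding LR_def TB_def by (auto simp: conj_assoc)
  qed
  also have "\<dots> \<le> hp s p 0 (k - 1) 0 (k - 1) + pr p ?W (\<lambda>A. TB (\<not> s) 0 (k - 1) 0 (k - 1) (?W - A))"
    unfolding hp_def by (rule pr_disj_le[OF p])
  also have "pr p ?W (\<lambda>A. TB (\<not> s) 0 (k - 1) 0 (k - 1) (?W - A)) = vp (\<not> s) (1 - p) 0 (k - 1) 0 (k - 1)"
    unfolding vp_def pr_def by (subst pexp_compl) simp_all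
  finally show ?thesis unfolding vp_hp .
qed

definition colour_prob :: "real \<Rightarrow> bool \<Rightarrow> real" where
  "colour_prob p s = (if s then 1 - p else p)"

text \<open>Take a colour of probability at least 1/2 at scale \<open>n\<close>. If it falls below
  1/2 before scale \<open>2 * n\<close>, then right after the drop both colours are acceptable, this
  one by \<open>hp_step\<close> and the other by duality, and the colour that is likely at twice
  that scale can be chosen.\<close>

lemma good_scale:
  assumes p: "0 \<le> p" "p \<le> 1" and n: "1 \<le> n"
  obtains k s where "n \<le> k" "k \<le> 2 * n"
    "min p (1 - p) / 2 \<le> hp s (colour_prob p s) 0 (k - 1) 0 (k - 1)"
    "min p (1 - p) / 2 \<le> hp s (colour_prob p s) 0 (2 * k - 1) 0 (2 * k - 1)"
proof -
  define a where "a s k = hp s (colour_prob p s) 0 (k - 1) 0 (k - 1)" for s k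
  let ?c = "min p (1 - p) / 2"
  have cp: "0 \<le> colour_prob p s" "colour_prob p s \<le> 1" "min p (1 - p) \<le> colour_prob p s" for s
    using p by (auto simp: colour_prob_def)
  have c: "?c \<le> 1 / 2" using p by auto
  have dual: "1 \<le> a s k + a (\<not> s) k" if "1 \<le> k" for s k
  proof -
    have "1 - colour_prob p s = colour_prob p (\<not> s)" by (simp add: colour_prob_def)
    then show ?thesis using hp_dual[OF that cp(1,2), of s s] unfolding a_def by simp
  qed
  have step: "?c \<le> a s (k + 1)" if "1 / 2 \<le> a s k" "1 \<le> k" for s k
  proof -
    have "?c \<le> colour_prob p s * (1 / 2)" using cp(3)[of s] by simp
    also have "\<dots> \<le> colour_prob p s * a s k" using that cp(1)[of s] by (intro mult_left_mono)
    also have "\<dots> \<le> a s (k + 1)" using hp_step[OF that(2) cp(1,2), of s s] unfolding a_def by simp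
    finally show ?thesis .
  qed
  have "\<exists>k s. n \<le> k \<and> k \<le> 2 * n \<and> ?c \<le> a s k \<and> ?c \<le> a s (2 * k)"
  proof -
    have "1 / 2 \<le> a False n \<or> 1 / 2 \<le> a True n" using dual[OF n, of False] by auto
    then obtain s where s: "1 / 2 \<le> a s n" by blast
    show ?thesis
    proof (cases "1 / 2 \<le> a s (2 * n)")
      case True
      then show ?thesis using s c n by (intro exI[of _ n] exI[of _ s]) auto
    next
      case False
      have "\<exists>k. n \<le> k \<and> k < m \<and> 1 / 2 \<le> a s k \<and> \<not> 1 / 2 \<le> a s (k + 1)" if "n \<le> m" "\<not> 1 / 2 \<le> a s m" for m
        using that
      proof (induction m rule: int_ge_induct)
        case base then show ?case using s by simp
      next
        case (step m)
        show ?case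
        proof (cases "1 / 2 \<le> a s m")
          case True
          then show ?thesis using step by (intro exI[of _ m]) auto
        next
          case False
          then show ?thesis using step by force
        qed
      qed
      from this[OF _ False] n obtain k where k: "n \<le> k" "k < 2 * n" "1 / 2 \<le> a s k" "\<not> 1 / 2 \<le> a s (k + 1)" by auto
      have both: "?c \<le> a s' (k + 1)" for s'
      proof (cases "s' = s")
        case True
        then show ?thesis using step[OF k(3)] k(1) n by simp
      next
        case False
        then have "s' = (\<not> s)" by auto
        then show ?thesis using dual[of "k + 1" s] k n c by auto
      qed
      have "?c \<le> a s (2 * (k + 1)) \<or> ?c \<le> a (\<not> s) (2 * (k + 1))"
        using dual[of "2 * (k + 1)" s] k n c by auto
      then obtain s' where "?c \<le> a s' (2 * (k + 1))" by blast
      then have "n \<le> k + 1 \<and> k + 1 \<le> 2 * n \<and> ?c \<le> a s' (k + 1) \<and> ?c \<le> a s' (2 * (k + 1))"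
        using both[of s'] k(1,2) by simp
      then show ?thesis by blast
    qed
  qed
  then show ?thesis using that unfolding a_def by blast
qed


subsection \<open>Counting coarser partitions\<close>

lemma card_coarser:
  assumes "finite X" "\<And>x y. x \<in> X \<Longrightarrow> y \<in> X \<Longrightarrow> f x = f y \<Longrightarrow> g x = g y"
  shows "card (g ` X) \<le> card (f ` X)"
proof -
  have e: "g ` X = (\<lambda>c. g (SOME x. x \<in> X \<and> f x = c)) ` (f ` X)"
  proof -
    have "g (SOME y. y \<in> X \<and> f y = f x) = g x" if "x \<in> X" for x
    proof -
      have "(SOME y. y \<in> X \<and> f y = f x) \<in> X \<and> f (SOME y. y \<in> X \<and> f y = f x) = f x"
        by (rule someI[of _ x]) (use that in simp)
      then show ?thesis using assms(2) that by blast
    qed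
    then show ?thesis by (simp add: image_image)
  qed
  show ?thesis unfolding e by (rule card_image_le) (use assms(1) in simp)
qed

lemma card_strictly_coarser:
  assumes fin: "finite X" and fg: "\<And>x y. x \<in> X \<Longrightarrow> y \<in> X \<Longrightarrow> f x = f y \<Longrightarrow> g x = g y"
    and xy: "x \<in> X" "y \<in> X" "g x = g y" "f x \<noteq> f y"
  shows "card (g ` X) < card (f ` X)"
proof -
  let ?X = "{z \<in> X. f z \<noteq> f y}"
  have "g ` X \<subseteq> g ` ?X"
  proof
    fix c assume "c \<in> g ` X"
    then obtain z where z: "z \<in> X" "c = g z" by blast
    show "c \<in> g ` ?X"
    proof (cases "f z = f y")
      case True
      then have "g z = g x" using fg[OF z(1) xy(2)] xy(3) by simp
      then show ?thesis using xy(1,4) z(2) by blast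
    next
      case False
      then show ?thesis using z by blast
    qed
  qed
  then have "g ` X = g ` ?X" by blast
  moreover have "card (g ` ?X) \<le> card (f ` ?X)"
  proof (rule card_coarser)
    fix x y assume "x \<in> ?X" "y \<in> ?X" "f x = f y"
    then show "g x = g y" using fg[of x y] by simp
  qed (use fin in simp)
  ultimately have "card (g ` X) \<le> card (f ` ?X)" by simp
  also have "card (f ` ?X) < card (f ` X)"
  proof (rule psubset_card_mono)
    have "f y \<in> f ` X" "f y \<notin> f ` ?X" using xy(2) by auto
    then show "f ` ?X \<subset> f ` X" by blast
  qed (use fin in simp)
  finally show ?thesis .
qed

subsection \<open>Clusters touching the boundary of a box\<close>

definition sphere :: "int \<Rightarrow> vertex set" where
  "sphere n = {v. norm_inf v = n}"

definition touching :: "bool \<Rightarrow> int \<Rightarrow> vertex set \<Rightarrow> nat" where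
  "touching s n A = card (cluster s A ` (sphere n \<inter> A))"

lemma sphere_bdry:
  assumes "0 \<le> n"
  shows "sphere n = bdry (- n) n (- n) n"
proof (rule set_eqI)
  fix v :: vertex
  obtain x y where v: "v = (x, y)" by (cases v)
  have "max \<bar>x\<bar> \<bar>y\<bar> = n \<longleftrightarrow> (- n \<le> x \<and> x \<le> n \<and> - n \<le> y \<and> y \<le> n) \<and> (x = - n \<or> x = n \<or> y = - n \<or> y = n)"
    using assms unfolding max_def by (smt (verit))
  then show "v \<in> sphere n \<longleftrightarrow> v \<in> bdry (- n) n (- n) n"
    unfolding v sphere_def bdry_def by (simp add: in_rect norm_inf_def)
qed

lemma norm_step:
  assumes "gadj s u v"
  shows "\<bar>norm_inf u - norm_inf v\<bar> \<le> 1"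
proof -
  have "\<bar>fst u - fst v\<bar> \<le> 1" "\<bar>snd u - snd v\<bar> \<le> 1" using assms by (auto simp: gadj_iff split: if_splits)
  then show ?thesis unfolding norm_inf_def max_def by (smt (verit))
qed

lemma cluster_conn:
  assumes "x \<in> A" "y \<in> A"
  shows "cluster s A x = cluster s A y \<longleftrightarrow> conn s A x y"
proof
  assume "cluster s A x = cluster s A y"
  moreover have "y \<in> cluster s A y" using assms unfolding cluster_def by blast
  ultimately show "conn s A x y" unfolding cluster_def by blast
next
  assume "conn s A x y"
  then show "cluster s A x = cluster s A y" using cluster_eq[of y s A x] unfolding cluster_def by simp
qed

lemma conn_pass:
  assumes c: "conn s X v y" and n: "\<not> conn s (X - {w}) v y" and y: "y \<noteq> w"
  obtains w' where "gadj s w w'" "conn s (X - {w}) w' y"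
proof -
  have "conn s X v w"
  proof (rule ccontr)
    assume "\<not> conn s X v w"
    then have "conn s (X \<inter> - {w}) v y" by (intro conn_all[OF c]) auto
    then show False using n by (simp add: Diff_eq)
  qed
  then have "conn s X w y" using conn_trans[OF conn_sym c] by blast
  from conn_leave[OF this y] show ?thesis using that by blast
qed

text \<open>The vertices on the sphere are the same for both sets, so enlarging the set can only
  merge clusters.\<close>

lemma touching_mono:
  assumes "finite B" "A \<subseteq> B" "sphere n \<inter> A = sphere n \<inter> B"
  shows "touching s n B \<le> touching s n A"
  unfolding touching_def assms(3)
proof (rule card_coarser)
  fix x y assume h: "x \<in> sphere n \<inter> B" "y \<in> sphere n \<inter> B" "cluster s A x = cluster s A y"
  then have xy: "x \<in> A" "y \<in> A" "x \<in> B" "y \<in> B" using assms(3) by auto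
  then have "conn s A x y" using h(3) cluster_conn by blast
  then have "conn s B x y" by (rule conn_mono[OF _ assms(2)])
  then show "cluster s B x = cluster s B y" using xy cluster_conn by blast
qed (use assms(1) in simp)

lemma touching_less:
  assumes fin: "finite B" and AB: "A \<subseteq> B" "sphere n \<inter> A = sphere n \<inter> B"
    and xy: "x \<in> sphere n" "y \<in> sphere n" "x \<in> A" "y \<in> A" "conn s B x y" "\<not> conn s A x y"
  shows "touching s n B < touching s n A"
  unfolding touching_def AB(2)
proof (rule card_strictly_coarser)
  fix x y assume h: "x \<in> sphere n \<inter> B" "y \<in> sphere n \<inter> B" "cluster s A x = cluster s A y"
  then have xy: "x \<in> A" "y \<in> A" "x \<in> B" "y \<in> B" using AB(2) by auto
  then have "conn s A x y" using h(3) cluster_conn by blast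
  then have "conn s B x y" by (rule conn_mono[OF _ AB(1)])
  then show "cluster s B x = cluster s B y" using xy cluster_conn by blast
next
  show "x \<in> sphere n \<inter> B" "y \<in> sphere n \<inter> B" using xy AB by auto
  show "cluster s B x = cluster s B y" using xy AB cluster_conn[of x B y s] by auto
  show "cluster s A x \<noteq> cluster s A y" using xy cluster_conn[of x A y s] by auto
qed (use fin in simp)

text \<open>The colour of \<^term>\<open>u\<close> itself is ignored.\<close>

definition barm :: "bool \<Rightarrow> int \<Rightarrow> vertex \<Rightarrow> vertex set \<Rightarrow> bool" where
  "barm s n u A \<longleftrightarrow> (\<exists>v y. gadj s u v \<and> y \<in> sphere n \<and> conn s (A \<inter> box n - {u}) v y)"

definition two_arms :: "bool \<Rightarrow> int \<Rightarrow> vertex \<Rightarrow> vertex set \<Rightarrow> bool" where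
  "two_arms s n u A \<longleftrightarrow> barm s n u A \<and> barm (\<not> s) n u (- A)"

lemma barm_insert: "barm s n u (insert u A) = barm s n u A"
proof -
  have "insert u A \<inter> box n - {u} = A \<inter> box n - {u}" by blast
  then show ?thesis unfolding barm_def by simp
qed

lemma barm_compl_insert: "barm s n u (- insert u A) = barm s n u (- A)"
proof -
  have "- insert u A \<inter> box n - {u} = - A \<inter> box n - {u}" by blast
  then show ?thesis unfolding barm_def by simp
qed

lemma barm_mono: "barm s n u A \<Longrightarrow> A \<subseteq> B \<Longrightarrow> barm s n u B"
  unfolding barm_def by (meson Diff_mono Int_mono conn_mono order_refl)

text \<open>The arm of \<open>u\<close> must pass through \<open>w\<close>, and its part after the
  last visit to \<open>w\<close> is an arm of \<open>w\<close>; it is nontrivial because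
  \<open>w\<close> is not on the sphere.\<close>

lemma barm_tail:
  assumes "barm s n u (insert w A)" "\<not> barm s n u A" "w \<notin> A" "u \<noteq> w" "w \<notin> sphere n"
  shows "barm s n w (A - {u})"
proof -
  obtain v y where h: "gadj s u v" "y \<in> sphere n" "conn s (insert w A \<inter> box n - {u}) v y"
    using assms(1) unfolding barm_def by blast
  have e: "insert w A \<inter> box n - {u} - {w} = A \<inter> box n - {u}" using assms(3) by auto
  have "\<not> conn s (insert w A \<inter> box n - {u} - {w}) v y" unfolding e using assms(2) h unfolding barm_def by blast
  moreover have "y \<noteq> w" using h(2) assms(5) by auto
  ultimately obtain w' where w': "gadj s w w'" "conn s (insert w A \<inter> box n - {u} - {w}) w' y"
    using conn_pass[OF h(3)] by blast
  have "conn s ((A - {u}) \<inter> box n - {w}) w' y" by (rule conn_mono[OF w'(2)]) (use assms(3) in auto)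
  then show ?thesis unfolding barm_def using w'(1) h(2) by blast
qed

text \<open>If adding \<open>u\<close> merges two boundary clusters, then \<open>u\<close> has arms
  in two different clusters, and \<open>dual_arm\<close> provides the arm of the other colour
  between them.\<close>

lemma touching_insert:
  assumes n: "1 \<le> n" and A: "A \<subseteq> box n" and u: "u \<in> box n" "u \<notin> sphere n" "u \<notin> A" and nj: "\<not> two_arms s n u A"
  shows "touching s n (insert u A) = touching s n A"
proof (rule antisym)
  have fin: "finite (insert u A)" using finite_subset[OF A] by simp
  have sp: "sphere n \<inter> A = sphere n \<inter> insert u A" using u by auto
  show "touching s n (insert u A) \<le> touching s n A" by (rule touching_mono[OF fin _ sp]) auto
  show "touching s n A \<le> touching s n (insert u A)"
    unfolding touching_def sp[symmetric]
  proof (rule card_coarser)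
    fix x y assume h: "x \<in> sphere n \<inter> A" "y \<in> sphere n \<inter> A" "cluster s (insert u A) x = cluster s (insert u A) y"
    have c: "conn s (insert u A) x y" using h cluster_conn[of x "insert u A" y s] by auto
    have ne: "x \<noteq> u" "y \<noteq> u" using h u by auto
    have e: "insert u A - {u} = A" using u by blast
    have "conn s A x y"
    proof (rule ccontr)
      assume nc: "\<not> conn s A x y"
      obtain u3 where u3: "gadj s u u3" "conn s A u3 y" using conn_pass[OF c, of u] nc ne e by auto
      have "\<not> conn s A y x" using nc conn_sym by blast
      then obtain u1 where u1: "gadj s u u1" "conn s A u1 x" using conn_pass[OF conn_sym[OF c], of u] ne e by auto
      have nc13: "\<not> conn s A u1 u3"
        using nc conn_trans[OF conn_sym[OF u1(2)] conn_trans[OF _ u3(2)]] by blast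
      have A': "A = A \<inter> rect (- n) n (- n) n - {u}" using A u unfolding box_def by blast
      have bd: "sphere n = bdry (- n) n (- n) n" using n by (intro sphere_bdry) simp
      have xb: "x \<in> bdry (- n) n (- n) n" "y \<in> bdry (- n) n (- n) n" using h unfolding bd by auto
      have ub: "u \<in> rect (- n) n (- n) n" "u \<notin> bdry (- n) n (- n) n" using u unfolding bd box_def by auto
      have nn: "- n < n" using n by simp
      obtain v w where vw: "gadj (\<not> s) u v" "w \<in> bdry (- n) n (- n) n"
        "conn (\<not> s) (rect (- n) n (- n) n - A - {u}) v w"
        by (rule dual_arm[OF nn nn ub A' u1(1) u3(1) u1(2) u3(2) xb nc13])
      have "rect (- n) n (- n) n - A - {u} = - A \<inter> box n - {u}" unfolding box_def by blast
      then have "barm (\<not> s) n u (- A)" unfolding barm_def bd using vw by metis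
      moreover have "A \<inter> box n - {u} = A" using A' unfolding box_def by simp
      then have "barm s n u A"
        unfolding barm_def using u1 h(1) by (intro exI[of _ u1] exI[of _ x]) simp
      ultimately show False using nj unfolding two_arms_def by blast
    qed
    then show "cluster s A x = cluster s A y" using h cluster_conn by blast
  qed (use finite_subset[OF A] in simp)
qed

text \<open>If blackening \<open>w\<close> creates the two-arm event of \<open>u\<close>, then
  \<open>w\<close> has a black arm without the help of \<open>u\<close>; so blackening
  \<open>u\<close> can only harm \<open>w\<close>, by cutting its white arm. If blackening
  \<open>w\<close> destroys the event, then \<open>w\<close> has a white arm even when
  \<open>u\<close> is black, and blackening \<open>u\<close> can only help \<open>w\<close>.\<close>

lemma two_arms_sign:
  assumes u: "u \<notin> sphere n" "w \<notin> sphere n" "u \<noteq> w" "u \<notin> A" "w \<notin> A"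
  shows "(of_bool (two_arms s n u (insert w A)) - of_bool (two_arms s n u A)) *
    (of_bool (two_arms s n w (insert u A)) - of_bool (two_arms s n w A)) \<le> (0::real)"
proof -
  have up: "barm s n w A" if "two_arms s n u (insert w A)" "\<not> two_arms s n u A" "w \<notin> A" "u \<noteq> w" "w \<notin> sphere n" for u w
  proof -
    have "barm (\<not> s) n u (- A)" by (rule barm_mono[of _ _ _ "- insert w A"]) (use that in \<open>auto simp: two_arms_def\<close>)
    then have "\<not> barm s n u A" "barm s n u (insert w A)" using that unfolding two_arms_def by auto
    from barm_tail[OF this(2,1) that(3-5)] show ?thesis by (rule barm_mono) auto
  qed
  have down: "barm (\<not> s) n w (- insert u A)" if "two_arms s n u A" "\<not> two_arms s n u (insert w A)" "w \<notin> A" "u \<noteq> w" "w \<notin> sphere n" for u w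
  proof -
    have "barm s n u (insert w A)" by (rule barm_mono[of _ _ _ A]) (use that in \<open>auto simp: two_arms_def\<close>)
    then have 1: "\<not> barm (\<not> s) n u (- insert w A)" using that unfolding two_arms_def by auto
    have "insert w (- insert w A) = - A" using that(3) by auto
    then have 2: "barm (\<not> s) n u (insert w (- insert w A))" using that(1) unfolding two_arms_def by simp
    from barm_tail[OF 2 1 _ that(4,5)] show ?thesis by (rule barm_mono) auto
  qed
  show ?thesis
  proof (cases "two_arms s n u (insert w A)"; cases "two_arms s n u A")
    assume h: "two_arms s n u (insert w A)" "\<not> two_arms s n u A"
    have "barm s n w A" by (rule up[OF h u(5,3,2)])
    then have "two_arms s n w A" if "two_arms s n w (insert u A)"
      using up[OF that _ u(4) _ u(1)] that u(3) barm_mono[of "\<not> s" n w "- insert u A" "- A"]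
      unfolding two_arms_def by auto
    then show ?thesis using h by auto
  next
    assume h: "\<not> two_arms s n u (insert w A)" "two_arms s n u A"
    have "barm (\<not> s) n w (- insert u A)" by (rule down[OF h(2,1) u(5,3,2)])
    then have "two_arms s n w (insert u A)" if "two_arms s n w A"
      using that barm_mono[of s n w A "insert u A"] unfolding two_arms_def by auto
    then show ?thesis using h by auto
  qed auto
qed

text \<open>A path entering the inner box passes through the sphere of radius \<open>n + 1\<close>.
  Boundary clusters that do not reach this sphere are therefore not merged inside the box, and the
  others cross the annulus.\<close>

lemma touching_inner:
  assumes A: "A \<subseteq> box (3 * n)" and n: "1 \<le> n"
  shows "touching s (3 * n) (A - box n) \<le> touching s (3 * n) A + ncross s (sphere (n + 1)) (sphere (3 * n)) (A - box n)"
proof -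
  let ?X = "sphere (3 * n) \<inter> A" and ?f = "cluster s (A - box n)" and ?g = "cluster s A"
  define Y where "Y = {x \<in> ?X. \<exists>z. norm_inf z = n + 1 \<and> conn s (A - box n) x z}"
  have fX: "finite ?X" using finite_subset[OF A] by simp
  have out: "x \<notin> box n" if "x \<in> sphere (3 * n)" for x using that n by (auto simp: sphere_def in_box)
  have sX: "sphere (3 * n) \<inter> (A - box n) = ?X" using out by blast
  have "card (?f ` (?X - Y)) \<le> card (?g ` (?X - Y))"
  proof (rule card_coarser)
    fix x y assume h: "x \<in> ?X - Y" "y \<in> ?X - Y" "?g x = ?g y"
    have c: "conn s A x y" using h cluster_conn[of x A y s] by auto
    have "conn s (A - box n) x y"
      using c
    proof (induction rule: conn_induct)
      case refl
      then show ?case using h out by blast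
    next
      case (step y z)
      have "y \<notin> box n" using conn_in(2)[OF step.IH] by blast
      have "norm_inf y \<noteq> n + 1" using step.IH h(1) unfolding Y_def by blast
      then have "z \<notin> box n" using norm_step[OF step(4)] \<open>y \<notin> box n\<close> by (auto simp: in_box)
      then show ?case using conn_extend[OF step.IH _ step(4)] step(3) by blast
    qed
    then show "?f x = ?f y" using h out cluster_conn[of x "A - box n" y s] by blast
  qed (use fX in simp)
  also have "\<dots> \<le> card (?g ` ?X)" using fX by (intro card_mono) auto
  finally have 1: "card (?f ` (?X - Y)) \<le> touching s (3 * n) A" unfolding touching_def .
  have "?f ` Y \<subseteq> {C. \<exists>z\<in>sphere (n + 1). C = cluster s (A - box n) z \<and> C \<inter> sphere (3 * n) \<noteq> {}}"
  proof
    fix C assume "C \<in> ?f ` Y"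
    then obtain x z where h: "x \<in> ?X" "norm_inf z = n + 1" "conn s (A - box n) x z" "C = ?f x"
      unfolding Y_def by blast
    have "C = ?f z" using h(4) cluster_eq[of z s "A - box n" x] h(3) unfolding cluster_def by simp
    moreover have "x \<in> C" using h(3,4) conn_in(1)[OF h(3)] unfolding cluster_def by blast
    moreover have "z \<in> sphere (n + 1)" "x \<in> sphere (3 * n)" using h(1,2) by (simp_all add: sphere_def)
    ultimately show "C \<in> {C. \<exists>z\<in>sphere (n + 1). C = cluster s (A - box n) z \<and> C \<inter> sphere (3 * n) \<noteq> {}}"
      by blast
  qed
  moreover have "finite {C. \<exists>z\<in>sphere (n + 1). C = cluster s (A - box n) z \<and> C \<inter> sphere (3 * n) \<noteq> {}}"
  proof (rule finite_subset)
    show "{C. \<exists>z\<in>sphere (n + 1). C = cluster s (A - box n) z \<and> C \<inter> sphere (3 * n) \<noteq> {}} \<subseteq> Pow (box (3 * n))"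
    proof
      fix C assume "C \<in> {C. \<exists>z\<in>sphere (n + 1). C = cluster s (A - box n) z \<and> C \<inter> sphere (3 * n) \<noteq> {}}"
      then obtain z where "C = cluster s (A - box n) z" by auto
      then show "C \<in> Pow (box (3 * n))" using cluster_subset[of s "A - box n" z] A by auto
    qed
  qed simp
  ultimately have 2: "card (?f ` Y) \<le> ncross s (sphere (n + 1)) (sphere (3 * n)) (A - box n)"
    unfolding ncross_def by (intro card_mono)
  have "?f ` ?X = ?f ` (?X - Y) \<union> ?f ` Y" unfolding Y_def by blast
  then have "touching s (3 * n) (A - box n) \<le> card (?f ` (?X - Y)) + card (?f ` Y)"
    unfolding touching_def sX using card_Un_le[of "?f ` (?X - Y)" "?f ` Y"] by simp
  then show ?thesis using 1 2 by linarith
qed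

definition pivotal :: "bool \<Rightarrow> int \<Rightarrow> vertex \<Rightarrow> vertex set \<Rightarrow> bool" where
  "pivotal s n u A \<longleftrightarrow> touching s n (insert u A) < touching s n A"

lemma sum_influence:
  assumes n: "1 \<le> n" and b: "0 < b" "b < 1"
    and q: "pr b (box (3 * n) - box n) (\<lambda>A. \<exists>x\<in>sphere (n + 1). \<exists>y\<in>sphere (3 * n). conn s A x y) \<le> q" "q < 1"
  shows "b * (1 - b) * (\<Sum>u\<in>box n. pr b (box (3 * n) - {u}) (pivotal s (3 * n) u)) \<le>
    sqrt (2 / (1 - q)\<^sup>2) * sqrt (b * (1 - b) * (\<Sum>u\<in>box n. pr b (box (3 * n)) (two_arms s (3 * n) u)))"
proof -
  let ?W = "box (3 * n)" and ?M = "box n"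
  let ?N = "touching s (3 * n)"
  \<comment> \<open>The first term ignores the colours in the inner box, so
    \<open>F (insert u A) - F A\<close> is the drop of the cluster number at \<open>u\<close>, while
    \<open>touching_inner\<close> bounds \<open>F\<close> by the number of crossing
    clusters.\<close>
  define F where "F A = real (?N (A - ?M)) - real (?N A)" for A
  have b': "0 \<le> b" "b \<le> 1" using b by auto
  have MW: "?M \<subseteq> ?W" using n by (auto simp: in_box)
  have Ms: "u \<notin> sphere (3 * n)" if "u \<in> ?M" for u using that n by (auto simp: in_box sphere_def)
  have ins: "insert u A - ?M = A - ?M" if "u \<in> ?M" for u A using that by blast
  have infl: "b * (1 - b) * (\<Sum>u\<in>?M. pexp b (?W - {u}) (\<lambda>A. F (insert u A) - F A)) \<le>
    sqrt (pexp b ?W (\<lambda>A. (F A)\<^sup>2)) * sqrt (b * (1 - b) * (\<Sum>u\<in>?M. pr b ?W (two_arms s (3 * n) u)))"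
  proof (rule influence_bound[OF b' finite_box MW])
    fix u A assume u: "u \<in> ?M" "A \<subseteq> ?W" "u \<notin> A"
    show "two_arms s (3 * n) u (insert u A) = two_arms s (3 * n) u A"
      unfolding two_arms_def by (simp only: barm_insert barm_compl_insert)
    show "F (insert u A) = F A" if "\<not> two_arms s (3 * n) u A"
      unfolding F_def ins[OF u(1)]
      using touching_insert[OF _ u(2) _ Ms[OF u(1)] u(3) that] u(1) MW n by auto
  next
    fix u w A assume h: "u \<in> ?M" "w \<in> ?M" "u \<noteq> w" "A \<subseteq> ?W" "u \<notin> A" "w \<notin> A"
    show "(of_bool (two_arms s (3 * n) u (insert w A)) - of_bool (two_arms s (3 * n) u A)) *
      (of_bool (two_arms s (3 * n) w (insert u A)) - of_bool (two_arms s (3 * n) w A)) \<le> (0::real)"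
      by (rule two_arms_sign) (use h Ms in auto)
  qed
  have piv: "pr b (?W - {u}) (pivotal s (3 * n) u) \<le> pexp b (?W - {u}) (\<lambda>A. F (insert u A) - F A)" if u: "u \<in> ?M" for u
    unfolding pr_def
  proof (rule pexp_mono[OF b'])
    fix A assume A: "A \<subseteq> ?W - {u}"
    have fin: "finite (insert u A)" using finite_subset[OF A] by simp
    have "?N (insert u A) \<le> ?N A" by (rule touching_mono[OF fin]) (use Ms[OF u] in auto)
    then show "of_bool (pivotal s (3 * n) u A) \<le> F (insert u A) - F A"
      unfolding F_def ins[OF u] pivotal_def by (auto simp: of_bool_def)
  qed
  have "pexp b ?W (\<lambda>A. (F A)\<^sup>2) \<le> pexp b ?W (\<lambda>A. (real (ncross s (sphere (n + 1)) (sphere (3 * n)) (A - ?M)))\<^sup>2)"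
  proof (rule pexp_mono[OF b'])
    fix A assume A: "A \<subseteq> ?W"
    have fin: "finite A" using finite_subset[OF A] by simp
    have "?N A \<le> ?N (A - ?M)" by (rule touching_mono[OF fin]) (use Ms in auto)
    then have "0 \<le> F A" unfolding F_def by simp
    moreover have "F A \<le> real (ncross s (sphere (n + 1)) (sphere (3 * n)) (A - ?M))"
      using touching_inner[OF A n, of s] unfolding F_def by simp
    ultimately show "(F A)\<^sup>2 \<le> (real (ncross s (sphere (n + 1)) (sphere (3 * n)) (A - ?M)))\<^sup>2"
      by (intro power_mono)
  qed
  also have "\<dots> = pexp b (?W - ?M) (\<lambda>A. (real (ncross s (sphere (n + 1)) (sphere (3 * n)) (A - ?M)))\<^sup>2)"
  proof (rule pexp_subset)
    fix A assume "A \<subseteq> ?W"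
    then have "A \<inter> (?W - ?M) - ?M = A - ?M" by blast
    then show "(real (ncross s (sphere (n + 1)) (sphere (3 * n)) (A - ?M)))\<^sup>2 =
      (real (ncross s (sphere (n + 1)) (sphere (3 * n)) (A \<inter> (?W - ?M) - ?M)))\<^sup>2" by simp
  qed auto
  also have "\<dots> = pexp b (?W - ?M) (\<lambda>A. (real (ncross s (sphere (n + 1)) (sphere (3 * n)) A))\<^sup>2)"
  proof (rule pexp_cong)
    fix A assume "A \<subseteq> ?W - ?M"
    then have "A - ?M = A" by blast
    then show "(real (ncross s (sphere (n + 1)) (sphere (3 * n)) (A - ?M)))\<^sup>2 =
      (real (ncross s (sphere (n + 1)) (sphere (3 * n)) A))\<^sup>2" by simp
  qed
  also have "\<dots> \<le> 2 / (1 - q)\<^sup>2" by (rule ncross_second_moment[OF b' _ q]) simp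
  finally have F2: "pexp b ?W (\<lambda>A. (F A)\<^sup>2) \<le> 2 / (1 - q)\<^sup>2" .
  have "b * (1 - b) * (\<Sum>u\<in>?M. pr b (?W - {u}) (pivotal s (3 * n) u)) \<le>
    b * (1 - b) * (\<Sum>u\<in>?M. pexp b (?W - {u}) (\<lambda>A. F (insert u A) - F A))"
    by (intro mult_left_mono sum_mono piv) (use b in auto)
  also have "\<dots> \<le> sqrt (pexp b ?W (\<lambda>A. (F A)\<^sup>2)) * sqrt (b * (1 - b) * (\<Sum>u\<in>?M. pr b ?W (two_arms s (3 * n) u)))"
    by (rule infl)
  also have "\<dots> \<le> sqrt (2 / (1 - q)\<^sup>2) * sqrt (b * (1 - b) * (\<Sum>u\<in>?M. pr b ?W (two_arms s (3 * n) u)))"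
    by (intro mult_right_mono real_sqrt_le_mono F2 real_sqrt_ge_zero mult_nonneg_nonneg sum_nonneg pr_nonneg b')
      (use b in auto)
  finally show ?thesis .
qed

subsection \<open>Arm events around a vertex\<close>

definition arms2 :: "bool \<Rightarrow> int \<Rightarrow> vertex set \<Rightarrow> bool" where
  "arms2 s m A \<longleftrightarrow> (\<exists>x1 x2 e1 e2. norm_inf x1 = 1 \<and> norm_inf x2 = 1 \<and> norm_inf e1 = m \<and> norm_inf e2 = m \<and>
     conn s (A \<inter> (box m - {0})) x1 e1 \<and> conn (\<not> s) (box m - {0} - A) x2 e2)"

text \<open>Both interlacing conditions are recorded because \<open>interl_meet\<close> wants the
  pair joined by ordinary adjacency first, and which pair that is depends on
  \<open>s\<close>.\<close>

definition arms4 :: "bool \<Rightarrow> int \<Rightarrow> vertex set \<Rightarrow> bool" where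
  "arms4 s m A \<longleftrightarrow> (\<exists>x1 x2 x3 x4 e1 e2 e3 e4. norm_inf x1 = 1 \<and> norm_inf x2 = 1 \<and> norm_inf x3 = 1 \<and> norm_inf x4 = 1 \<and>
     norm_inf e1 = m \<and> norm_inf e2 = m \<and> norm_inf e3 = m \<and> norm_inf e4 = m \<and>
     conn s (A \<inter> (box m - {0})) x1 e1 \<and> conn s (A \<inter> (box m - {0})) x3 e3 \<and>
     conn (\<not> s) (box m - {0} - A) x2 e2 \<and> conn (\<not> s) (box m - {0} - A) x4 e4 \<and>
     interl (- m) m (- m) m e1 e3 e2 e4 \<and> interl (- m) m (- m) m e2 e4 e1 e3)"

lemma shift_inv [simp]: "shift (- v) (shift v w) = w" "shift v (shift (- v) w) = w"
  by (simp_all add: prod_eq_iff)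

lemma shift_image_iff: "w \<in> shift v ` X \<longleftrightarrow> shift (- v) w \<in> X"
proof
  assume "shift (- v) w \<in> X"
  then have "shift v (shift (- v) w) \<in> shift v ` X" by (rule imageI)
  then show "w \<in> shift v ` X" by simp
qed auto

lemma conn_truncate:
  assumes c: "conn s X x y" and xy: "norm_inf x \<le> k" "k \<le> norm_inf y"
  obtains e where "norm_inf e = k" "conn s (X \<inter> box k) x e"
proof -
  let ?Y = "{z. k \<le> norm_inf z}"
  have yY: "y \<in> ?Y" using xy by simp
  obtain z where z: "z \<in> ?Y" "z \<in> X" "x = z \<or> (\<exists>u. conn s (X - ?Y) x u \<and> gadj s u z)"
    using conn_first[OF c yY] by blast
  from z(3) show ?thesis
  proof
    assume e: "x = z"
    then have "norm_inf x = k" using z xy by simp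
    moreover have "conn s (X \<inter> box k) x x" using e z(2) xy by (intro conn_refl) (simp add: in_box)
    ultimately show ?thesis using that by blast
  next
    assume "\<exists>u. conn s (X - ?Y) x u \<and> gadj s u z"
    then obtain u where u: "conn s (X - ?Y) x u" "gadj s u z" by blast
    have "norm_inf u < k" using conn_in(2)[OF u(1)] by auto
    then have nz: "norm_inf z = k" using norm_step[OF u(2)] z(1) by auto
    have "conn s (X \<inter> box k) x u" by (rule conn_mono[OF u(1)]) (auto simp: in_box)
    from conn_extend[OF this _ u(2)] have "conn s (X \<inter> box k) x z" using z(2) nz by (auto simp: in_box)
    then show ?thesis using that nz by blast
  qed
qed

text \<open>Seen from a vertex of \<open>box n\<close>, the sphere of radius \<open>3 * n\<close> is
  at distance at least \<open>2 * n\<close>, so the translated arm can be cut there.\<close>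

lemma barm_arm:
  assumes n: "1 \<le> n" and u: "u \<in> box n" and h: "barm s (3 * n) u A"
  obtains x e where "norm_inf x = 1" "norm_inf e = 2 * n" "conn s (shift (- u) ` A \<inter> (box (2 * n) - {0})) x e"
proof -
  obtain v y where vy: "gadj s u v" "y \<in> sphere (3 * n)" "conn s (A \<inter> box (3 * n) - {u}) v y"
    using h unfolding barm_def by blast
  let ?T = "shift (- u)"
  have c: "conn s (?T ` (A \<inter> box (3 * n) - {u})) (?T v) (?T y)"
    by (simp add: conn_iso[OF inj_shift gadj_shift] vy(3))
  have nv: "norm_inf (?T v) = 1" using vy(1) by (auto simp: gadj_iff norm_inf_def split: if_splits)
  have ny: "2 * n \<le> norm_inf (?T y)" using vy(2) u by (auto simp: sphere_def in_box norm_inf_def)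
  obtain e where e: "norm_inf e = 2 * n" "conn s (?T ` (A \<inter> box (3 * n) - {u}) \<inter> box (2 * n)) (?T v) e"
    by (rule conn_truncate[OF c, of "2 * n"]) (use nv ny n in auto)
  have "conn s (?T ` A \<inter> (box (2 * n) - {0})) (?T v) e"
  proof (rule conn_mono[OF e(2)])
    have "0 \<notin> ?T ` (A \<inter> box (3 * n) - {u})"
    proof
      assume "0 \<in> ?T ` (A \<inter> box (3 * n) - {u})"
      then have "shift u 0 \<in> A \<inter> box (3 * n) - {u}" using shift_image_iff[of 0 "- u"] by simp
      then show False by (simp add: shift_def)
    qed
    then show "?T ` (A \<inter> box (3 * n) - {u}) \<inter> box (2 * n) \<subseteq> ?T ` A \<inter> (box (2 * n) - {0})" by blast
  qed
  then show ?thesis using that nv e(1) by blast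
qed

lemma two_arms_arms2:
  assumes n: "1 \<le> n" and u: "u \<in> box n" and h: "two_arms s (3 * n) u A"
  shows "arms2 s (2 * n) (shift (- u) ` A)"
proof -
  let ?T = "shift (- u)"
  have "w \<in> ?T ` (- A) \<longleftrightarrow> w \<in> - (?T ` A)" for w
    using shift_image_iff[of w "- u" "- A"] shift_image_iff[of w "- u" A] by simp
  then have "?T ` (- A) = - (?T ` A)" by blast
  then have e: "?T ` (- A) \<inter> (box (2 * n) - {0}) = box (2 * n) - {0} - ?T ` A" by blast
  obtain x1 e1 where 1: "norm_inf x1 = 1" "norm_inf e1 = 2 * n" "conn s (?T ` A \<inter> (box (2 * n) - {0})) x1 e1"
    using barm_arm[OF n u] h unfolding two_arms_def by blast
  obtain x2 e2 where 2: "norm_inf x2 = 1" "norm_inf e2 = 2 * n" "conn (\<not> s) (?T ` (- A) \<inter> (box (2 * n) - {0})) x2 e2"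
    using barm_arm[OF n u] h unfolding two_arms_def by blast
  show ?thesis unfolding arms2_def using 1 2 unfolding e by blast
qed

lemma arms2_local: "arms2 s m (A \<inter> box m) = arms2 s m A"
proof -
  have "A \<inter> box m \<inter> (box m - {0}) = A \<inter> (box m - {0})" "box m - {0} - A \<inter> box m = box m - {0} - A" by auto
  then show ?thesis unfolding arms2_def by simp
qed

lemma arms4_local: "arms4 s m (A \<inter> box m) = arms4 s m A"
proof -
  have "A \<inter> box m \<inter> (box m - {0}) = A \<inter> (box m - {0})" "box m - {0} - A \<inter> box m = box m - {0} - A" by auto
  then show ?thesis unfolding arms4_def by simp
qed

lemma pr_shift:
  assumes W: "finite W" "shift u ` box m \<subseteq> W" and P: "\<And>A. P (A \<inter> box m) = P A"
  shows "pr b W (\<lambda>A. P (shift (- u) ` A)) = pr b (box m) P"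
proof -
  have im: "shift (- u) ` (A \<inter> shift u ` box m) = shift (- u) ` A \<inter> box m" for A
  proof -
    have "shift (- u) ` shift u ` box m = box m" by (simp add: image_image)
    then show ?thesis using image_Int[OF inj_shift, of "- u" A "shift u ` box m"] by simp
  qed
  have "pr b W (\<lambda>A. P (shift (- u) ` A)) = pr b (shift u ` box m) (\<lambda>A. P (shift (- u) ` A))"
  proof (rule pr_subset[OF W])
    fix A
    show "P (shift (- u) ` A) = P (shift (- u) ` (A \<inter> shift u ` box m))" unfolding im P ..
  qed
  also have "\<dots> = pr b (box m) (\<lambda>A. P (shift (- u) ` shift u ` A))"
    by (rule pr_image) (rule inj_on_subset[OF inj_shift], simp)
  also have "\<dots> = pr b (box m) P" by (simp add: image_image)
  finally show ?thesis .
qed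

lemma two_arms_prob:
  assumes n: "1 \<le> n" and u: "u \<in> box n" and b: "0 \<le> b" "b \<le> 1"
  shows "pr b (box (3 * n)) (two_arms s (3 * n) u) \<le> pr b (box (2 * n)) (arms2 s (2 * n))"
proof -
  have "pr b (box (3 * n)) (two_arms s (3 * n) u) \<le> pr b (box (3 * n)) (\<lambda>A. arms2 s (2 * n) (shift (- u) ` A))"
    by (rule pr_mono[OF b]) (rule two_arms_arms2[OF n u])
  also have "\<dots> = pr b (box (2 * n)) (arms2 s (2 * n))"
  proof (rule pr_shift)
    show "shift u ` box (2 * n) \<subseteq> box (3 * n)" using u by (auto simp: in_box norm_inf_def)
  qed (simp_all add: arms2_local)
  finally show ?thesis .
qed

lemma box1_conn:
  assumes "z \<in> box 1" "z' \<in> box 1"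
  shows "conn s (box 1) z z'"
proof -
  have "conn s (box 1) (0, 0) z" if z: "z \<in> box 1" for z
  proof -
    have r: "\<bar>fst z\<bar> \<le> 1" "\<bar>snd z\<bar> \<le> 1" using z by (auto simp: in_box norm_inf_def)
    let ?k = "(fst z, 0)"
    have m: "(0, 0) \<in> box 1" "?k \<in> box 1" using r by (auto simp: in_box norm_inf_def)
    have "conn s (box 1) (0, 0) ?k"
    proof (cases "fst z = 0")
      case True then show ?thesis using m by (auto intro: conn_refl)
    next
      case False
      then have "gadj False (0, 0) ?k" using r by (auto simp: gadj_iff)
      then show ?thesis using m by (intro conn_step) (auto intro: gadj_False_imp)
    qed
    moreover have "conn s (box 1) ?k z"
    proof (cases "snd z = 0")
      case True then have "?k = z" by (simp add: prod_eq_iff)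
      then show ?thesis using m by (auto intro: conn_refl)
    next
      case False
      then have "gadj False ?k z" using r by (auto simp: gadj_iff)
      then show ?thesis using m z by (intro conn_step) (auto intro: gadj_False_imp)
    qed
    ultimately show ?thesis by (rule conn_trans)
  qed
  from conn_trans[OF conn_sym[OF this[OF assms(1)]] this[OF assms(2)]] show ?thesis .
qed

text \<open>In the situation of the four arm event, two black arms are in distinct clusters when the unit box
  is white, and in the same cluster when it is black.\<close>

lemma arms4_separates:
  assumes m: "2 \<le> m" and h: "arms4 s m A"
    and L: "L \<subseteq> box m" "Q \<subseteq> L" "\<And>p q. p \<in> L - Q \<Longrightarrow> gadj s p q \<Longrightarrow> q \<in> L" "box 1 \<subseteq> L - Q" "\<And>e. norm_inf e = m \<Longrightarrow> e \<notin> L - Q"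
  obtains y1 y3 where "y1 \<in> Q" "y3 \<in> Q" "y1 \<in> A \<inter> L - box 1" "y3 \<in> A \<inter> L - box 1"
    "conn s (A \<inter> L \<union> box 1) y1 y3" "\<not> conn s (A \<inter> L - box 1) y1 y3"
proof -
  let ?B = "box m - {0}"
  obtain x1 x2 x3 x4 e1 e2 e3 e4 where
    nx: "norm_inf x1 = 1" "norm_inf x2 = 1" "norm_inf x3 = 1" "norm_inf x4 = 1" and
    ne: "norm_inf e1 = m" "norm_inf e2 = m" "norm_inf e3 = m" "norm_inf e4 = m" and
    c1: "conn s (A \<inter> ?B) x1 e1" and c3: "conn s (A \<inter> ?B) x3 e3" and
    c2: "conn (\<not> s) (?B - A) x2 e2" and c4: "conn (\<not> s) (?B - A) x4 e4" and
    il: "interl (- m) m (- m) m e1 e3 e2 e4" "interl (- m) m (- m) m e2 e4 e1 e3"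
    using h unfolding arms4_def by blast
  \<comment> \<open>The arm is cut at its last visit to the unit box and then at its next visit to
    the boundary \<open>Q\<close> of \<open>L\<close>; the connection from there to the far end
    \<open>e\<close> also avoids the unit box.\<close>
  have arm: "\<exists>y z u. y \<in> Q \<and> z \<in> box 1 \<and> gadj s u z \<and> conn s (A \<inter> L - box 1) u y \<and> conn s (A \<inter> box m - box 1) y e"
    if x: "norm_inf x = 1" "norm_inf e = m" and c: "conn s (A \<inter> ?B) x e" for x e
  proof -
    have xb: "x \<in> box 1" using x by (simp add: in_box)
    obtain z where z: "z \<in> box 1" "e = z \<or> (\<exists>u. conn s (A \<inter> ?B - box 1) e u \<and> gadj s u z)"
      using conn_first[OF conn_sym[OF c] xb] by blast
    have "e \<noteq> z" using z(1) x(2) m by (auto simp: in_box)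
    then obtain u where u: "conn s (A \<inter> ?B - box 1) e u" "gadj s u z" using z(2) by blast
    have "u \<in> L" using L(3)[of z u] L(4) z(1) u(2) gadj_sym by blast
    have ue: "conn s (A \<inter> box m - box 1) u e" by (rule conn_mono[OF conn_sym[OF u(1)]]) auto
    have eY: "e \<in> - (L - Q)" using L(5) x(2) by blast
    obtain y where y: "y \<in> - (L - Q)" "y \<in> A \<inter> box m - box 1"
      "u = y \<or> (\<exists>w. conn s (A \<inter> box m - box 1 - - (L - Q)) u w \<and> gadj s w y)"
      using conn_first[OF ue eY] by blast
    have "y \<in> Q \<and> conn s (A \<inter> L - box 1) u y"
      using y(3)
    proof
      assume "u = y"
      then have "y \<in> Q" "y \<in> A \<inter> L - box 1" using y(1,2) \<open>u \<in> L\<close> by auto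
      then show ?thesis using \<open>u = y\<close> by (auto intro: conn_refl)
    next
      assume "\<exists>w. conn s (A \<inter> box m - box 1 - - (L - Q)) u w \<and> gadj s w y"
      then obtain w where w: "conn s (A \<inter> box m - box 1 - - (L - Q)) u w" "gadj s w y" by blast
      have "y \<in> L" using L(3)[OF _ w(2)] conn_in(2)[OF w(1)] by blast
      have "conn s (A \<inter> L - box 1) u w" by (rule conn_mono[OF w(1)]) blast
      from conn_extend[OF this _ w(2)] show ?thesis using y(1,2) \<open>y \<in> L\<close> by blast
    qed
    moreover from this have "conn s (A \<inter> box m - box 1) u y"
      using L(1) by (auto elim!: conn_mono)
    then have "conn s (A \<inter> box m - box 1) y e" using conn_trans[OF conn_sym ue] by blast
    ultimately show ?thesis using z(1) u(2) by blast
  qed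
  obtain y1 z1 u1 where 1: "y1 \<in> Q" "z1 \<in> box 1" "gadj s u1 z1" "conn s (A \<inter> L - box 1) u1 y1"
    "conn s (A \<inter> box m - box 1) y1 e1" using arm[OF nx(1) ne(1) c1] by blast
  obtain y3 z3 u3 where 3: "y3 \<in> Q" "z3 \<in> box 1" "gadj s u3 z3" "conn s (A \<inter> L - box 1) u3 y3"
    "conn s (A \<inter> box m - box 1) y3 e3" using arm[OF nx(3) ne(3) c3] by blast
  have join: "conn s (A \<inter> L \<union> box 1) y z" if "z \<in> box 1" "gadj s u z" "conn s (A \<inter> L - box 1) u y" for y z u
  proof -
    have "conn s (A \<inter> L \<union> box 1) y u" by (rule conn_mono[OF conn_sym[OF that(3)]]) blast
    from conn_extend[OF this _ that(2)] show ?thesis using that(1) by blast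
  qed
  have zz: "conn s (A \<inter> L \<union> box 1) z1 z3" by (rule conn_mono[OF box1_conn[OF 1(2) 3(2)]]) blast
  have yes: "conn s (A \<inter> L \<union> box 1) y1 y3"
    by (rule conn_trans[OF conn_trans[OF join[OF 1(2-4)] zz] conn_sym[OF join[OF 3(2-4)]]])
  have no: "\<not> conn s (A \<inter> L - box 1) y1 y3"
  proof
    assume "conn s (A \<inter> L - box 1) y1 y3"
    then have "conn s (A \<inter> box m - box 1) y1 y3" by (rule conn_mono) (use L(1) in blast)
    then have X: "conn s (A \<inter> box m - box 1) e1 e3"
      using conn_trans[OF conn_trans[OF conn_sym[OF 1(5)]] 3(5)] by blast
    \<comment> \<open>Adding the unit box to the white set joins the two white arms, so a black
      connection outside that box would have to meet it.\<close>
    let ?Y = "(?B - A) \<union> box 1"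
    have xb: "x2 \<in> box 1" "x4 \<in> box 1" using nx by (simp_all add: in_box)
    have "conn (\<not> s) ?Y x2 e2" "conn (\<not> s) ?Y x4 e4" "conn (\<not> s) ?Y x2 x4"
      by (rule conn_mono[OF c2], blast, rule conn_mono[OF c4], blast, rule conn_mono[OF box1_conn[OF xb]], blast)
    then have Y: "conn (\<not> s) ?Y e2 e4" using conn_trans[OF conn_trans[OF conn_sym]] by blast
    have m1: "box 1 \<subseteq> box m" using m by (auto simp: in_box)
    have sub: "A \<inter> box m - box 1 \<subseteq> rect (- m) m (- m) m" "?Y \<subseteq> rect (- m) m (- m) m"
      using m1 unfolding box_def by auto
    have bd: "e \<in> bdry (- m) m (- m) m" if "norm_inf e = m" for e
      using that sphere_bdry[of m] m unfolding sphere_def by auto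
    have "(A \<inter> box m - box 1) \<inter> ?Y \<noteq> {}"
    proof (cases s)
      case False
      show ?thesis by (rule interl_meet[OF _ sub(1) _ sub(2) bd bd bd bd il(1)]) (use X Y False ne in auto)
    next
      case True
      have "?Y \<inter> (A \<inter> box m - box 1) \<noteq> {}"
        by (rule interl_meet[OF _ sub(2) _ sub(1) bd bd bd bd il(2)]) (use X Y True ne in auto)
      then show ?thesis by blast
    qed
    then show False by blast
  qed
  show ?thesis using that[OF 1(1) 3(1) conn_in(2)[OF 1(4)] conn_in(2)[OF 3(4)] yes no] .
qed

text \<open>When the elements of \<open>B\<close> are added one at a time, some addition must lower
  \<open>N\<close>.\<close>

lemma interpolate:
  fixes N :: "'a set \<Rightarrow> nat"
  assumes "finite B" "N (A \<union> B) < N A"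
  shows "\<exists>u\<in>B. \<exists>Q\<in>Pow (B - {u}). N (insert u (A \<union> Q)) < N (A \<union> Q)"
  using assms
proof (induction B rule: finite_induct)
  case (insert x B)
  show ?case
  proof (cases "N (insert x (A \<union> B)) < N (A \<union> B)")
    case True
    then show ?thesis using insert(2) by (intro bexI[of _ x] bexI[of _ B]) auto
  next
    case False
    then have "N (A \<union> B) < N A" using insert by simp
    then obtain u Q where h: "u \<in> B" "Q \<in> Pow (B - {u})" "N (insert u (A \<union> Q)) < N (A \<union> Q)" using insert by blast
    then show ?thesis by (intro bexI[of _ u] bexI[of _ Q]) auto
  qed
qed simp

lemma pr_Bex_le:
  assumes "0 \<le> b" "b \<le> 1" "finite I"
  shows "pr b W (\<lambda>A. \<exists>i\<in>I. P i A) \<le> (\<Sum>i\<in>I. pr b W (P i))"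
  unfolding pr_def pexp_sum[symmetric]
proof (rule pexp_mono[OF assms(1,2)])
  fix A
  show "of_bool (\<exists>i\<in>I. P i A) \<le> (\<Sum>i\<in>I. of_bool (P i A) :: real)"
  proof (cases "\<exists>i\<in>I. P i A")
    case True
    then obtain i where i: "i \<in> I" "P i A" by blast
    have "(of_bool (P i A) :: real) \<le> (\<Sum>i\<in>I. of_bool (P i A))"
      by (rule member_le_sum) (use i assms in auto)
    then show ?thesis using True i by simp
  qed (simp add: sum_nonneg)
qed

text \<open>Arms start at sup-distance 1 from \<open>v\<close> and need not be adjacent to
  \<open>v\<close>, so changing the colour of \<open>v\<close> may not join them. Recolouring the
  whole unit box does, and \<open>interpolate\<close> finds the responsible vertex \<open>u\<close>,
  with a pattern \<open>Q\<close> on the rest of the box.\<close>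

lemma four_arms_pivotal:
  assumes n: "1 \<le> n" and m: "4 * n \<le> m" and v: "v \<in> box (n - 1)" and h: "arms4 s m (shift (- v) ` A)"
  shows "\<exists>u\<in>shift v ` box 1. \<exists>Q\<in>Pow (shift v ` box 1 - {u}). pivotal s (3 * n) u (A \<inter> (box (3 * n) - shift v ` box 1) \<union> Q)"
proof -
  let ?T = "shift (- v)" and ?B = "shift v ` box 1"
  let ?L = "?T ` box (3 * n)" and ?Q = "?T ` sphere (3 * n)"
  have iff: "w \<in> ?T ` X \<longleftrightarrow> shift v w \<in> X" for w X using shift_image_iff[of w "- v" X] by simp
  have vb: "\<bar>fst v\<bar> \<le> n - 1" "\<bar>snd v\<bar> \<le> n - 1" using v by (auto simp: in_box norm_inf_def)
  have B1: "?B \<subseteq> box n" using vb by (auto simp: in_box norm_inf_def)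
  obtain y1 y3 where y: "y1 \<in> ?Q" "y3 \<in> ?Q" "y1 \<in> ?T ` A \<inter> ?L - box 1" "y3 \<in> ?T ` A \<inter> ?L - box 1"
    "conn s (?T ` A \<inter> ?L \<union> box 1) y1 y3" "\<not> conn s (?T ` A \<inter> ?L - box 1) y1 y3"
  proof (rule arms4_separates[OF _ h, of ?L ?Q])
    show "2 \<le> m" using n m by simp
    show "?L \<subseteq> box m" using vb m n by (auto simp: in_box norm_inf_def)
    show "?Q \<subseteq> ?L" by (auto simp: in_box sphere_def)
    show "q \<in> ?L" if "p \<in> ?L - ?Q" "gadj s p q" for p q
    proof -
      have "norm_inf (shift v p) < 3 * n" using that(1) by (auto simp: iff in_box sphere_def)
      moreover have "gadj s (shift v p) (shift v q)" using that(2) by (simp add: gadj_shift)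
      ultimately show ?thesis using norm_step[of s "shift v p" "shift v q"] by (simp add: iff in_box)
    qed
    show "box 1 \<subseteq> ?L - ?Q"
    proof
      fix w assume "w \<in> box 1"
      then have "shift v w \<in> box n" using B1 by blast
      then show "w \<in> ?L - ?Q" using n by (auto simp: iff in_box sphere_def)
    qed
    show "e \<notin> ?L - ?Q" if "norm_inf e = m" for e
    proof
      assume "e \<in> ?L - ?Q"
      then have "norm_inf (shift v e) < 3 * n" by (auto simp: iff in_box sphere_def)
      then show False using that vb m by (auto simp: norm_inf_def max_def split: if_splits)
    qed
  qed blast
  let ?A0 = "A \<inter> (box (3 * n) - ?B)"
  have sh: "shift v ` (?T ` X) = X" for X by (simp add: image_image)
  have im1: "shift v ` (?T ` A \<inter> ?L - box 1) = ?A0"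
    using image_set_diff[OF inj_shift[of v], of "?T ` A \<inter> ?L" "box 1"] image_Int[OF inj_shift[of v], of "?T ` A" ?L]
    unfolding sh by blast
  have im2: "shift v ` (?T ` A \<inter> ?L \<union> box 1) = ?A0 \<union> ?B"
    using image_Un[of "shift v" "?T ` A \<inter> ?L" "box 1"] image_Int[OF inj_shift[of v], of "?T ` A" ?L]
    unfolding sh by blast
  have "touching s (3 * n) (?A0 \<union> ?B) < touching s (3 * n) ?A0"
  proof (rule touching_less)
    have BW: "?A0 \<union> ?B \<subseteq> box (3 * n)" using B1 n by (auto simp: in_box)
    show "finite (?A0 \<union> ?B)" by (rule finite_subset[OF BW]) simp
    show "sphere (3 * n) \<inter> ?A0 = sphere (3 * n) \<inter> (?A0 \<union> ?B)" using B1 n by (auto simp: sphere_def in_box)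
    show "shift v y1 \<in> sphere (3 * n)" "shift v y3 \<in> sphere (3 * n)" using y(1,2) by (simp_all add: iff)
    show "shift v y1 \<in> ?A0" "shift v y3 \<in> ?A0" using y(3,4) im1 by blast+
    show "conn s (?A0 \<union> ?B) (shift v y1) (shift v y3)"
      unfolding im2[symmetric] conn_iso[OF inj_shift gadj_shift] by (rule y(5))
    show "\<not> conn s ?A0 (shift v y1) (shift v y3)"
      unfolding im1[symmetric] conn_iso[OF inj_shift gadj_shift] by (rule y(6))
  qed auto
  from interpolate[OF _ this] show ?thesis unfolding pivotal_def by simp
qed

text \<open>Finite energy: the prescribed pattern on \<open>B - {u}\<close> is independent of the
  outside and has probability at least \<open>min b (1 - b) ^ 9\<close>.\<close>

lemma pivotal_pattern:
  assumes b: "0 < b" "b < 1" and W: "finite W" "u \<in> B" "B \<subseteq> W" "Q \<subseteq> B - {u}" "card B \<le> 9"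
  shows "min b (1 - b) ^ 9 * pr b (W - B) (\<lambda>A. P (A \<union> Q)) \<le> pr b (W - {u}) P"
proof -
  let ?d = "min b (1 - b)"
  have b': "0 \<le> b" "b \<le> 1" using b by auto
  have fB: "finite B" using W finite_subset by auto
  have d: "0 \<le> ?d" "?d \<le> 1" "?d \<le> b" "?d \<le> 1 - b" using b by auto
  have W': "W - {u} = (W - B) \<union> (B - {u})" using W by auto
  let ?w = "b ^ card Q * (1 - b) ^ card (B - {u} - Q)"
  have fQ: "finite Q" using W fB finite_subset by blast
  have "card Q + card (B - {u} - Q) = card (B - {u})"
    using W(4) fB by (simp add: card_Diff_subset fQ card_mono)
  also have "\<dots> \<le> 9" using W(5) card_mono[of B "B - {u}"] fB by auto
  finally have k: "card Q + card (B - {u} - Q) \<le> 9" .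
  have "?d ^ 9 \<le> ?d ^ (card Q + card (B - {u} - Q))" by (rule power_decreasing[OF k d(1,2)])
  also have "\<dots> \<le> ?w" unfolding power_add by (intro mult_mono power_mono) (use d b in auto)
  finally have w: "?d ^ 9 \<le> ?w" .
  have "?d ^ 9 * pr b (W - B) (\<lambda>A. P (A \<union> Q)) \<le> ?w * pr b (W - B) (\<lambda>A. P (A \<union> Q))"
    by (intro mult_right_mono w pr_nonneg b')
  also have "\<dots> = pexp b (W - B) (\<lambda>A. ?w * of_bool (P (A \<union> Q)))" unfolding pr_def pexp_cmult ..
  also have "\<dots> \<le> pexp b (W - B) (\<lambda>A. pexp b (B - {u}) (\<lambda>C. of_bool (P (A \<union> C))))"
  proof (rule pexp_mono[OF b'])
    fix A
    have "(\<lambda>C. b ^ card C * (1 - b) ^ card (B - {u} - C) * of_bool (P (A \<union> C))) Q \<le>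
      (\<Sum>C\<in>Pow (B - {u}). b ^ card C * (1 - b) ^ card (B - {u} - C) * of_bool (P (A \<union> C)))"
      by (rule member_le_sum) (use W fB b in auto)
    then show "?w * of_bool (P (A \<union> Q)) \<le> pexp b (B - {u}) (\<lambda>C. of_bool (P (A \<union> C)))"
      unfolding pexp_def by simp
  qed
  also have "\<dots> = pr b (W - {u}) P"
    unfolding pr_def W' by (rule pexp_Un[symmetric]) (use W fB in auto)
  finally show ?thesis .
qed

lemma card_box: "0 \<le> n \<Longrightarrow> real (card (box n)) = (2 * real_of_int n + 1)\<^sup>2"
  unfolding box_def rect_def by (simp add: card_cartesian_product power2_eq_square)

text \<open>Union bound over the vertices of a unit box and the 256 patterns on the remaining eight,
  with 512 as a generous bound. In the sum over \<open>v\<close> a vertex \<open>u\<close> occurs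
  once for each displacement \<open>d\<close> in the unit box, which gives the factor 9.\<close>

lemma four_arms_sum:
  assumes n: "1 \<le> n" and m: "4 * n \<le> m" and b: "0 < b" "b < 1"
  shows "min b (1 - b) ^ 9 * (real (card (box (n - 1))) * pr b (box m) (arms4 s m)) \<le>
    9 * 512 * (\<Sum>u\<in>box n. pr b (box (3 * n) - {u}) (pivotal s (3 * n) u))"
proof -
  let ?d = "min b (1 - b) ^ 9"
  let ?I = "\<lambda>u. pr b (box (3 * n) - {u}) (pivotal s (3 * n) u)"
  have b': "0 \<le> b" "b \<le> 1" using b by auto
  have c9: "card (shift v ` box 1) = 9" for v
  proof -
    have "card (shift v ` box 1) = card (box 1)" by (rule card_image) (rule inj_on_subset[OF inj_shift], simp)
    then show ?thesis by (simp add: box_def rect_def card_cartesian_product)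
  qed
  have one: "?d * pr b (box m) (arms4 s m) \<le> (\<Sum>d\<in>box 1. 512 * ?I (shift v d))" if v: "v \<in> box (n - 1)" for v
  proof -
    let ?B = "shift v ` box 1" and ?W = "box (3 * n)"
    have vb: "\<bar>fst v\<bar> \<le> n - 1" "\<bar>snd v\<bar> \<le> n - 1" using v by (auto simp: in_box norm_inf_def)
    have B1: "?B \<subseteq> ?W" using vb n by (auto simp: in_box norm_inf_def)
    have Wm: "?W \<subseteq> shift v ` box m"
      using vb m n by (auto simp: shift_image_iff in_box norm_inf_def)
    have fin: "finite (shift v ` box m)" "finite ?B" by simp_all
    have "pr b (box m) (arms4 s m) = pr b (shift v ` box m) (\<lambda>A. arms4 s m (shift (- v) ` A))"
      by (rule pr_shift[symmetric]) (simp_all add: arms4_local)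
    also have "\<dots> \<le> pr b (shift v ` box m) (\<lambda>A. \<exists>u\<in>?B. \<exists>Q\<in>Pow (?B - {u}). pivotal s (3 * n) u (A \<inter> (?W - ?B) \<union> Q))"
      by (rule pr_mono[OF b']) (rule four_arms_pivotal[OF n m v])
    also have "\<dots> \<le> (\<Sum>u\<in>?B. pr b (shift v ` box m) (\<lambda>A. \<exists>Q\<in>Pow (?B - {u}). pivotal s (3 * n) u (A \<inter> (?W - ?B) \<union> Q)))"
      by (rule pr_Bex_le[OF b' fin(2)])
    also have "\<dots> \<le> (\<Sum>u\<in>?B. \<Sum>Q\<in>Pow (?B - {u}). pr b (shift v ` box m) (\<lambda>A. pivotal s (3 * n) u (A \<inter> (?W - ?B) \<union> Q)))"
      by (intro sum_mono pr_Bex_le[OF b']) simp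
    also have "\<dots> = (\<Sum>u\<in>?B. \<Sum>Q\<in>Pow (?B - {u}). pr b (?W - ?B) (\<lambda>A. pivotal s (3 * n) u (A \<union> Q)))"
    proof (intro sum.cong refl)
      fix u Q
      have "pr b (shift v ` box m) (\<lambda>A. pivotal s (3 * n) u (A \<inter> (?W - ?B) \<union> Q)) =
        pr b (?W - ?B) (\<lambda>A. pivotal s (3 * n) u (A \<inter> (?W - ?B) \<union> Q))"
        by (rule pr_subset[OF fin(1)]) (use Wm in \<open>auto simp: Int_assoc\<close>)
      also have "\<dots> = pr b (?W - ?B) (\<lambda>A. pivotal s (3 * n) u (A \<union> Q))"
        by (rule pr_cong) (simp add: inf.absorb1)
      finally show "pr b (shift v ` box m) (\<lambda>A. pivotal s (3 * n) u (A \<inter> (?W - ?B) \<union> Q)) =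
        pr b (?W - ?B) (\<lambda>A. pivotal s (3 * n) u (A \<union> Q))" .
    qed
    finally have "?d * pr b (box m) (arms4 s m) \<le>
      ?d * (\<Sum>u\<in>?B. \<Sum>Q\<in>Pow (?B - {u}). pr b (?W - ?B) (\<lambda>A. pivotal s (3 * n) u (A \<union> Q)))"
      by (intro mult_left_mono) (use b in auto)
    also have "\<dots> = (\<Sum>u\<in>?B. \<Sum>Q\<in>Pow (?B - {u}). ?d * pr b (?W - ?B) (\<lambda>A. pivotal s (3 * n) u (A \<union> Q)))"
      by (simp add: sum_distrib_left)
    also have "\<dots> \<le> (\<Sum>u\<in>?B. \<Sum>Q\<in>Pow (?B - {u}). ?I u)"
      by (intro sum_mono pivotal_pattern[OF b]) (use B1 c9 in auto)
    also have "\<dots> = (\<Sum>u\<in>?B. 256 * ?I u)"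
    proof (intro sum.cong refl)
      fix u assume "u \<in> ?B"
      then have "card (Pow (?B - {u})) = 256" using c9[of v] by (simp add: card_Pow)
      then show "(\<Sum>Q\<in>Pow (?B - {u}). ?I u) = 256 * ?I u" by simp
    qed
    also have "\<dots> = (\<Sum>d\<in>box 1. 256 * ?I (shift v d))"
      by (subst sum.reindex) (auto intro: inj_on_subset[OF inj_shift])
    also have "\<dots> \<le> (\<Sum>d\<in>box 1. 512 * ?I (shift v d))"
      by (intro sum_mono mult_right_mono pr_nonneg b') simp
    finally show ?thesis .
  qed
  have "?d * (real (card (box (n - 1))) * pr b (box m) (arms4 s m)) = (\<Sum>v\<in>box (n - 1). ?d * pr b (box m) (arms4 s m))"
    by simp
  also have "\<dots> \<le> (\<Sum>v\<in>box (n - 1). \<Sum>d\<in>box 1. 512 * ?I (shift v d))" by (intro sum_mono one)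
  also have "\<dots> = (\<Sum>d\<in>box 1. \<Sum>v\<in>box (n - 1). 512 * ?I (shift v d))" by (rule sum.swap)
  also have "\<dots> \<le> (\<Sum>d\<in>box 1. \<Sum>u\<in>box n. 512 * ?I u)"
  proof (rule sum_mono)
    fix d assume d: "d \<in> box 1"
    have e: "shift v d = shift d v" for v by (simp add: prod_eq_iff)
    have "(\<Sum>v\<in>box (n - 1). 512 * ?I (shift v d)) = (\<Sum>u\<in>shift d ` box (n - 1). 512 * ?I u)"
      unfolding e by (subst sum.reindex) (auto intro: inj_on_subset[OF inj_shift])
    also have "\<dots> \<le> (\<Sum>u\<in>box n. 512 * ?I u)"
    proof (rule sum_mono2)
      show "shift d ` box (n - 1) \<subseteq> box n" using d by (auto simp: in_box norm_inf_def)
    qed (auto intro: pr_nonneg b')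
    finally show "(\<Sum>v\<in>box (n - 1). 512 * ?I (shift v d)) \<le> (\<Sum>u\<in>box n. 512 * ?I u)" .
  qed
  also have "\<dots> = 9 * 512 * (\<Sum>u\<in>box n. ?I u)"
  proof -
    have "card (box 1) = 9" by (simp add: box_def rect_def card_cartesian_product)
    then show ?thesis by (simp add: sum_distrib_left)
  qed
  finally show ?thesis .
qed

section \<open>The four-arm estimate at a fixed scale\<close>

definition arm_const :: "real \<Rightarrow> real" where
  "arm_const p = (let d = min p (1 - p) in
     9 * 512 * 3 * sqrt 2 / (d ^ 9 * (p * (1 - p)) * rsw_const (d / 2) ^ 4))"

lemma rsw_const_pos: "0 < c \<Longrightarrow> 0 < rsw_const c"
  unfolding rsw_const_def by simp

text \<open>Crossings of the other colour make an annulus crossing of colour \<open>s\<close> fail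
  with probability at least \<open>k\<close>, which gives the factor \<open>sqrt 2 / k\<close>. The
  box has at most \<open>(3 * n)^2\<close> vertices, so the Cauchy-Schwarz bound is of order
  \<open>n\<close> times the root of the two-arm probability, to be compared with \<open>n^2\<close>
  four-arm probabilities.\<close>

lemma arms4_le:
  assumes n: "2 \<le> n" and m: "4 * n \<le> m" and b: "0 < b" "b < 1"
    and w: "min b (1 - b) / 2 \<le> hp (\<not> s) (1 - b) 0 (n - 1) 0 (n - 1)"
      "min b (1 - b) / 2 \<le> hp (\<not> s) (1 - b) 0 (2 * n - 1) 0 (2 * n - 1)"
  shows "pr b (box m) (arms4 s m) \<le> arm_const b / n * sqrt (pr b (box (2 * n)) (arms2 s (2 * n)))"
proof -
  let ?d = "min b (1 - b)" and ?W = "box (3 * n) - box n"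
  let ?S = "\<Sum>u\<in>box n. pr b (box (3 * n) - {u}) (pivotal s (3 * n) u)"
  let ?p4 = "pr b (box m) (arms4 s m)" and ?p2 = "pr b (box (2 * n)) (arms2 s (2 * n))"
  define k where "k = rsw_const (?d / 2) ^ 4"
  have b': "0 \<le> b" "b \<le> 1" using b by auto
  have n1: "1 \<le> n" using n by simp
  have d0: "0 < ?d" using b by simp
  have k0: "0 < k" unfolding k_def by (intro zero_less_power rsw_const_pos half_gt_zero d0)
  have "pr b ?W (\<lambda>A. \<exists>x\<in>sphere (n + 1). \<exists>y\<in>sphere (3 * n). conn s A x y) =
    pr (1 - b) ?W (\<lambda>A. \<exists>x y. norm_inf x = n + 1 \<and> norm_inf y = 3 * n \<and> conn (\<not> \<not> s) (?W - A) x y)"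
    unfolding pr_def by (subst pexp_compl) (simp add: sphere_def Bex_def conj_assoc)
  also have "\<dots> \<le> 1 - k"
    unfolding k_def by (rule annulus_crossing[OF n _ _ _ w]) (use b in auto)
  finally have q: "pr b ?W (\<lambda>A. \<exists>x\<in>sphere (n + 1). \<exists>y\<in>sphere (3 * n). conn s A x y) \<le> 1 - k" .
  have "b * (1 - b) * ?S \<le> sqrt (2 / (1 - (1 - k))\<^sup>2) *
    sqrt (b * (1 - b) * (\<Sum>u\<in>box n. pr b (box (3 * n)) (two_arms s (3 * n) u)))"
    by (rule sum_influence[OF n1 b q]) (use k0 in simp)
  also have "\<dots> \<le> (sqrt 2 / k) * ((3 * n) * sqrt ?p2)"
  proof (intro mult_mono)
    show "sqrt (2 / (1 - (1 - k))\<^sup>2) \<le> sqrt 2 / k" using k0 by (simp add: real_sqrt_divide)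
    have "(\<Sum>u\<in>box n. pr b (box (3 * n)) (two_arms s (3 * n) u)) \<le> (\<Sum>u\<in>box n. ?p2)"
      by (intro sum_mono two_arms_prob[OF n1]) (use b' in auto)
    also have "\<dots> = (2 * real_of_int n + 1)\<^sup>2 * ?p2" using n by (simp add: card_box)
    also have "\<dots> \<le> (3 * real_of_int n)\<^sup>2 * ?p2"
      by (intro mult_right_mono power_mono pr_nonneg b') (use n in auto)
    finally have s: "(\<Sum>u\<in>box n. pr b (box (3 * n)) (two_arms s (3 * n) u)) \<le> (3 * real_of_int n)\<^sup>2 * ?p2" .
    have "b * (1 - b) \<le> 1" using b by (intro mult_le_one) auto
    then have "b * (1 - b) * (\<Sum>u\<in>box n. pr b (box (3 * n)) (two_arms s (3 * n) u)) \<le>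
      1 * (\<Sum>u\<in>box n. pr b (box (3 * n)) (two_arms s (3 * n) u))"
      by (intro mult_right_mono sum_nonneg pr_nonneg b')
    also have "\<dots> \<le> (3 * real_of_int n)\<^sup>2 * ?p2" using s by simp
    finally have "sqrt (b * (1 - b) * (\<Sum>u\<in>box n. pr b (box (3 * n)) (two_arms s (3 * n) u))) \<le> sqrt ((3 * real_of_int n)\<^sup>2 * ?p2)"
      by (rule real_sqrt_le_mono)
    also have "\<dots> = (3 * real_of_int n) * sqrt ?p2" using n by (simp add: real_sqrt_mult)
    finally show "sqrt (b * (1 - b) * (\<Sum>u\<in>box n. pr b (box (3 * n)) (two_arms s (3 * n) u))) \<le> (3 * n) * sqrt ?p2" by simp
  qed (use k0 b in \<open>auto intro!: mult_nonneg_nonneg sum_nonneg pr_nonneg\<close>)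
  finally have S0: "b * (1 - b) * ?S \<le> (sqrt 2 / k) * ((3 * n) * sqrt ?p2)" .
  have bb: "0 < b * (1 - b)" using b by simp
  have S: "?S \<le> (sqrt 2 / k) * ((3 * n) * sqrt ?p2) / (b * (1 - b))"
    unfolding pos_le_divide_eq[OF bb] by (subst mult.commute) (rule S0)
  have "?d ^ 9 * (real_of_int n ^ 2 * ?p4) \<le> ?d ^ 9 * (real (card (box (n - 1))) * ?p4)"
  proof (intro mult_left_mono mult_right_mono pr_nonneg b')
    have "real_of_int n \<le> 2 * real_of_int (n - 1) + 1" using n by simp
    then have "(real_of_int n)\<^sup>2 \<le> (2 * real_of_int (n - 1) + 1)\<^sup>2" using n by (intro power_mono) auto
    then show "(real_of_int n)\<^sup>2 \<le> real (card (box (n - 1)))" using n by (simp add: card_box)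
  qed (use d0 in simp)
  also have "\<dots> \<le> 9 * 512 * ?S" by (rule four_arms_sum[OF n1 m b])
  also have "\<dots> \<le> 9 * 512 * ((sqrt 2 / k) * ((3 * n) * sqrt ?p2) / (b * (1 - b)))"
    using S by (intro mult_left_mono) auto
  finally have f: "?d ^ 9 * (real_of_int n ^ 2 * ?p4) \<le> 9 * 512 * ((sqrt 2 / k) * ((3 * n) * sqrt ?p2) / (b * (1 - b)))" .
  have c: "arm_const b = 9 * 512 * 3 * sqrt 2 / (?d ^ 9 * (b * (1 - b)) * k)"
    unfolding arm_const_def k_def Let_def by simp
  have pos: "0 < ?d ^ 9 * (real_of_int n)\<^sup>2" using d0 n by simp
  have "?p4 = ?d ^ 9 * (real_of_int n ^ 2 * ?p4) / (?d ^ 9 * (real_of_int n)\<^sup>2)"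
  proof -
    have "p4 = D * (N * p4) / (D * N)" if "0 < D * N" for p4 D N :: real using that by auto
    from this[OF pos] show ?thesis .
  qed
  also have "\<dots> \<le> 9 * 512 * ((sqrt 2 / k) * ((3 * n) * sqrt ?p2) / (b * (1 - b))) / (?d ^ 9 * (real_of_int n)\<^sup>2)"
    using pos by (intro divide_right_mono f) simp
  also have "\<dots> = arm_const b / n * sqrt ?p2"
  proof -
    have gen: "9 * 512 * ((sqrt 2 / k) * ((3 * N) * r) / B) / (D * N\<^sup>2) = 9 * 512 * 3 * sqrt 2 / (D * B * k) / N * r"
      if "D \<noteq> 0" "B \<noteq> 0" "N \<noteq> 0" for D B N r :: real
      using that k0 by (simp add: field_simps power2_eq_square)
    have "0 < ?d ^ 9" using d0 by (rule zero_less_power)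
    then have "?d ^ 9 \<noteq> 0" by linarith
    moreover have "b * (1 - b) \<noteq> 0" "real_of_int n \<noteq> 0" using b n by auto
    ultimately have "?d ^ 9 \<noteq> 0" "b * (1 - b) \<noteq> 0" "real_of_int n \<noteq> 0" by blast+
    from gen[OF this, of "sqrt ?p2"] show ?thesis unfolding c of_int_mult of_int_numeral .
  qed
  finally show ?thesis .
qed

lemma arm_const_sym: "arm_const (1 - p) = arm_const p"
  unfolding arm_const_def by (simp add: min.commute mult.commute)


subsection \<open>From finite boxes to the percolation measure\<close>

definition oset :: "vertex set \<Rightarrow> config \<Rightarrow> vertex set" where
  "oset W \<omega> = {v \<in> W. \<omega> v}"

lemma prob_space_percolation: "prob_space (percolation p)"
  unfolding percolation_def by (intro prob_space_PiM prob_space_measure_pmf)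

lemma space_percolation: "space (percolation p) = UNIV"
  unfolding percolation_def by (simp add: space_PiM PiE_UNIV_domain)

lemma cylinder:
  assumes W: "finite W" "A \<subseteq> W" and p: "0 \<le> p" "p \<le> 1"
  shows "{\<omega>. oset W \<omega> = A} \<in> sets (percolation p)"
    and "measure (percolation p) {\<omega>. oset W \<omega> = A} = p ^ card A * (1 - p) ^ card (W - A)"
proof -
  interpret product_prob_space "\<lambda>_. measure_pmf (bernoulli_pmf p)" "UNIV :: vertex set"
    by unfold_locales
  let ?X = "\<lambda>v. {v \<in> A}"
  have e: "{\<omega>. oset W \<omega> = A} = prod_emb UNIV (\<lambda>_. measure_pmf (bernoulli_pmf p)) W (Pi\<^sub>E W ?X)"
    using W(2) by (auto simp: prod_emb_def oset_def PiE_UNIV_domain space_PiM PiE_iff)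
  show "{\<omega>. oset W \<omega> = A} \<in> sets (percolation p)"
    unfolding e percolation_def by (rule sets_PiM_I) (use W in auto)
  have "measure (percolation p) {\<omega>. oset W \<omega> = A} = (\<Prod>v\<in>W. measure (measure_pmf (bernoulli_pmf p)) (?X v))"
    unfolding e percolation_def by (rule measure_PiM_emb) (use W in auto)
  also have "\<dots> = (\<Prod>v\<in>W. if v \<in> A then p else 1 - p)"
    by (intro prod.cong) (use p in \<open>auto simp: measure_pmf_single\<close>)
  also have "\<dots> = p ^ card A * (1 - p) ^ card (W - A)"
  proof -
    have "(\<Prod>v\<in>W. if v \<in> A then p else 1 - p) = (\<Prod>v\<in>A. p) * (\<Prod>v\<in>W - A. 1 - p)"
      using W by (subst prod.subset_diff[of A W]) (auto simp: mult.commute intro!: arg_cong2[of _ _ _ _ "(*)"] prod.cong)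
    then show ?thesis by simp
  qed
  finally show "measure (percolation p) {\<omega>. oset W \<omega> = A} = p ^ card A * (1 - p) ^ card (W - A)" .
qed

text \<open>Such an event is a finite disjoint union of cylinders, so measurability needs no further
  argument.\<close>

lemma percolation_local:
  assumes W: "finite W" and p: "0 \<le> p" "p \<le> 1"
  shows "{\<omega>. P (oset W \<omega>)} \<in> sets (percolation p)" "measure (percolation p) {\<omega>. P (oset W \<omega>)} = pr p W P"
proof -
  interpret prob_space "percolation p" by (rule prob_space_percolation)
  let ?I = "{A \<in> Pow W. P A}"
  have e: "{\<omega>. P (oset W \<omega>)} = (\<Union>A\<in>?I. {\<omega>. oset W \<omega> = A})" by (auto simp: oset_def)
  have fI: "finite ?I" using W by simp
  have m: "{\<omega>. oset W \<omega> = A} \<in> sets (percolation p)" if "A \<in> ?I" for A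
    by (rule cylinder(1)) (use that W p in auto)
  show "{\<omega>. P (oset W \<omega>)} \<in> sets (percolation p)" unfolding e using fI m by blast
  have "measure (percolation p) {\<omega>. P (oset W \<omega>)} = (\<Sum>A\<in>?I. measure (percolation p) {\<omega>. oset W \<omega> = A})"
    unfolding e by (rule finite_measure_finite_Union[OF fI]) (use m in \<open>auto simp: disjoint_family_on_def\<close>)
  also have "\<dots> = (\<Sum>A\<in>?I. p ^ card A * (1 - p) ^ card (W - A))"
    by (intro sum.cong cylinder(2)) (use W p in auto)
  also have "\<dots> = (\<Sum>A\<in>Pow W. p ^ card A * (1 - p) ^ card (W - A) * of_bool (P A))"
    by (rule sum.mono_neutral_cong_left) (use W in auto)
  finally show "measure (percolation p) {\<omega>. P (oset W \<omega>)} = pr p W P" unfolding pr_def pexp_def .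
qed

subsection \<open>Self-avoiding paths\<close>

text \<open>Deleting \<open>x\<close> before continuing forces self-avoidance, so every step
  inspects a fresh, independent vertex.\<close>

primrec sap :: "bool \<Rightarrow> nat \<Rightarrow> vertex \<Rightarrow> vertex set \<Rightarrow> bool" where
  "sap s 0 x A \<longleftrightarrow> x \<in> A"
| "sap s (Suc k) x A \<longleftrightarrow> x \<in> A \<and> (\<exists>y. gadj s x y \<and> sap s k y (A - {x}))"

lemma sap_prob:
  assumes p: "0 \<le> p" "p \<le> 1"
  shows "finite W \<Longrightarrow> pr p W (sap s k x) \<le> p * (9 * p) ^ k"
proof (induction k arbitrary: x W)
  case 0
  show ?case
  proof (cases "x \<in> W")
    case True
    then show ?thesis using pr_single[OF 0 True, of p] by simp
  next
    case False
    then have "pr p W (sap s 0 x) = pr p W (\<lambda>A. False)" by (intro pr_cong) auto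
    then show ?thesis using 0 p by (simp add: pr_def)
  qed
next
  case (Suc k)
  show ?case
  proof (cases "x \<in> W")
    case False
    then have "pr p W (sap s (Suc k) x) = pr p W (\<lambda>A. False)" by (intro pr_cong) auto
    then show ?thesis using Suc(2) p by (simp add: pr_def)
  next
    case True
    let ?V = "W - {x}"
    have fV: "finite ?V" using Suc(2) by simp
    \<comment> \<open>All neighbours lie in the unit box around \<open>x\<close>; its nine vertices
      give the crude factor 9 for both adjacencies.\<close>
    have nb: "y \<in> shift x ` box 1" if "gadj s x y" for y
      using that by (auto simp: shift_image_iff in_box gadj_iff norm_inf_def split: if_splits)
    have rem: "pr p W (sap s (Suc k) x) = p * pr p ?V (\<lambda>A. sap s (Suc k) x (insert x A)) + (1 - p) * pr p ?V (sap s (Suc k) x)"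
      unfolding pr_def by (rule pexp_remove[OF Suc(2) True])
    have "pr p ?V (sap s (Suc k) x) = pr p ?V (\<lambda>A. False)" by (rule pr_cong) auto
    then have zero: "pr p ?V (sap s (Suc k) x) = 0" using fV by (simp add: pr_def)
    have "pr p ?V (\<lambda>A. sap s (Suc k) x (insert x A)) \<le> pr p ?V (\<lambda>A. \<exists>y\<in>shift x ` box 1. sap s k y A)"
    proof (rule pr_mono[OF p])
      fix A assume A: "A \<subseteq> ?V" "sap s (Suc k) x (insert x A)"
      then have "insert x A - {x} = A" by auto
      then obtain y where "gadj s x y" "sap s k y A" using A(2) by (simp only: sap.simps) blast
      then show "\<exists>y\<in>shift x ` box 1. sap s k y A" using nb[of y] by blast
    qed
    also have "\<dots> \<le> (\<Sum>y\<in>shift x ` box 1. pr p ?V (sap s k y))" by (rule pr_Bex_le[OF p]) simp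
    also have "\<dots> \<le> (\<Sum>y\<in>shift x ` box 1. p * (9 * p) ^ k)" by (intro sum_mono Suc.IH fV)
    also have "\<dots> = 9 * (p * (9 * p) ^ k)"
    proof -
      have "card (shift x ` box 1) = card (box 1)" by (rule card_image) (rule inj_on_subset[OF inj_shift], simp)
      then show ?thesis by (simp add: box_def rect_def card_cartesian_product)
    qed
    finally have "p * pr p ?V (\<lambda>A. sap s (Suc k) x (insert x A)) \<le> p * (9 * (p * (9 * p) ^ k))"
      by (rule mult_left_mono) (rule p(1))
    moreover have "p * (9 * (p * (9 * p) ^ k)) = p * (9 * p) ^ Suc k" by simp
    ultimately show ?thesis unfolding rem zero by linarith
  qed
qed

lemma conn_sap:
  assumes "conn s A x y" "int k \<le> norm_inf (y - x)"
  shows "sap s k x A"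
  using assms
proof (induction k arbitrary: x A)
  case 0
  then show ?case using conn_in by simp
next
  case (Suc k)
  have "y \<noteq> x" using Suc(3) by (auto simp: norm_inf_def)
  from conn_leave[OF Suc(2) this] obtain u where u: "gadj s x u" "conn s (A - {x}) u y" .
  have "\<bar>fst x - fst u\<bar> \<le> 1" "\<bar>snd x - snd u\<bar> \<le> 1" using u(1) by (auto simp: gadj_iff split: if_splits)
  moreover have "int k + 1 \<le> max \<bar>fst y - fst x\<bar> \<bar>snd y - snd x\<bar>" using Suc(3) by (simp add: norm_inf_def)
  ultimately have "int k \<le> max \<bar>fst y - fst u\<bar> \<bar>snd y - snd u\<bar>" unfolding max_def by (smt (verit))
  then have "int k \<le> norm_inf (y - u)" by (simp add: norm_inf_def)
  then have "sap s k u (A - {x})" by (rule Suc.IH[OF u(2)])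
  then show ?case unfolding sap.simps using conn_in(1)[OF Suc(2)] u(1) by blast
qed

subsection \<open>The critical parameter is nontrivial\<close>

lemma open_cluster_conn: "w \<in> open_cluster \<omega> v \<longleftrightarrow> conn False {z. \<omega> z} v w"
  unfolding open_cluster_def conn_def by (simp add: gadj_def)

lemma infinite_cluster_reaches:
  assumes "infinite (open_cluster \<omega> v)"
  obtains y where "norm_inf (y - v) = int n" "conn False (oset (shift v ` box (int n)) \<omega>) v y"
proof -
  have "\<not> open_cluster \<omega> v \<subseteq> shift v ` box (int n)"
    using assms finite_subset by fastforce
  then obtain w where w: "w \<in> open_cluster \<omega> v" "w \<notin> shift v ` box (int n)" by blast
  let ?T = "shift (- v)"
  have c: "conn False (?T ` {z. \<omega> z}) (?T v) (?T w)"
    using w(1) by (simp add: open_cluster_conn conn_iso[OF inj_shift gadj_shift])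
  have n0: "norm_inf (?T v) = 0" by (simp add: norm_inf_def)
  have nw: "int n \<le> norm_inf (?T w)" using w(2) by (simp add: shift_image_iff in_box)
  obtain e where e: "norm_inf e = int n" "conn False (?T ` {z. \<omega> z} \<inter> box (int n)) (?T v) e"
    by (rule conn_truncate[OF c _ nw]) (use n0 in auto)
  have im: "shift v ` (?T ` {z. \<omega> z} \<inter> box (int n)) = oset (shift v ` box (int n)) \<omega>"
  proof (rule set_eqI)
    fix w
    have "shift (- v) w \<in> ?T ` {z. \<omega> z} \<longleftrightarrow> \<omega> w"
      using shift_image_iff[of "shift (- v) w" "- v" "{z. \<omega> z}"] by simp
    then show "w \<in> shift v ` (?T ` {z. \<omega> z} \<inter> box (int n)) \<longleftrightarrow> w \<in> oset (shift v ` box (int n)) \<omega>"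
      unfolding oset_def by (simp add: shift_image_iff conj_commute)
  qed
  have "conn False (shift v ` (?T ` {z. \<omega> z} \<inter> box (int n))) (shift v (?T v)) (shift v e)"
    unfolding conn_iso[OF inj_shift gadj_shift] by (rule e(2))
  then have "conn False (oset (shift v ` box (int n)) \<omega>) v (shift v e)" unfolding im by simp
  moreover have "shift v e - v = e" by (simp add: prod_eq_iff)
  ultimately show ?thesis using that[of "shift v e"] e(1) by simp
qed

text \<open>An infinite cluster at \<open>v\<close> yields self-avoiding open paths of every length,
  and \<open>9 * p \<le> 1 / 2\<close> makes their probability tend to 0.\<close>

lemma no_infinite_cluster:
  assumes p: "0 \<le> p" "p \<le> 1 / 18"
  shows "AE \<omega> in percolation p. \<not> has_infinite_cluster \<omega>"
proof -
  interpret prob_space "percolation p" by (rule prob_space_percolation)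
  have p': "0 \<le> p" "p \<le> 1" using p by auto
  have "AE \<omega> in percolation p. finite (open_cluster \<omega> v)" for v
  proof -
    define E where "E n = {\<omega>. sap False n v (oset (shift v ` box (int n)) \<omega>)}" for n
    have fin: "finite (shift v ` box (int n))" for n by simp
    have E1: "E n \<in> sets (percolation p)" for n
      unfolding E_def by (rule percolation_local(1)[OF fin p'])
    have E2: "measure (percolation p) (E n) \<le> p * (9 * p) ^ n" for n
      unfolding E_def percolation_local(2)[OF fin p'] by (rule sap_prob[OF p' fin])
    note E = E1 E2
    have "(\<lambda>n. p * (9 * p) ^ n) \<longlonglongrightarrow> p * 0"
      by (intro tendsto_mult tendsto_const LIMSEQ_power_zero) (use p in auto)
    then have lim: "(\<lambda>n. p * (9 * p) ^ n) \<longlonglongrightarrow> 0" by simp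
    have N: "(\<Inter>n. E n) \<in> null_sets (percolation p)"
    proof (rule null_setsI)
      show m: "(\<Inter>n. E n) \<in> sets (percolation p)" using E1 by (intro sets.countable_INT) auto
      have "measure (percolation p) (\<Inter>n. E n) \<le> p * (9 * p) ^ n" for n
        using finite_measure_mono[OF _ E1[of n], of "\<Inter>n. E n"] E2[of n] by fastforce
      then have "measure (percolation p) (\<Inter>n. E n) \<le> 0"
        by (intro LIMSEQ_le_const[OF lim]) auto
      then have "measure (percolation p) (\<Inter>n. E n) = 0" by (simp add: antisym)
      then show "emeasure (percolation p) (\<Inter>n. E n) = 0" by (simp add: emeasure_eq_measure)
    qed
    have "{\<omega>. infinite (open_cluster \<omega> v)} \<subseteq> (\<Inter>n. E n)"
    proof safe
      fix \<omega> n assume i: "infinite (open_cluster \<omega> v)"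
      obtain y where "norm_inf (y - v) = int n" "conn False (oset (shift v ` box (int n)) \<omega>) v y"
        by (rule infinite_cluster_reaches[OF i])
      then show "\<omega> \<in> E n" unfolding E_def using conn_sap by auto
    qed
    then show ?thesis by (intro AE_I'[OF N]) (auto simp: space_percolation)
  qed
  then have "AE \<omega> in percolation p. \<forall>v. finite (open_cluster \<omega> v)" by (subst AE_all_countable) blast
  then show ?thesis unfolding has_infinite_cluster_def by simp
qed

text \<open>The dual path blocking the origin from the right side of a square starts at some point
  \<^term>\<open>(i, 0)\<close> of the bottom side and has at least \<^term>\<open>i\<close> vertices.\<close>

lemma origin_to_right:
  assumes n: "1 \<le> n" and p: "17 / 18 \<le> p" "p \<le> 1"
  shows "1 / 2 \<le> pr p (rect 0 n 0 n) (\<lambda>A. \<exists>r. fst r = n \<and> conn False (A \<inter> rect 0 n 0 n) (0, 0) r)"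
proof -
  let ?W = "rect 0 n 0 n"
  have p': "0 \<le> p" "p \<le> 1" "0 \<le> 1 - p" "1 - p \<le> 1" using p by auto
  define G where "G A \<longleftrightarrow> (\<exists>r. fst r = n \<and> conn False (A \<inter> ?W) (0, 0) r)" for A
  have dich: "(0, 0) \<notin> A \<or> G A \<or> (\<exists>i\<in>{..<nat n}. sap True i (int i + 1, 0) (?W - A))" for A
  proof (rule ccontr)
    assume neg: "\<not> ?thesis"
    \<comment> \<open>The left column is whitened except for the origin, so a horizontal crossing in
      \<open>A'\<close> starts at the origin and the Hex lemma detects exactly its absence.\<close>
    define A' where "A' = insert (0, 0) (A - {v. fst v = 0})"
    have A'A: "A' \<subseteq> A" unfolding A'_def using neg by auto
    have "\<not> (\<exists>l r. fst l = 0 \<and> fst r = n \<and> conn False (A' \<inter> ?W) l r)"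
    proof safe
      fix l r assume h: "fst l = 0" "n = fst r" "conn False (A' \<inter> rect 0 (fst r) 0 (fst r)) l r"
      have "l = (0, 0)" using conn_in(1)[OF h(3)] h(1) unfolding A'_def by auto
      moreover have "conn False (A \<inter> ?W) l r" unfolding h(2) by (rule conn_mono[OF h(3)]) (use A'A in blast)
      ultimately have "G A" unfolding G_def using h(2) by blast
      then show False using neg by blast
    qed
    then obtain t u where tu: "snd t = n" "snd u = 0" "conn True (?W - A') t u"
      using hex[of 0 n 0 n False A'] n by auto
    have uW: "u \<in> ?W - A'" using conn_in(2)[OF tu(3)] .
    then have u1: "1 \<le> fst u" "fst u \<le> n" using tu(2) unfolding A'_def by (cases u; auto simp: in_rect)+
    define i where "i = nat (fst u - 1)"
    have u: "u = (int i + 1, 0)" "i < nat n" using u1 tu(2) unfolding i_def by (auto simp: prod_eq_iff)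
    let ?Y = "{z. fst z \<le> 0}"
    \<comment> \<open>The white path may use artificially whitened vertices of the left column. It
      is stopped before entering that column, where it has already travelled \<open>i\<close>
      columns; otherwise it reaches the top at distance \<open>n > i\<close>.\<close>
    have far: "\<exists>z. conn True (?W - A) u z \<and> int i \<le> norm_inf (z - u)"
    proof (cases "conn True (?W - A' - ?Y) u t")
      case True
      have "conn True (?W - A) u t" by (rule conn_mono[OF True]) (auto simp: A'_def)
      moreover have "int i \<le> norm_inf (t - u)" using tu(1,2) u by (auto simp: norm_inf_def)
      ultimately show ?thesis by blast
    next
      case False
      have "\<exists>z. conn True (?W - A') u z \<and> z \<in> ?Y"
      proof (rule ccontr)
        assume "\<not> ?thesis"
        then have "conn True ((?W - A') \<inter> - ?Y) u t" by (intro conn_all[OF conn_sym[OF tu(3)]]) auto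
        then show False using False by (simp add: Diff_eq)
      qed
      then obtain z0 where z0: "conn True (?W - A') u z0" "z0 \<in> ?Y" by blast
      obtain z where z: "z \<in> ?Y" "u = z \<or> (\<exists>w. conn True (?W - A' - ?Y) u w \<and> gadj True w z)"
        using conn_first[OF z0] by blast
      then obtain w where w: "conn True (?W - A' - ?Y) u w" "gadj True w z" using u1 by auto
      have "fst w \<le> 1" using w(2) z(1) by (auto simp: gadj_iff)
      then have "int i \<le> norm_inf (w - u)" using u by (auto simp: norm_inf_def)
      moreover have "conn True (?W - A) u w" by (rule conn_mono[OF w(1)]) (auto simp: A'_def)
      ultimately show ?thesis by blast
    qed
    then obtain z where "conn True (?W - A) u z" "int i \<le> norm_inf (z - u)" by blast
    then have "sap True i u (?W - A)" by (rule conn_sap)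
    then show False using neg u by auto
  qed
  have "1 = pr p ?W (\<lambda>A. True)" by (simp add: pr_def)
  also have "\<dots> \<le> pr p ?W (\<lambda>A. (0, 0) \<notin> A \<or> (G A \<or> (\<exists>i\<in>{..<nat n}. sap True i (int i + 1, 0) (?W - A))))"
    by (rule pr_mono[OF p'(1,2)]) (use dich in blast)
  also have "\<dots> \<le> pr p ?W (\<lambda>A. (0, 0) \<notin> A) + (pr p ?W G + pr p ?W (\<lambda>A. \<exists>i\<in>{..<nat n}. sap True i (int i + 1, 0) (?W - A)))"
    by (rule order_trans[OF pr_disj_le[OF p'(1,2)]]) (rule add_left_mono[OF pr_disj_le[OF p'(1,2)]])
  also have "pr p ?W (\<lambda>A. (0, 0) \<notin> A) = 1 - p"
    using pr_not[of ?W p "\<lambda>A. (0, 0) \<in> A"] pr_single[of ?W "(0, 0)" p] n by (simp add: in_rect)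
  also have "pr p ?W (\<lambda>A. \<exists>i\<in>{..<nat n}. sap True i (int i + 1, 0) (?W - A)) \<le>
    (\<Sum>i<nat n. pr p ?W (\<lambda>A. sap True i (int i + 1, 0) (?W - A)))"
    by (rule pr_Bex_le[OF p'(1,2)]) simp
  also have "\<dots> \<le> (\<Sum>i<nat n. (1 / 18) * (1 / 2) ^ i)"
  proof (rule sum_mono)
    fix i
    have "pr p ?W (\<lambda>A. sap True i (int i + 1, 0) (?W - A)) = pr (1 - p) ?W (\<lambda>A. sap True i (int i + 1, 0) (?W - (?W - A)))"
      unfolding pr_def by (subst pexp_compl) simp
    also have "\<dots> = pr (1 - p) ?W (sap True i (int i + 1, 0))"
      by (rule pr_cong) (simp add: double_diff)
    also have "\<dots> \<le> (1 - p) * (9 * (1 - p)) ^ i" by (rule sap_prob[OF p'(3,4)]) simp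
    also have "\<dots> \<le> (1 / 18) * (1 / 2) ^ i" by (intro mult_mono power_mono) (use p in auto)
    finally show "pr p ?W (\<lambda>A. sap True i (int i + 1, 0) (?W - A)) \<le> (1 / 18) * (1 / 2) ^ i" .
  qed
  also have "\<dots> = (1 / 18) * (\<Sum>i<nat n. (1 / 2) ^ i)" by (simp add: sum_distrib_left)
  also have "(\<Sum>i<nat n. (1 / 2 :: real) ^ i) \<le> 2"
    by (subst geometric_sum) (auto simp: field_simps)
  finally have "1 \<le> (1 - p) + (pr p ?W G + (1 / 18) * 2)" by simp
  then show ?thesis using p unfolding G_def by simp
qed

text \<open>The events that the origin reaches distance \<open>Suc n\<close> decrease and have
  probability at least 1/2, so their intersection does too, and there the cluster of the origin is
  unbounded.\<close>

lemma infinite_cluster: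
  assumes p: "17 / 18 \<le> p" "p \<le> 1"
  shows "\<not> (AE \<omega> in percolation p. \<not> has_infinite_cluster \<omega>)"
proof
  interpret prob_space "percolation p" by (rule prob_space_percolation)
  assume ae: "AE \<omega> in percolation p. \<not> has_infinite_cluster \<omega>"
  have p': "0 \<le> p" "p \<le> 1" using p by auto
  define H where "H n A \<longleftrightarrow> (\<exists>r. norm_inf r = int n \<and> conn False (A \<inter> box (int n)) (0, 0) r)" for n A
  define E where "E n = {\<omega>. H (Suc n) (oset (box (int (Suc n))) \<omega>)}" for n
  have Eiff: "\<omega> \<in> E n \<longleftrightarrow> (\<exists>r. norm_inf r = int (Suc n) \<and> conn False ({z. \<omega> z} \<inter> box (int (Suc n))) (0, 0) r)" for \<omega> n
  proof -
    have "oset (box (int (Suc n))) \<omega> \<inter> box (int (Suc n)) = {z. \<omega> z} \<inter> box (int (Suc n))" by (auto simp: oset_def)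
    then show ?thesis unfolding E_def H_def by simp
  qed
  have Em: "E n \<in> sets (percolation p)" for n unfolding E_def by (rule percolation_local(1)[OF _ p']) simp
  have half: "1 / 2 \<le> measure (percolation p) (E n)" for n
  proof -
    let ?m = "int (Suc n)" and ?R = "rect 0 (int (Suc n)) 0 (int (Suc n))"
    have sub: "?R \<subseteq> box ?m" unfolding box_def by (auto simp: in_rect)
    have "1 / 2 \<le> pr p ?R (\<lambda>A. \<exists>r. fst r = ?m \<and> conn False (A \<inter> ?R) (0, 0) r)"
      by (rule origin_to_right) (use p in auto)
    also have "\<dots> = pr p (box ?m) (\<lambda>A. \<exists>r. fst r = ?m \<and> conn False (A \<inter> ?R) (0, 0) r)"
      by (rule pr_subset[symmetric]) (use sub in \<open>auto simp: Int_assoc\<close>)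
    also have "\<dots> \<le> pr p (box ?m) (H (Suc n))"
    proof (rule pr_mono[OF p'])
      fix A assume "\<exists>r. fst r = ?m \<and> conn False (A \<inter> ?R) (0, 0) r"
      then obtain r where r: "fst r = ?m" "conn False (A \<inter> ?R) (0, 0) r" by blast
      have "norm_inf r = ?m" using conn_in(2)[OF r(2)] r(1) by (auto simp: in_rect norm_inf_def)
      moreover have "conn False (A \<inter> box ?m) (0, 0) r" by (rule conn_mono[OF r(2)]) (use sub in blast)
      ultimately show "H (Suc n) A" unfolding H_def by blast
    qed
    also have "\<dots> = measure (percolation p) (E n)" unfolding E_def by (rule percolation_local(2)[OF _ p', symmetric]) simp
    finally show ?thesis .
  qed
  have dec: "decseq E"
  proof (rule decseq_SucI, rule subsetI)
    fix n \<omega> assume "\<omega> \<in> E (Suc n)"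
    then obtain r where r: "norm_inf r = int (Suc (Suc n))" "conn False ({z. \<omega> z} \<inter> box (int (Suc (Suc n)))) (0, 0) r"
      unfolding Eiff by blast
    obtain e where e: "norm_inf e = int (Suc n)"
      "conn False ({z. \<omega> z} \<inter> box (int (Suc (Suc n))) \<inter> box (int (Suc n))) (0, 0) e"
      by (rule conn_truncate[OF r(2), of "int (Suc n)"]) (use r(1) in \<open>auto simp: norm_inf_def\<close>)
    have "conn False ({z. \<omega> z} \<inter> box (int (Suc n))) (0, 0) e" by (rule conn_mono[OF e(2)]) blast
    then show "\<omega> \<in> E n" unfolding Eiff using e(1) by blast
  qed
  have "(\<lambda>n. measure (percolation p) (E n)) \<longlonglongrightarrow> measure (percolation p) (\<Inter>n. E n)"
    by (rule finite_Lim_measure_decseq[OF _ dec]) (use Em in auto)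
  then have I: "1 / 2 \<le> measure (percolation p) (\<Inter>n. E n)" by (rule LIMSEQ_le_const) (use half in blast)
  have inf: "has_infinite_cluster \<omega>" if "\<omega> \<in> (\<Inter>n. E n)" for \<omega>
  proof -
    have "infinite (open_cluster \<omega> (0, 0))"
    proof
      assume fin: "finite (open_cluster \<omega> (0, 0))"
      define m where "m = nat (Max (norm_inf ` open_cluster \<omega> (0, 0)))"
      have "\<omega> \<in> E m" using that by simp
      then obtain r where r: "norm_inf r = int (Suc m)" "conn False ({z. \<omega> z} \<inter> box (int (Suc m))) (0, 0) r"
        unfolding Eiff by (elim exE conjE)
      have "conn False {z. \<omega> z} (0, 0) r" by (rule conn_mono[OF r(2)]) blast
      then have "r \<in> open_cluster \<omega> (0, 0)" unfolding open_cluster_conn .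
      then have "norm_inf r \<le> Max (norm_inf ` open_cluster \<omega> (0, 0))" using fin by (intro Max_ge) auto
      then show False using r(1) unfolding m_def by linarith
    qed
    then show ?thesis unfolding has_infinite_cluster_def by blast
  qed
  have "AE \<omega> in percolation p. \<omega> \<notin> (\<Inter>n. E n)" using ae by eventually_elim (use inf in blast)
  moreover have "(\<Inter>n. E n) \<in> sets (percolation p)" by (rule sets.countable_INT) (use Em in auto)
  ultimately have "(\<Inter>n. E n) \<in> null_sets (percolation p)" by (subst AE_iff_null_sets)
  then have "measure (percolation p) (\<Inter>n. E n) = 0" by (rule measure_eq_0_null_sets)
  then show False using I by simp
qed

lemma p_c_bounds: "0 < p_c" "p_c < 1"
proof -
  let ?S = "{p \<in> {0..1}. AE \<omega> in percolation p. \<not> has_infinite_cluster \<omega>}"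
  have in_S: "1 / 18 \<in> ?S" using no_infinite_cluster[of "1 / 18"] by simp
  have bd: "bdd_above ?S" by (rule bdd_aboveI[of _ 1]) auto
  have "1 / 18 \<le> p_c" unfolding p_c_def by (rule cSup_upper[OF in_S bd])
  then show "0 < p_c" by simp
  have "p_c \<le> 17 / 18" unfolding p_c_def
  proof (rule cSup_least)
    fix p assume "p \<in> ?S"
    then show "p \<le> 17 / 18" using infinite_cluster[of p] by force
  qed (use in_S in blast)
  then show "p_c < 1" by simp
qed

subsection \<open>Arms as paths\<close>

lemma conn_path:
  assumes "conn s X x y"
  obtains \<gamma> where "\<gamma> \<noteq> []" "hd \<gamma> = x" "last \<gamma> = y" "successively (gadj s) \<gamma>" "set \<gamma> \<subseteq> X"
proof -
  have "\<exists>\<gamma>. \<gamma> \<noteq> [] \<and> hd \<gamma> = x \<and> last \<gamma> = y \<and> successively (gadj s) \<gamma> \<and> set \<gamma> \<subseteq> X"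
    using assms
  proof (induction rule: conn_induct)
    case refl
    then show ?case by (intro exI[of _ "[x]"]) simp
  next
    case (step y z)
    then obtain \<gamma> where "\<gamma> \<noteq> []" "hd \<gamma> = x" "last \<gamma> = y" "successively (gadj s) \<gamma>" "set \<gamma> \<subseteq> X" by blast
    then show ?case using step by (intro exI[of _ "\<gamma> @ [z]"]) (simp add: successively_append_iff)
  qed
  then show ?thesis using that by blast
qed

lemma path_conn:
  assumes "\<gamma> \<noteq> []" "successively (gadj s) \<gamma>" "set \<gamma> \<subseteq> X"
  shows "conn s X (hd \<gamma>) (last \<gamma>)"
  using assms
proof (induction \<gamma>)
  case (Cons a \<gamma>)
  show ?case
  proof (cases "\<gamma> = []")
    case True then show ?thesis using Cons by auto
  next
    case False
    then have "conn s X (hd \<gamma>) (last \<gamma>)" using Cons by (auto simp: successively_Cons)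
    moreover have "conn s X a (hd \<gamma>)" using Cons False by (intro conn_step) (auto simp: successively_Cons)
    ultimately show ?thesis using False conn_trans by auto
  qed
qed simp

lemma annulus_1: "annulus 1 n = box (int n) - {0}"
proof -
  have "ball_inf 0 = {0}" by (auto simp: ball_inf_def norm_inf_def prod_eq_iff)
  moreover have "ball_inf n = box (int n)" by (auto simp: ball_inf_def in_box)
  ultimately show ?thesis unfolding annulus_def by simp
qed

definition point :: "vertex \<Rightarrow> complex" where
  "point v = Complex (of_int (fst v)) (of_int (snd v))"

text \<open>An argument of a point of the sphere, decreasing in the clockwise position.\<close>

definition sang :: "int \<Rightarrow> vertex \<Rightarrow> real" where
  "sang n v = (if fst v = n then arctan (of_int (snd v) / of_int n)
     else if snd v = - n then arctan (of_int (fst v) / of_int n) - pi / 2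
     else if fst v = - n then - pi - arctan (of_int (snd v) / of_int n)
     else - (3 * pi / 2) - arctan (of_int (fst v) / of_int n))"

lemma arctan_coords:
  assumes "0 < n"
  obtains r where "0 < r" "r * cos (arctan (y / n)) = n" "r * sin (arctan (y / n)) = (y :: real)"
proof -
  let ?t = "y / n"
  have s: "0 < sqrt (1 + ?t\<^sup>2)" by (simp add: add_pos_nonneg)
  show ?thesis
    by (rule that[of "n * sqrt (1 + ?t\<^sup>2)"]) (use assms s in \<open>auto simp: cos_arctan sin_arctan field_simps\<close>)
qed

lemma cos_sin_three_half_pi: "cos (3 * pi / 2) = 0" "sin (3 * pi / 2) = - 1"
proof -
  have "cos (pi / 2 + pi) = 0" "sin (pi / 2 + pi) = - 1" by (simp_all only: cos_add sin_add) simp_all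
  then show "cos (3 * pi / 2) = 0" "sin (3 * pi / 2) = - 1" by (simp_all add: field_simps)
qed

lemma sang_rcis:
  assumes n: "1 \<le> n" and v: "norm_inf v = n"
  shows "\<exists>r>0. point v = rcis r (sang n v)"
proof -
  have n0: "0 < real_of_int n" using n by simp
  have c: "cos (x - pi / 2) = sin x" "sin (x - pi / 2) = - cos x" "cos (- pi - x) = - cos x" "sin (- pi - x) = sin x"
    "cos (- (3 * pi / 2) - x) = sin x" "sin (- (3 * pi / 2) - x) = cos x" for x :: real
  proof -
    show "cos (x - pi / 2) = sin x" "sin (x - pi / 2) = - cos x" by (simp_all add: cos_diff sin_diff)
    show "cos (- pi - x) = - cos x" "sin (- pi - x) = sin x" by (simp_all add: cos_diff sin_diff)
    show "cos (- (3 * pi / 2) - x) = sin x" "sin (- (3 * pi / 2) - x) = cos x"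
      by (simp_all add: cos_diff sin_diff cos_sin_three_half_pi)
  qed
  have nv: "fst v = n \<or> snd v = - n \<or> fst v = - n \<or> snd v = n"
    using v by (auto simp: norm_inf_def max_def abs_if split: if_splits)
  show ?thesis
  proof (cases "fst v = n \<or> (snd v \<noteq> - n \<and> fst v = - n)")
    case True
    obtain r where r: "0 < r" "r * cos (arctan (real_of_int (snd v) / n)) = n" "r * sin (arctan (real_of_int (snd v) / n)) = real_of_int (snd v)"
      by (rule arctan_coords[OF n0])
    then show ?thesis using True n
      by (intro exI[of _ r]) (auto simp: sang_def point_def complex_eq_iff c)
  next
    case False
    obtain r where r: "0 < r" "r * cos (arctan (real_of_int (fst v) / n)) = n" "r * sin (arctan (real_of_int (fst v) / n)) = real_of_int (fst v)"
      by (rule arctan_coords[OF n0])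
    then show ?thesis using False n nv
      by (intro exI[of _ r]) (auto simp: sang_def point_def complex_eq_iff c)
  qed
qed

lemma arctan_quarter:
  assumes n: "1 \<le> n" and y: "- n \<le> y" "y \<le> n"
  shows "- (pi / 4) \<le> arctan (of_int y / of_int n)" "arctan (of_int y / of_int n) \<le> pi / 4"
    "y < n \<Longrightarrow> arctan (of_int y / of_int n) < pi / 4" "- n < y \<Longrightarrow> - (pi / 4) < arctan (of_int y / of_int n)"
proof -
  have n0: "0 < real_of_int n" using n by simp
  have 1: "- 1 \<le> real_of_int y / of_int n" "real_of_int y / of_int n \<le> 1"
    using n0 y by (simp_all add: field_simps)
  have a: "arctan (- 1) = - (pi / 4)" "arctan 1 = pi / 4" by (simp_all add: arctan_minus arctan_one)
  show "- (pi / 4) \<le> arctan (of_int y / of_int n)" "arctan (of_int y / of_int n) \<le> pi / 4"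
    using arctan_monotone'[OF 1(1)] arctan_monotone'[OF 1(2)] a by simp_all
  show "arctan (of_int y / of_int n) < pi / 4" if "y < n"
    using that n0 arctan_monotone[of "real_of_int y / of_int n" 1] a by (simp add: field_simps)
  show "- (pi / 4) < arctan (of_int y / of_int n)" if "- n < y"
  proof -
    have "- 1 < real_of_int y / of_int n" using that n0 by (simp add: field_simps)
    from arctan_monotone[OF this] show ?thesis using a by simp
  qed
qed

text \<open>Clockwise from the top right corner, the four sides occupy consecutive angle ranges of
  length \<open>pi / 2\<close>, and within a side \<open>arctan\<close> is monotone. Strictness at
  the corners holds because each corner is assigned to one side only.\<close>

lemma sang_bpos:
  assumes n: "1 \<le> n" and uv: "norm_inf u = n" "norm_inf v = n"
    and less: "bpos (- n) n (- n) n u < bpos (- n) n (- n) n v"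
  shows "sang n v < sang n u"
proof -
  have n0: "0 < real_of_int n" using n by simp
  have am: "arctan (of_int x / of_int n) < arctan (of_int y / of_int n)" if "x < y" for x y :: int
    using that n0 by (intro arctan_monotone) (simp add: divide_strict_right_mono)
  obtain x y x' y' where e: "u = (x, y)" "v = (x', y')" by (cases u; cases v)
  have r: "- n \<le> x" "x \<le> n" "- n \<le> y" "y \<le> n" "- n \<le> x'" "x' \<le> n" "- n \<le> y'" "y' \<le> n"
    using uv unfolding e norm_inf_def by auto
  have o: "x = n \<or> y = - n \<or> x = - n \<or> y = n" "x' = n \<or> y' = - n \<or> x' = - n \<or> y' = n"
    using uv unfolding e norm_inf_def by (auto simp: max_def abs_if split: if_splits)
  note q = arctan_quarter[OF n r(1,2)] arctan_quarter[OF n r(3,4)] arctan_quarter[OF n r(5,6)] arctan_quarter[OF n r(7,8)]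
  consider (ru) "x = n" | (bu) "x \<noteq> n" "y = - n" | (lu) "x \<noteq> n" "y \<noteq> - n" "x = - n" | (tu) "x \<noteq> n" "y \<noteq> - n" "x \<noteq> - n" "y = n"
    using o(1) by blast
  note cu = this
  consider (rv) "x' = n" | (bv) "x' \<noteq> n" "y' = - n" | (lv) "x' \<noteq> n" "y' \<noteq> - n" "x' = - n" | (tv) "x' \<noteq> n" "y' \<noteq> - n" "x' \<noteq> - n" "y' = n"
    using o(2) by blast
  note cv = this
  show ?thesis
    using cu
  proof cases
    case ru
    show ?thesis using cv
    proof cases
      case rv
      then have "y' < y" using less ru unfolding e bpos_def by simp
      then show ?thesis using am ru rv unfolding e sang_def by simp
    next
      case bv
      then have "arctan (of_int x' / of_int n) < pi / 4" using q r by auto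
      then show ?thesis using ru bv q unfolding e sang_def by (simp; linarith)
    next
      case lv
      then show ?thesis using ru q pi_gt_zero unfolding e sang_def by (simp; linarith)
    next
      case tv
      then show ?thesis using ru q pi_gt_zero unfolding e sang_def by (simp; linarith)
    qed
  next
    case bu
    show ?thesis using cv
    proof cases
      case rv
      then show ?thesis using less bu r unfolding e bpos_def by simp
    next
      case bv
      then have "x' < x" using less bu unfolding e bpos_def by simp
      then show ?thesis using am bu bv unfolding e sang_def by simp
    next
      case lv
      then have "- (pi / 4) < arctan (of_int y' / of_int n)" using q r by auto
      then show ?thesis using bu lv q unfolding e sang_def by (simp; linarith)
    next
      case tv
      then show ?thesis using bu q pi_gt_zero unfolding e sang_def by (simp; linarith)
    qed
  next
    case lu
    show ?thesis using cv
    proof cases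
      case rv
      then show ?thesis using less lu r unfolding e bpos_def by simp
    next
      case bv
      then show ?thesis using less lu r unfolding e bpos_def by simp
    next
      case lv
      then have "y < y'" using less lu unfolding e bpos_def by simp
      then show ?thesis using am lu lv unfolding e sang_def by simp
    next
      case tv
      then have "- (pi / 4) < arctan (of_int x' / of_int n)" using q r by auto
      then show ?thesis using lu tv q unfolding e sang_def by (simp; linarith)
    qed
  next
    case tu
    show ?thesis using cv
    proof cases
      case rv
      then show ?thesis using less tu r unfolding e bpos_def by simp
    next
      case bv
      then show ?thesis using less tu r unfolding e bpos_def by simp
    next
      case lv
      then show ?thesis using less tu r unfolding e bpos_def by simp
    next
      case tv
      then have "x < x'" using less tu unfolding e bpos_def by simp
      then show ?thesis using am tu tv unfolding e sang_def by simp
    qed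
  qed
qed

lemma sang_range:
  assumes n: "1 \<le> n" and v: "norm_inf v = n"
  shows "- (7 * pi / 4) \<le> sang n v" "sang n v \<le> pi / 4" "sang n v \<noteq> - (7 * pi / 4)"
proof -
  have r: "- n \<le> fst v" "fst v \<le> n" "- n \<le> snd v" "snd v \<le> n" using v unfolding norm_inf_def by auto
  note q = arctan_quarter[OF n r(1,2)] arctan_quarter[OF n r(3,4)]
  show "- (7 * pi / 4) \<le> sang n v" "sang n v \<le> pi / 4" "sang n v \<noteq> - (7 * pi / 4)"
    unfolding sang_def using q r pi_gt_zero by (auto split: if_splits)
qed

lemma bpos_inj:
  assumes n: "1 \<le> n" and uv: "norm_inf u = n" "norm_inf v = n"
    and eq: "bpos (- n) n (- n) n u = bpos (- n) n (- n) n v"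
  shows "u = v"
proof -
  have r: "- n \<le> fst w" "fst w \<le> n" "- n \<le> snd w" "snd w \<le> n"
    "fst w = n \<or> snd w = - n \<or> fst w = - n \<or> snd w = n" if "norm_inf w = n" for w
    using that unfolding norm_inf_def by (auto simp: max_def abs_if split: if_splits)
  show ?thesis
    using eq r[OF uv(1)] r[OF uv(2)] n unfolding bpos_def by (auto simp: prod_eq_iff split: if_splits)
qed

text \<open>The angles \<open>\<theta>\<close> are lifts of \<open>sang\<close> by multiples
  \<open>k i\<close> of a full turn. The \<open>k i\<close> are nondecreasing and grow by at most 1
  in total, so the values of \<open>sang\<close> are increasing up to a cyclic rotation. Passing to
  \<open>bpos\<close> reverses the order, which does not affect interlacing.\<close>

lemma ccw_interl:
  assumes n: "1 \<le> n" and e: "\<And>i. i \<in> {1..4} \<Longrightarrow> norm_inf (e i) = int n" and ccw: "ccw_ordered 4 e"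
  shows "interl (- int n) (int n) (- int n) (int n) (e 1) (e 3) (e 2) (e 4)"
    "interl (- int n) (int n) (- int n) (int n) (e 2) (e 4) (e 1) (e 3)"
proof -
  obtain \<theta> where th: "\<And>i. i \<in> {1..4} \<Longrightarrow> \<exists>r>0. point (e i) = rcis r (\<theta> i)"
    and mono: "strict_mono_on {1..4} \<theta>" and last: "\<theta> 4 < \<theta> 1 + 2 * pi"
    using ccw unfolding ccw_ordered_def point_def by blast
  let ?a = "\<lambda>i. sang (int n) (e i)"
  have n1: "1 \<le> int n" using n by simp
  have "\<exists>k::int. \<theta> i = ?a i + 2 * pi * k" if i: "i \<in> {1..4}" for i
  proof -
    obtain r where r: "0 < r" "point (e i) = rcis r (\<theta> i)" using th[OF i] by blast
    obtain r' where r': "0 < r'" "point (e i) = rcis r' (?a i)" using sang_rcis[OF n1 e[OF i]] by blast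
    have eq: "rcis r (\<theta> i) = rcis r' (?a i)" using r r' by simp
    then have "norm (rcis r (\<theta> i)) = norm (rcis r' (?a i))" by simp
    then have "r = r'" using r(1) r'(1) by simp
    then have "sin (\<theta> i) = sin (?a i) \<and> cos (\<theta> i) = cos (?a i)" using eq r'(1) by (simp add: complex_eq_iff)
    then show ?thesis using sin_cos_eq_iff[of "\<theta> i" "?a i"] by (auto simp: mult_ac)
  qed
  then obtain k :: "nat \<Rightarrow> int" where k: "\<And>i. i \<in> {1..4} \<Longrightarrow> \<theta> i = ?a i + 2 * pi * k i" by metis
  have rng: "\<bar>?a i - ?a j\<bar> < 2 * pi" if "i \<in> {1..4}" "j \<in> {1..4}" for i j
    using sang_range[OF n1 e[OF that(1)]] sang_range[OF n1 e[OF that(2)]] by linarith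
  have kle: "k i \<le> k j" if "i \<in> {1..4}" "j \<in> {1..4}" "\<theta> i < \<theta> j" for i j
  proof -
    have "2 * pi * k i < 2 * pi * k j + 2 * pi" using that(3) rng[OF that(1,2)] unfolding k[OF that(1)] k[OF that(2)] by linarith
    then have "2 * pi * real_of_int (k i) < 2 * pi * (real_of_int (k j) + 1)" by (simp add: algebra_simps)
    then have "real_of_int (k i) < real_of_int (k j) + 1" by (subst (asm) mult_less_cancel_left_pos) auto
    then show ?thesis by linarith
  qed
  have th': "\<theta> 1 < \<theta> 2" "\<theta> 2 < \<theta> 3" "\<theta> 3 < \<theta> 4" using mono by (auto simp: strict_mono_on_def)
  have k123: "k 1 \<le> k 2" "k 2 \<le> k 3" "k 3 \<le> k 4" using kle th' by auto
  have k41: "k 4 \<le> k 1 + 1"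
  proof -
    have "2 * pi * k 4 < 2 * pi * k 1 + 4 * pi"
      using last rng[of 4 1] k[of 4] k[of 1] by simp
    then have "2 * pi * real_of_int (k 4) < 2 * pi * (real_of_int (k 1) + 2)" by (simp add: algebra_simps)
    then have "real_of_int (k 4) < real_of_int (k 1) + 2" by (subst (asm) mult_less_cancel_left_pos) auto
    then show ?thesis by linarith
  qed
  have same: "?a i < ?a j" if "i \<in> {1..4}" "j \<in> {1..4}" "\<theta> i < \<theta> j" "k i = k j" for i j
    using that k[OF that(1)] k[OF that(2)] by simp
  have wrap: "?a 4 < ?a 1" if "k 4 = k 1 + 1"
  proof -
    have "?a 4 + 2 * pi * (real_of_int (k 1) + 1) < ?a 1 + 2 * pi * real_of_int (k 1) + 2 * pi"
      using last k[of 4] k[of 1] that by simp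
    then show ?thesis by (simp add: algebra_simps)
  qed
  let ?b = "\<lambda>i. bpos (- int n) (int n) (- int n) (int n) (e i)"
  have bp: "(?b i < ?b j) = (?a j < ?a i)" if "i \<in> {1..4}" "j \<in> {1..4}" "?a i \<noteq> ?a j" for i j
  proof
    assume "?b i < ?b j"
    then show "?a j < ?a i" by (rule sang_bpos[OF n1 e[OF that(1)] e[OF that(2)]])
  next
    assume l: "?a j < ?a i"
    show "?b i < ?b j"
    proof (rule ccontr)
      assume nb: "\<not> ?b i < ?b j"
      have "?b i \<noteq> ?b j"
      proof
        assume be: "?b i = ?b j"
        have "e i = e j" by (rule bpos_inj[OF n1 e[OF that(1)] e[OF that(2)] be])
        then show False using that(3) by simp
      qed
      then have "?b j < ?b i" using nb by simp
      then have "?a i < ?a j" by (rule sang_bpos[OF n1 e[OF that(2)] e[OF that(1)]])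
      then show False using l by simp
    qed
  qed
  have m: "(1::nat) \<in> {1..4}" "(2::nat) \<in> {1..4}" "(3::nat) \<in> {1..4}" "(4::nat) \<in> {1..4}" by auto
  have cases: "(?a 1 < ?a 2 \<and> ?a 2 < ?a 3 \<and> ?a 3 < ?a 4) \<or> (?a 2 < ?a 3 \<and> ?a 3 < ?a 4 \<and> ?a 4 < ?a 1) \<or>
    (?a 3 < ?a 4 \<and> ?a 4 < ?a 1 \<and> ?a 1 < ?a 2) \<or> (?a 4 < ?a 1 \<and> ?a 1 < ?a 2 \<and> ?a 2 < ?a 3)"
  proof -
    consider "k 4 = k 1" | "k 2 = k 1 + 1" "k 4 = k 1 + 1" | "k 2 = k 1" "k 3 = k 1 + 1" "k 4 = k 1 + 1"
      | "k 3 = k 1" "k 4 = k 1 + 1"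
      using k123 k41 by linarith
    then show ?thesis
    proof cases
      case 1
      then have "k 1 = k 2" "k 2 = k 3" "k 3 = k 4" using k123 by auto
      then show ?thesis using same[OF m(1,2)] same[OF m(2,3)] same[OF m(3,4)] th' by blast
    next
      case 2
      then have "k 2 = k 3" "k 3 = k 4" using k123 by auto
      then show ?thesis using same[OF m(2,3)] same[OF m(3,4)] th' wrap 2 by blast
    next
      case 3
      then have "k 1 = k 2" "k 3 = k 4" using k123 by auto
      then show ?thesis using same[OF m(1,2)] same[OF m(3,4)] th' wrap 3 by blast
    next
      case 4
      then have "k 1 = k 2" "k 2 = k 3" using k123 by auto
      then show ?thesis using same[OF m(1,2)] same[OF m(2,3)] th' wrap 4 by blast
    qed
  qed
  have ne: "?a 1 \<noteq> ?a 2" "?a 3 \<noteq> ?a 2" "?a 1 \<noteq> ?a 4" "?a 3 \<noteq> ?a 4" using cases by auto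
  note B = bp[OF m(1,2) ne(1)] bp[OF m(3,2) ne(2)] bp[OF m(1,4) ne(3)] bp[OF m(3,4) ne(4)]
    bp[OF m(2,1) ne(1)[symmetric]] bp[OF m(2,3) ne(2)[symmetric]] bp[OF m(4,1) ne(3)[symmetric]] bp[OF m(4,3) ne(4)[symmetric]]
  show "interl (- int n) (int n) (- int n) (int n) (e 1) (e 3) (e 2) (e 4)"
    unfolding interl_def B using cases by (elim disjE) auto
  show "interl (- int n) (int n) (- int n) (int n) (e 2) (e 4) (e 1) (e 3)"
    unfolding interl_def B using cases by (elim disjE) auto
qed


subsection \<open>The arm events of the annulus\<close>

lemma arm_event_local: "\<omega> \<in> arm_event k 1 m \<longleftrightarrow> (\<lambda>v. v \<in> oset (box (int m)) \<omega>) \<in> arm_event k 1 m"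
proof -
  let ?\<omega> = "\<lambda>v. v \<in> oset (box (int m)) \<omega>"
  have e: "(if odd i then open_path \<omega> \<gamma> else closed_star_path \<omega> \<gamma>) \<and> set \<gamma> \<subseteq> annulus 1 m \<and> P \<longleftrightarrow>
    (if odd i then open_path ?\<omega> \<gamma> else closed_star_path ?\<omega> \<gamma>) \<and> set \<gamma> \<subseteq> annulus 1 m \<and> P" for i :: nat and \<gamma> P
    unfolding open_path_def closed_star_path_def annulus_1 oset_def by auto
  show ?thesis unfolding arm_event_def mem_Collect_eq e ..
qed

lemma arm_prob_eq: "arm_prob k 1 m = pr p_c (box (int m)) (\<lambda>A. (\<lambda>v. v \<in> A) \<in> arm_event k 1 m)"
proof -
  have p: "0 \<le> p_c" "p_c \<le> 1" using p_c_bounds by auto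
  have "arm_event k 1 m = {\<omega>. (\<lambda>v. v \<in> oset (box (int m)) \<omega>) \<in> arm_event k 1 m}"
    using arm_event_local by blast
  then have "arm_prob k 1 m = measure (percolation p_c) {\<omega>. (\<lambda>v. v \<in> oset (box (int m)) \<omega>) \<in> arm_event k 1 m}"
    unfolding arm_prob_def by simp
  also have "\<dots> = pr p_c (box (int m)) (\<lambda>A. (\<lambda>v. v \<in> A) \<in> arm_event k 1 m)"
    by (rule percolation_local(2)[OF finite_box p])
  finally show ?thesis .
qed

lemma arm_eventI:
  assumes m: "2 \<le> m"
    and c: "\<And>i. i \<in> {1..k} \<Longrightarrow> conn (even i) (X i) (x i) (e i)"
    and X: "\<And>i. i \<in> {1..k} \<Longrightarrow> X i \<subseteq> annulus 1 m" "\<And>i v. i \<in> {1..k} \<Longrightarrow> v \<in> X i \<Longrightarrow> \<omega> v \<longleftrightarrow> odd i"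
    and n: "\<And>i. i \<in> {1..k} \<Longrightarrow> norm_inf (x i) = 1" "\<And>i. i \<in> {1..k} \<Longrightarrow> norm_inf (e i) = int m"
    and dis: "disjoint_family_on X {1..k}" and ccw: "ccw_ordered k e"
  shows "\<omega> \<in> arm_event k 1 m"
proof -
  have "\<forall>i\<in>{1..k}. \<exists>\<gamma>. \<gamma> \<noteq> [] \<and> hd \<gamma> = x i \<and> last \<gamma> = e i \<and> successively (gadj (even i)) \<gamma> \<and> set \<gamma> \<subseteq> X i"
  proof
    fix i assume "i \<in> {1..k}"
    obtain \<gamma> where \<gamma>: "\<gamma> \<noteq> []" "hd \<gamma> = x i" "last \<gamma> = e i" "successively (gadj (even i)) \<gamma>" "set \<gamma> \<subseteq> X i"
      by (rule conn_path[OF c[OF \<open>i \<in> {1..k}\<close>]])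
    show "\<exists>\<gamma>. \<gamma> \<noteq> [] \<and> hd \<gamma> = x i \<and> last \<gamma> = e i \<and> successively (gadj (even i)) \<gamma> \<and> set \<gamma> \<subseteq> X i"
      by (intro exI[of _ \<gamma>] conjI \<gamma>)
  qed
  from bchoice[OF this] obtain \<gamma> where
    g': "\<forall>i\<in>{1..k}. \<gamma> i \<noteq> [] \<and> hd (\<gamma> i) = x i \<and> last (\<gamma> i) = e i \<and> successively (gadj (even i)) (\<gamma> i) \<and> set (\<gamma> i) \<subseteq> X i" ..
  have g: "\<gamma> i \<noteq> []" "hd (\<gamma> i) = x i" "last (\<gamma> i) = e i" "successively (gadj (even i)) (\<gamma> i)" "set (\<gamma> i) \<subseteq> X i"
    if "i \<in> {1..k}" for i using bspec[OF g' that] by simp_all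
  have len: "2 \<le> length (\<gamma> i)" if i: "i \<in> {1..k}" for i
  proof (rule ccontr)
    assume "\<not> ?thesis"
    moreover have "length (\<gamma> i) \<noteq> 0" using g(1)[OF i] by simp
    ultimately have "length (\<gamma> i) = 1" by linarith
    then have "hd (\<gamma> i) = last (\<gamma> i)" by (auto simp: length_Suc_conv)
    then have "x i = e i" using g(2,3)[OF i] by simp
    then show False using n[OF i] m by simp
  qed
  show ?thesis unfolding arm_event_def mem_Collect_eq
  proof (intro exI[of _ \<gamma>] conjI ballI)
    fix i assume i: "i \<in> {1..k}"
    show "if odd i then open_path \<omega> (\<gamma> i) else closed_star_path \<omega> (\<gamma> i)"
    proof (cases "odd i")
      case True
      then have "gadj (even i) = adj" by (intro ext) (simp add: gadj_def)
      then show ?thesis using True g(4,5)[OF i] X(2)[OF i] len[OF i]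
        by (auto simp: open_path_def is_path_def)
    next
      case False
      then have "gadj (even i) = star_adj" by (intro ext) (simp add: gadj_def)
      then show ?thesis using False g(4,5)[OF i] X(2)[OF i] len[OF i]
        by (auto simp: closed_star_path_def is_star_path_def)
    qed
    show "set (\<gamma> i) \<subseteq> annulus 1 m" using g(5)[OF i] X(1)[OF i] by blast
    show "norm_inf (hd (\<gamma> i)) = int 1" using g(2)[OF i] n(1)[OF i] by simp
    show "norm_inf (last (\<gamma> i)) = int m" using g(3)[OF i] n(2)[OF i] by simp
  next
    show "disjoint_family_on (\<lambda>i. set (\<gamma> i)) {1..k}"
      using dis g(5) unfolding disjoint_family_on_def by blast
    show "ccw_ordered k (\<lambda>i. last (\<gamma> i))"
      using ccw g(3) unfolding ccw_ordered_def by simp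
  qed
qed

lemma rcis_periodic: "rcis r (a + 2 * pi) = rcis r a"
  by (simp add: complex_eq_iff)

text \<open>Two distinct endpoints are always in cyclic order: a full turn is added to the second
  angle when it is the smaller one.\<close>

lemma ccw_ordered_2:
  assumes n: "1 \<le> n" and e: "norm_inf (e 1) = n" "norm_inf (e 2) = n" "e 1 \<noteq> e 2"
  shows "ccw_ordered 2 e"
proof -
  obtain r1 r2 where r: "0 < r1" "point (e 1) = rcis r1 (sang n (e 1))" "0 < r2" "point (e 2) = rcis r2 (sang n (e 2))"
    using sang_rcis[OF n e(1)] sang_rcis[OF n e(2)] by blast
  have "bpos (- n) n (- n) n (e 1) \<noteq> bpos (- n) n (- n) n (e 2)" using bpos_inj[OF n e(1,2)] e(3) by blast
  then have ne: "sang n (e 1) \<noteq> sang n (e 2)"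
    using sang_bpos[OF n e(1,2)] sang_bpos[OF n e(2,1)] by linarith
  have rng: "\<bar>sang n (e 1) - sang n (e 2)\<bar> < 2 * pi"
    using sang_range[OF n e(1)] sang_range[OF n e(2)] by linarith
  have two: "{1..2} = {1, 2 :: nat}" by auto
  let ?\<theta> = "\<lambda>i::nat. if i = 1 then sang n (e 1) else if sang n (e 1) < sang n (e 2) then sang n (e 2) else sang n (e 2) + 2 * pi"
  have pt: "\<exists>r>0. point (e 1) = rcis r (?\<theta> 1)" "\<exists>r>0. point (e 2) = rcis r (?\<theta> 2)"
    using r by (auto simp: rcis_periodic)
  have lt: "?\<theta> 1 < ?\<theta> 2" "?\<theta> 2 < ?\<theta> 1 + 2 * pi" using ne rng by (auto simp: abs_if split: if_splits)
  show ?thesis unfolding ccw_ordered_def point_def[symmetric]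
  proof (intro exI[of _ ?\<theta>] conjI)
    show "\<forall>i\<in>{1..2}. \<exists>r>0. point (e i) = rcis r (?\<theta> i)" unfolding two using pt by blast
    show "strict_mono_on {1..2} ?\<theta>" unfolding two strict_mono_on_def using lt(1) by auto
    show "?\<theta> 2 < ?\<theta> 1 + 2 * pi" by (rule lt(2))
  qed
qed

lemma arms2_arm_event:
  assumes m: "2 \<le> m" and A: "A \<subseteq> box (int m)" and a: "arms2 s (int m) (if s then box (int m) - A else A)"
  shows "(\<lambda>v. v \<in> A) \<in> arm_event 2 1 m"
proof -
  let ?R = "box (int m) - {0}"
  have A': "(box (int m) - A) \<inter> ?R = ?R - A" "?R - (box (int m) - A) = A \<inter> ?R" using A by auto
  obtain x1 e1 x2 e2 where c: "norm_inf x1 = 1" "norm_inf e1 = int m" "norm_inf x2 = 1" "norm_inf e2 = int m"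
    "conn False (A \<inter> ?R) x1 e1" "conn True (?R - A) x2 e2"
    using a unfolding arms2_def by (cases s) (simp_all only: if_True if_False A' not_True_eq_False not_False_eq_True, blast+)
  have ne: "e1 \<noteq> e2" using conn_in(2)[OF c(5)] conn_in(2)[OF c(6)] by blast
  let ?X = "\<lambda>i::nat. if odd i then A \<inter> ?R else ?R - A"
  let ?e = "\<lambda>i::nat. if odd i then e1 else e2"
  let ?x = "\<lambda>i::nat. if odd i then x1 else x2"
  have two: "{1..2} = {1, 2 :: nat}" by auto
  show ?thesis
  proof (rule arm_eventI[OF m, of _ ?X ?x ?e])
    fix i :: nat
    show "conn (even i) (?X i) (?x i) (?e i)" by (cases "odd i") (use c in simp_all)
    show "?X i \<subseteq> annulus 1 m" unfolding annulus_1 by auto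
    show "norm_inf (?x i) = 1" "norm_inf (?e i) = int m" using c by auto
    show "v \<in> A \<longleftrightarrow> odd i" if "v \<in> ?X i" for v using that by (auto split: if_splits)
  next
    show "disjoint_family_on ?X {1..2}" unfolding two by (auto simp: disjoint_family_on_def)
    show "ccw_ordered 2 ?e" by (rule ccw_ordered_2[of "int m"]) (use m c ne in auto)
  qed
qed

lemma arms4I:
  assumes "norm_inf x1 = 1" "norm_inf x2 = 1" "norm_inf x3 = 1" "norm_inf x4 = 1"
    "norm_inf e1 = m" "norm_inf e2 = m" "norm_inf e3 = m" "norm_inf e4 = m"
    "conn s (A \<inter> (box m - {0})) x1 e1" "conn s (A \<inter> (box m - {0})) x3 e3"
    "conn (\<not> s) (box m - {0} - A) x2 e2" "conn (\<not> s) (box m - {0} - A) x4 e4"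
    "interl (- m) m (- m) m e1 e3 e2 e4" "interl (- m) m (- m) m e2 e4 e1 e3"
  shows "arms4 s m A"
  unfolding arms4_def
  by (rule exI[of _ x1], rule exI[of _ x2], rule exI[of _ x3], rule exI[of _ x4],
      rule exI[of _ e1], rule exI[of _ e2], rule exI[of _ e3], rule exI[of _ e4])
    (intro conjI assms)

text \<open>For \<open>s = True\<close> the closed arms take the part of the black ones, so the arms
  are read in the order 2, 1, 4, 3 and the two interlacing conditions are exchanged.\<close>

lemma arm_event_arms4:
  assumes m: "1 \<le> m" and A: "A \<subseteq> box (int m)" and ev: "(\<lambda>v. v \<in> A) \<in> arm_event 4 1 m"
  shows "arms4 s (int m) (if s then box (int m) - A else A)"
proof -
  let ?R = "box (int m) - {0}"
  have A': "(box (int m) - A) \<inter> ?R = ?R - A" "?R - (box (int m) - A) = A \<inter> ?R" using A by auto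
  obtain \<gamma> where g: "\<And>i::nat. i \<in> {1..4} \<Longrightarrow> (if odd i then open_path (\<lambda>v. v \<in> A) (\<gamma> i) else closed_star_path (\<lambda>v. v \<in> A) (\<gamma> i)) \<and>
      set (\<gamma> i) \<subseteq> annulus 1 m \<and> norm_inf (hd (\<gamma> i)) = int 1 \<and> norm_inf (last (\<gamma> i)) = int m"
    and ccw: "ccw_ordered 4 (\<lambda>i. last (\<gamma> i))"
    using ev unfolding arm_event_def by blast
  have adj: "gadj False = adj" "gadj True = star_adj" by (intro ext, simp add: gadj_def)+
  have op: "conn False (A \<inter> ?R) (hd (\<gamma> i)) (last (\<gamma> i))" if "i \<in> {1..4}" "odd i" for i
    by (rule path_conn) (use g[OF that(1), unfolded annulus_1] that(2) in \<open>auto simp: open_path_def is_path_def adj\<close>)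
  have cl: "conn True (?R - A) (hd (\<gamma> i)) (last (\<gamma> i))" if "i \<in> {1..4}" "even i" for i
    by (rule path_conn) (use g[OF that(1), unfolded annulus_1] that(2) in \<open>auto simp: closed_star_path_def is_star_path_def adj\<close>)
  have l: "norm_inf (last (\<gamma> i)) = int m" "norm_inf (hd (\<gamma> i)) = 1" if "i \<in> {1..4}" for i using g[OF that] by auto
  note il = ccw_interl[OF m l(1) ccw]
  have i4: "(1::nat) \<in> {1..4}" "(2::nat) \<in> {1..4}" "(3::nat) \<in> {1..4}" "(4::nat) \<in> {1..4}" by auto
  show ?thesis
  proof (cases s)
    case False
    have "arms4 False (int m) A"
      by (rule arms4I[OF l(2)[OF i4(1)] l(2)[OF i4(2)] l(2)[OF i4(3)] l(2)[OF i4(4)]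
            l(1)[OF i4(1)] l(1)[OF i4(2)] l(1)[OF i4(3)] l(1)[OF i4(4)]])
        (simp_all only: il not_False_eq_True, (rule op cl; simp)+)
    then show ?thesis using False by simp
  next
    case True
    have "arms4 True (int m) (box (int m) - A)"
      by (rule arms4I[OF l(2)[OF i4(2)] l(2)[OF i4(1)] l(2)[OF i4(4)] l(2)[OF i4(3)]
            l(1)[OF i4(2)] l(1)[OF i4(1)] l(1)[OF i4(4)] l(1)[OF i4(3)]])
        (simp_all only: il not_True_eq_False A', (rule op cl; simp)+)
    then show ?thesis using True by simp
  qed
qed

lemma pr_colour: "pr (colour_prob p s) W P = pr p W (\<lambda>A. P (if s then W - A else A))"
  by (cases s) (simp_all add: colour_prob_def pr_def pexp_compl[of "1 - p"])

lemma arm_prob_2_ge: "2 \<le> m \<Longrightarrow> pr (colour_prob p_c s) (box (int m)) (arms2 s (int m)) \<le> arm_prob 2 1 m"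
  unfolding pr_colour arm_prob_eq by (rule pr_mono) (use p_c_bounds arms2_arm_event in auto)

lemma arm_prob_4_le: "1 \<le> m \<Longrightarrow> arm_prob 4 1 m \<le> pr (colour_prob p_c s) (box (int m)) (arms4 s (int m))"
  unfolding pr_colour arm_prob_eq by (rule pr_mono) (use p_c_bounds arm_event_arms4 in auto)

lemma pr_pos:
  assumes "finite W" "0 < b" "b < 1" "A \<subseteq> W" "P A"
  shows "0 < pr b W P"
  unfolding pr_def pexp_def by (rule sum_pos2[of _ A]) (use assms in auto)

lemma conn_ray: "\<bar>a\<bar> + \<bar>b\<bar> = 1 \<Longrightarrow> conn s ((\<lambda>j. (j * a, j * b)) ` {1..int (Suc n)}) (a, b) (int (Suc n) * a, int (Suc n) * b)"
proof (induction n)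
  case 0
  then show ?case by (simp add: conn_refl)
next
  case (Suc n)
  let ?X = "\<lambda>n. (\<lambda>j. (j * a, j * b)) ` {1..int n}"
  have 1: "conn s (?X (Suc (Suc n))) (a, b) (int (Suc n) * a, int (Suc n) * b)"
    by (rule conn_mono[OF Suc.IH[OF Suc.prems]]) (intro image_mono, simp)
  have 2: "conn s (?X (Suc (Suc n))) (int (Suc n) * a, int (Suc n) * b) (int (Suc (Suc n)) * a, int (Suc (Suc n)) * b)"
  proof (rule conn_step)
    show "(int (Suc n) * a, int (Suc n) * b) \<in> ?X (Suc (Suc n))" by (rule image_eqI[of _ _ "int (Suc n)"]) auto
    show "(int (Suc (Suc n)) * a, int (Suc (Suc n)) * b) \<in> ?X (Suc (Suc n))"
      by (rule image_eqI[of _ _ "int (Suc (Suc n))"]) auto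
    show "gadj s (int (Suc n) * a, int (Suc n) * b) (int (Suc (Suc n)) * a, int (Suc (Suc n)) * b)"
      using Suc.prems by (auto simp: gadj_iff algebra_simps)
  qed
  show ?case by (rule conn_trans[OF 1 2])
qed

text \<open>The four half-axes are arms when precisely the vertices of the horizontal axis are open.
  Positivity allows the estimate to be passed to logarithms.\<close>

lemma arm_prob_4_pos:
  assumes m: "2 \<le> m"
  shows "0 < arm_prob 4 1 m"
  unfolding arm_prob_eq
proof (rule pr_pos)
  let ?A = "{v \<in> box (int m). snd v = 0}"
  define a b :: "nat \<Rightarrow> int" where "a i = (if i = 1 then 1 else if i = 3 then - 1 else 0)"
    and "b i = (if i = 2 then 1 else if i = 4 then - 1 else 0)" for i
  define X where "X i = (\<lambda>j. (j * a i, j * b i)) ` {1..int m}" for i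
  have four: "{1..4} = {1, 2, 3, 4 :: nat}" by auto
  have ab: "\<bar>a i\<bar> + \<bar>b i\<bar> = 1" "even i \<longleftrightarrow> a i = 0" if "i \<in> {1..4}" for i
    using that unfolding four a_def b_def by auto
  obtain n where n: "m = Suc n" using m by (cases m) auto
  have c3: "cos (3 * pi / 2) = 0" "sin (3 * pi / 2) = - 1" by (rule cos_sin_three_half_pi)+
  show "(\<lambda>v. v \<in> ?A) \<in> arm_event 4 1 m"
  proof (rule arm_eventI[OF m, of _ X "\<lambda>i. (a i, b i)" "\<lambda>i. (int m * a i, int m * b i)"])
    fix i :: nat assume i: "i \<in> {1..4}"
    show "conn (even i) (X i) (a i, b i) (int m * a i, int m * b i)"
      unfolding X_def n by (rule conn_ray[OF ab(1)[OF i]])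
    show "X i \<subseteq> annulus 1 m"
      using i unfolding four X_def annulus_1 a_def b_def
      by (auto simp: in_box norm_inf_def prod_eq_iff)
    show "v \<in> ?A \<longleftrightarrow> odd i" if "v \<in> X i" for v
      using i that unfolding four X_def a_def b_def by (auto simp: in_box norm_inf_def)
    show "norm_inf (a i, b i) = 1" "norm_inf (int m * a i, int m * b i) = int m"
      using i unfolding four a_def b_def by (auto simp: norm_inf_def)
  next
    show "disjoint_family_on X {1..4}"
      unfolding four disjoint_family_on_def X_def a_def b_def by auto
    show "ccw_ordered 4 (\<lambda>i. (int m * a i, int m * b i))"
      unfolding ccw_ordered_def
    proof (intro exI[of _ "\<lambda>i. (real i - 1) * (pi / 2)"] conjI)
      show "\<forall>i\<in>{1..4}. \<exists>r>0. Complex (of_int (fst (int m * a i, int m * b i))) (of_int (snd (int m * a i, int m * b i))) =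
          rcis r ((real i - 1) * (pi / 2))"
      proof
        fix i :: nat assume i: "i \<in> {1..4}"
        show "\<exists>r>0. Complex (of_int (fst (int m * a i, int m * b i))) (of_int (snd (int m * a i, int m * b i))) =
          rcis r ((real i - 1) * (pi / 2))"
          using i m c3 unfolding four a_def b_def
          by (intro exI[of _ "real m"]) (auto simp: complex_eq_iff)
      qed
      show "strict_mono_on {1..4} (\<lambda>i::nat. (real i - 1) * (pi / 2))"
        by (auto simp: strict_mono_on_def)
      show "(real 4 - 1) * (pi / 2) < (real 1 - 1) * (pi / 2) + 2 * pi" by simp
    qed
  qed
qed (use p_c_bounds in auto)

section \<open>From the estimate at comparable scales to the exponents\<close>

lemma arm_const_nonneg: "0 \<le> arm_const p_c"
proof -
  have "0 < rsw_const (min p_c (1 - p_c) / 2)" by (rule rsw_const_pos) (use p_c_bounds in simp)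
  then show ?thesis unfolding arm_const_def Let_def using p_c_bounds by simp
qed

lemma arm_prob_4_le_2:
  assumes N: "16 \<le> N"
  shows "\<exists>k. N \<le> 16 * k \<and> 4 * k \<le> N \<and> arm_prob 4 1 N \<le> arm_const p_c / real k * sqrt (arm_prob 2 1 (2 * k))"
proof -
  have p: "0 \<le> p_c" "p_c \<le> 1" using p_c_bounds by auto
  \<comment> \<open>A scale \<open>k\<close> between \<open>N div 8\<close> and twice that satisfies
    \<open>4 * k \<le> N\<close>; and \<open>N \<le> 16 * k\<close> because \<open>N\<close> is less
    than \<open>8 * (N div 8) + 8\<close>.\<close>
  have n: "1 \<le> int (N div 8)" "2 \<le> int (N div 8)" using N by linarith+
  obtain k' s where k': "int (N div 8) \<le> k'" "k' \<le> 2 * int (N div 8)"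
    "min p_c (1 - p_c) / 2 \<le> hp s (colour_prob p_c s) 0 (k' - 1) 0 (k' - 1)"
    "min p_c (1 - p_c) / 2 \<le> hp s (colour_prob p_c s) 0 (2 * k' - 1) 0 (2 * k' - 1)"
    using good_scale[OF p n(1)] by blast
  define k where "k = nat k'"
  have k: "k' = int k" unfolding k_def using k'(1) n by simp
  \<comment> \<open>The colour \<open>s\<close> has the likely crossings, so the clusters to be
    counted are those of the opposite colour.\<close>
  let ?b = "colour_prob p_c (\<not> s)"
  have b: "0 < ?b" "?b < 1" "1 - ?b = colour_prob p_c s" "min ?b (1 - ?b) = min p_c (1 - p_c)" "arm_const ?b = arm_const p_c"
    using p_c_bounds arm_const_sym[of p_c] by (auto simp: colour_prob_def min.commute)
  have kN: "2 \<le> k" "N \<le> 16 * k" "4 * k \<le> N" using k'(1,2) n N unfolding k by linarith+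
  note a0 = arm_const_nonneg
  have "arm_prob 4 1 N \<le> pr ?b (box (int N)) (arms4 (\<not> s) (int N))" by (rule arm_prob_4_le) (use N in simp)
  also have "\<dots> \<le> arm_const ?b / int k * sqrt (pr ?b (box (2 * int k)) (arms2 (\<not> s) (2 * int k)))"
    by (rule arms4_le) (use b(1,2) kN k'(3,4)[unfolded k] in \<open>simp_all add: b(3) b(4)[unfolded b(3)]\<close>)
  also have "\<dots> \<le> arm_const ?b / real k * sqrt (arm_prob 2 1 (2 * k))"
  proof -
    have "pr ?b (box (2 * int k)) (arms2 (\<not> s) (2 * int k)) \<le> arm_prob 2 1 (2 * k)"
      using arm_prob_2_ge[of "2 * k" "\<not> s"] kN by simp
    then show ?thesis unfolding b(5) of_int_of_nat_eq using a0 by (intro mult_left_mono real_sqrt_le_mono divide_nonneg_nonneg) auto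
  qed
  finally show ?thesis unfolding b(5) using kN by blast
qed

text \<open>Since \<open>k\<close> is comparable to \<open>n\<close>, replacing \<open>k\<close> and
  \<open>2 * k\<close> by \<open>n\<close> inside the logarithms costs a bounded error, which
  vanishes after division by \<open>ln n\<close>. Working with numbers below the bound avoids any
  assumption on finiteness of the exponents.\<close>

lemma exponent_inequality:
  fixes f g :: "nat \<Rightarrow> real"
  assumes C0: "0 \<le> C" and pos: "\<And>n. 2 \<le> n \<Longrightarrow> 0 < f n"
    and bound: "\<And>n. 16 \<le> n \<Longrightarrow> \<exists>k. n \<le> 16 * k \<and> 4 * k \<le> n \<and> f n \<le> C / real k * sqrt (g (2 * k))"
  shows "1 + (- limsup (\<lambda>n. ereal (ln (g n) / ln (real n)))) / 2 \<le> - limsup (\<lambda>n. ereal (ln (f n) / ln (real n)))"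
proof (rule dense_le)
  let ?\<alpha> = "- limsup (\<lambda>n. ereal (ln (g n) / ln (real n)))"
  fix x assume x: "x < 1 + ?\<alpha> / 2"
  show "x \<le> - limsup (\<lambda>n. ereal (ln (f n) / ln (real n)))"
  proof (cases x)
    case (real r)
    \<comment> \<open>Chosen so that \<open>r = 1 + a / 2\<close>.\<close>
    define a where "a = 2 * (r - 1)"
    have "ereal a < ?\<alpha>"
      using x unfolding real a_def by (cases ?\<alpha>) (auto simp: one_ereal_def field_simps)
    then have "limsup (\<lambda>n. ereal (ln (g n) / ln (real n))) < ereal (- a)"
      using ereal_minus_less_minus[of ?\<alpha> "ereal a"] ereal_less_uminus_reorder[of "ereal a"] by (simp add: ereal_less_uminus_reorder)
    from Limsup_lessD[OF this] obtain M where M: "\<And>n. M \<le> n \<Longrightarrow> ln (g n) / ln (real n) < - a"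
      unfolding eventually_sequentially by auto
    \<comment> \<open>\<open>ln 16\<close> comes from \<open>n \<le> 16 * k\<close>, and
      \<open>ln 8\<close> bounds the distance between \<open>ln (2 * k)\<close> and
      \<open>ln n\<close>.\<close>
    define D where "D = ln C + ln 16 + \<bar>a\<bar> / 2 * ln 8"
    have main: "ln (f n) / ln (real n) \<le> - r + D / ln (real n)" if n: "max 16 (16 * M) \<le> n" for n
    proof -
      obtain k where k: "n \<le> 16 * k" "4 * k \<le> n" "f n \<le> C / real k * sqrt (g (2 * k))"
        using bound[of n] n by auto
      have k1: "1 \<le> k" "M \<le> 2 * k" using k(1) n by auto
      have fn: "0 < f n" using pos n by simp
      have "0 < C / real k * sqrt (g (2 * k))" using fn k(3) by linarith
      \<comment> \<open>Positivity of \<open>f n\<close> forces \<open>C\<close> and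
        \<open>g (2 * k)\<close> to be positive, so that the logarithm of the product
        splits.\<close>
      have pr: "0 < C / real k" "0 < g (2 * k)"
        using \<open>0 < C / real k * sqrt (g (2 * k))\<close> C0 by (auto simp: zero_less_mult_iff zero_less_divide_iff)
      have C: "0 < C" using pr(1) k1 by (simp add: zero_less_divide_iff)
      have "ln (f n) \<le> ln (C / real k * sqrt (g (2 * k)))" using fn k(3) by simp
      also have "\<dots> = ln C - ln (real k) + ln (g (2 * k)) / 2"
        using C k1 pr by (simp add: ln_mult ln_div ln_sqrt)
      finally have 1: "ln (f n) \<le> ln C - ln (real k) + ln (g (2 * k)) / 2" .
      have l2k: "0 < ln (real (2 * k))" using k1 by simp
      have 2: "ln (g (2 * k)) < - a * ln (real (2 * k))"
        using M[OF k1(2)] l2k by (simp add: pos_divide_less_eq)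
      have 3: "ln (real n) \<le> ln 16 + ln (real k)"
      proof -
        have "ln (real n) \<le> ln (16 * real k)" using k(1) n by simp
        then show ?thesis using k1 by (simp add: ln_mult)
      qed
      have 4: "\<bar>ln (real (2 * k)) - ln (real n)\<bar> \<le> ln 8"
      proof -
        have "ln (real n) \<le> ln (8 * real (2 * k))" using k(1) n by simp
        then have "ln (real n) \<le> ln 8 + ln (real (2 * k))" using k1 ln_mult[of 8 "real (2 * k)"] by simp
        moreover have "ln (real (2 * k)) \<le> ln (real n)" using k(2) k1 by simp
        moreover have "0 \<le> ln (8 :: real)" by simp
        ultimately show ?thesis by linarith
      qed
      have "- a * ln (real (2 * k)) \<le> - a * ln (real n) + \<bar>a\<bar> * ln 8"
      proof -
        have "- a * (ln (real (2 * k)) - ln (real n)) \<le> \<bar>a\<bar> * \<bar>ln (real (2 * k)) - ln (real n)\<bar>"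
          by (metis abs_ge_self abs_minus_cancel abs_mult)
        also have "\<dots> \<le> \<bar>a\<bar> * ln 8" by (rule mult_left_mono[OF 4]) simp
        finally show ?thesis by (simp add: algebra_simps)
      qed
      then have "ln (f n) \<le> - r * ln (real n) + D"
        using 1 2 3 unfolding D_def a_def by (simp add: algebra_simps)
      moreover have "0 < ln (real n)" using n by simp
      ultimately show ?thesis by (simp add: field_simps)
    qed
    have "(\<lambda>n. - r + D / ln (real n)) \<longlonglongrightarrow> - r + 0"
      by (intro tendsto_add tendsto_const tendsto_divide_0[OF tendsto_const]
          filterlim_at_top_imp_at_infinity filterlim_compose[OF ln_at_top] filterlim_real_sequentially)
    then have "(\<lambda>n. ereal (- r + D / ln (real n))) \<longlonglongrightarrow> ereal (- r)" by simp
    then have L: "limsup (\<lambda>n. ereal (- r + D / ln (real n))) = ereal (- r)"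
      by (rule lim_imp_Limsup[OF trivial_limit_sequentially])
    have "limsup (\<lambda>n. ereal (ln (f n) / ln (real n))) \<le> limsup (\<lambda>n. ereal (- r + D / ln (real n)))"
      by (rule Limsup_mono) (unfold eventually_sequentially, intro exI[of _ "max 16 (16 * M)"], use main in auto)
    then have "limsup (\<lambda>n. ereal (ln (f n) / ln (real n))) \<le> - ereal r" unfolding L by simp
    then show ?thesis unfolding real by (subst ereal_minus_le_minus[symmetric]) simp
  qed (use x in auto)
qed

theorem theorem1p1:
  "arm_exponent 4 \<ge> 1 + arm_exponent 2 / 2"
  unfolding arm_exponent_def
  by (rule exponent_inequality[OF arm_const_nonneg arm_prob_4_pos arm_prob_4_le_2])

end
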